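(* Let $\mu\in\mathbb{R}$, let $f\in L^2(\mathbb{S}^2)$ with Fourier–Laplace coefficients $(f_{\ell,m})_{\ell=0,1,\dots;\ m=-\ell,\dots,\ell}$, and let $$u(t,x)=\mathbb{E}_x[f(W^\mu_\Phi(t))],\qquad t\ge0,\ x\in\mathbb{S}^2 .$$ Then, for all $t\ge0$, $$u(t)=\sum_{\ell=0}^{+\infty}\sum_{m=-\ell}^{\ell}f_{\ell,m}\,\mathfrak{e}_\Phi(t;i\mu m-\ell(\ell+1))\,Y_{\ell,m}$$ (with convergence of the series in $L^2(\mathbb{S}^2)$). Furthermore, $u\in C([0,\infty);L^2(\mathbb{S}^2))\cap C((0,\infty);H^2(\mathbb{S}^2))$.
   Context: Sphere. $\mathbb{S}^2\subset\mathbb{R}^3$ is the unit sphere with the round metric $g$, surface measure $\sigma$ and spherical coordinates $(\sin\theta\cos\varphi,\sin\theta\sin\varphi,\cos\theta)$, $\theta\in[0,\pi]$, $\varphi\in[0,2\pi)$. Functions are complex-valued, $L^2(\mathbb{S}^2)=L^2(\mathbb{S}^2,\sigma)$. $\Delta_g$ is the Laplace–Beltrami operator, $X_\mu$ is the smooth vector field equal to $\mu\,\partial/\partial\varphi$ in spherical coordinates (and zero at the poles), and $\mathcal{G}_\mu=\Delta_g+X_\mu$. The spherical harmonics are $Y_{\ell,m}(\theta,\varphi)=\sqrt{\frac{(2\ell+1)(\ell-m)!}{4\pi(\ell+m)!}}P_\ell^m(\cos\theta)e^{im\varphi}$, $\ell=0,1,\dots$, $m=-\ell,\dots,\ell$,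 with $P_\ell^m(x)=\frac{(-1)^m}{2^\ell\ell!}(1-x^2)^{m/2}\frac{d^{\ell+m}}{dx^{\ell+m}}(x^2-1)^\ell$; they form an orthonormal basis of $L^2(\mathbb{S}^2)$. The Fourier–Laplace coefficients of $f\in L^2(\mathbb{S}^2)$ are $f_{\ell,m}=\int_{\mathbb{S}^2}f\,\overline{Y}_{\ell,m}\,d\sigma$, and $A_\ell(f)=\sum_{m=-\ell}^{\ell}|f_{\ell,m}|^2$. $H^s(\mathbb{S}^2)$, $s\ge0$, is the set of $f\in L^2(\mathbb{S}^2)$ with $[f]_{H^s}^2:=\sum_{\ell\ge0}\ell^{2s}A_\ell(f)<\infty$, with norm $\|f\|_{L^2}+[f]_{H^s}$. Subordinator. $\Phi(\lambda)=\int_0^{+\infty}(1-e^{-\lambda t})\nu_\Phi(dt)$, $\lambda\ge0$, where $\nu_\Phi$ is a measure on $(0,+\infty)$ with $\int_0^{+\infty}(1\wedge t)\nu_\Phi(dt)<\infty$ and $\nu_\Phi(0,+\infty)=+\infty$. $S_\Phi$ is a subordinator (increasing Lévy process with $S_\Phi(0)=0$) with $\mathbb{E}[e^{-\lambda S_\Phi(t)}]=e^{-t\Phi(\lambda)}$, $L_\Phi(t)=\inf\{s>0:S_\Phi(s)>t\}$, and $\mathfrak{e}_\Phi(t;\lambda)=\mathbb{E}[e^{\lambda L_\Phi(t)}]$ for $\lambda\in\mathbb{C}$, $t\ge0$. Process. $W^\mu$ is the diffusion (Feller) process on $\mathbb{S}^2$ generated by $\mathcal{G}_\mu$ (spherical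 Brownian motion with longitudinal drift), $S_\Phi$ is independent of $W^\mu$, and $W^\mu_\Phi(t):=W^\mu(L_\Phi(t))$. $\mathbb{E}_x$ is expectation conditional on $W^\mu(0)=W_\Phi^\mu(0)=x$. *)

theory Defs
  imports "HOL-Probability.Probability"
begin

section \<open>The unit sphere\<close>

abbreviation S2 :: "(real^3) set" where
  "S2 \<equiv> sphere 0 1"

definition sph :: "real \<Rightarrow> real \<Rightarrow> real^3" where
  "sph \<theta> \<phi> = vector [sin \<theta> * cos \<phi>, sin \<theta> * sin \<phi>, cos \<theta>]"

definition colatitude :: "real^3 \<Rightarrow> real" where
  "colatitude x = arccos (x $ 3)"

text \<open>Takes values in \<open>[0, 2 * pi)\<close>; it is \<open>0\<close> at the poles.\<close>

definition longitude :: "real^3 \<Rightarrow> real" where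
  "longitude x = Arg2pi (Complex (x $ 1) (x $ 2))"

definition poles :: "(real^3) set" where
  "poles = {sph 0 0, sph pi 0}"

text \<open>The density \<open>sin \<theta>\<close> is the Riemannian area element of
  \<open>g = d\<theta>\<^sup>2 + sin\<^sup>2 \<theta> d\<phi>\<^sup>2\<close>.\<close>

definition surface_measure :: "(real^3) measure" where
  "surface_measure =
     distr (density (restrict_space lborel ({0..pi} \<times> {0..<2 * pi})) (\<lambda>(\<theta>, \<phi>). ennreal (sin \<theta>)))
       (restrict_space borel S2) (\<lambda>(\<theta>, \<phi>). sph \<theta> \<phi>)"

section \<open>Spherical harmonics and Sobolev spaces\<close>

text \<open>For \<open>m < 0\<close> the power of \<open>1 - x\<^sup>2\<close> is singular at \<open>\<plusminus>1\<close>, where the associated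
  Legendre function vanishes by continuity; \<open>0 powi m = 0\<close> for \<open>m \<noteq> 0\<close> and
  \<open>0 powi 0 = 1\<close> (unlike \<open>0 powr 0\<close>) give the right values there.\<close>

definition assoc_legendre :: "nat \<Rightarrow> int \<Rightarrow> real \<Rightarrow> real" where
  "assoc_legendre l m x =
     (-1) powi m / (2 ^ l * fact l) * (sqrt (1 - x\<^sup>2) powi m)
       * (deriv ^^ nat (int l + m)) (\<lambda>y. (y\<^sup>2 - 1) ^ l) x"

definition sph_harm :: "nat \<Rightarrow> int \<Rightarrow> real^3 \<Rightarrow> complex" where
  "sph_harm l m x =
     complex_of_real
       (sqrt ((2 * real l + 1) * fact (nat (int l - m)) / (4 * pi * fact (nat (int l + m))))
         * assoc_legendre l m (cos (colatitude x)))
     * exp (\<i> * of_int m * of_real (longitude x))"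

definition L2 :: "(real^3 \<Rightarrow> complex) \<Rightarrow> bool" where
  "L2 f \<longleftrightarrow> f \<in> borel_measurable surface_measure
     \<and> integrable surface_measure (\<lambda>x. (cmod (f x))\<^sup>2)"

definition L2_norm :: "(real^3 \<Rightarrow> complex) \<Rightarrow> real" where
  "L2_norm f = sqrt (LINT x|surface_measure. (cmod (f x))\<^sup>2)"

definition fourier_laplace :: "(real^3 \<Rightarrow> complex) \<Rightarrow> nat \<Rightarrow> int \<Rightarrow> complex" where
  "fourier_laplace f l m = (LINT x|surface_measure. f x * cnj (sph_harm l m x))"

definition power_spectrum :: "(real^3 \<Rightarrow> complex) \<Rightarrow> nat \<Rightarrow> real" where
  "power_spectrum f l = (\<Sum>m\<in>{- int l..int l}. (cmod (fourier_laplace f l m))\<^sup>2)"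

text \<open>Since \<open>0 powr 0 = 0\<close>, the term \<open>l = 0\<close> is dropped also for \<open>s = 0\<close>, which does not
  change the space and gives an equivalent norm.\<close>

definition Hs :: "real \<Rightarrow> (real^3 \<Rightarrow> complex) \<Rightarrow> bool" where
  "Hs s f \<longleftrightarrow> L2 f \<and> summable (\<lambda>l. real l powr (2 * s) * power_spectrum f l)"

definition Hs_seminorm :: "real \<Rightarrow> (real^3 \<Rightarrow> complex) \<Rightarrow> real" where
  "Hs_seminorm s f = sqrt (\<Sum>l. real l powr (2 * s) * power_spectrum f l)"

definition Hs_norm :: "real \<Rightarrow> (real^3 \<Rightarrow> complex) \<Rightarrow> real" where
  "Hs_norm s f = L2_norm f + Hs_seminorm s f"

text \<open>\<open>u \<in> C(I; X)\<close>, where \<open>X\<close> is given by its membership predicate and its norm.\<close>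

definition continuous_curve ::
    "((real^3 \<Rightarrow> complex) \<Rightarrow> bool) \<Rightarrow> ((real^3 \<Rightarrow> complex) \<Rightarrow> real) \<Rightarrow> real set
      \<Rightarrow> (real \<Rightarrow> real^3 \<Rightarrow> complex) \<Rightarrow> bool" where
  "continuous_curve X nrm I u \<longleftrightarrow>
     (\<forall>t\<in>I. X (u t))
     \<and> (\<forall>t\<in>I. ((\<lambda>r. nrm (\<lambda>x. u r x - u t x)) \<longlongrightarrow> 0) (at t within I))"

section \<open>The operator \<open>\<Delta> + X\<close>\<close>

primrec Ck_on :: "nat \<Rightarrow> ('a::euclidean_space \<Rightarrow> 'b::real_normed_vector) \<Rightarrow> 'a set \<Rightarrow> bool" where
  "Ck_on 0 f U \<longleftrightarrow> continuous_on U f"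
| "Ck_on (Suc k) f U \<longleftrightarrow>
     f differentiable_on U \<and> (\<forall>v. Ck_on k (\<lambda>x. frechet_derivative f (at x) v) U)"

definition smooth_on_sphere :: "(real^3 \<Rightarrow> complex) \<Rightarrow> bool" where
  "smooth_on_sphere f \<longleftrightarrow>
     (\<exists>U F. open U \<and> S2 \<subseteq> U \<and> (\<forall>k. Ck_on k F U) \<and> (\<forall>x\<in>S2. F x = f x))"

text \<open>The coordinate formula
  \<open>1 / sqrt (det g) * \<partial>\<^sub>i (sqrt (det g) * g\<^sup>i\<^sup>j * \<partial>\<^sub>j f)\<close> in the chart \<open>(\<theta>, \<phi>)\<close>.\<close>

definition laplace_beltrami_chart :: "(real^3 \<Rightarrow> complex) \<Rightarrow> real \<Rightarrow> real \<Rightarrow> complex" where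
  "laplace_beltrami_chart f \<theta> \<phi> =
     (1 / sin \<theta>) *\<^sub>R
       vector_derivative
         (\<lambda>a. sin a *\<^sub>R vector_derivative (\<lambda>b. f (sph b \<phi>)) (at a)) (at \<theta>)
     + (1 / (sin \<theta>)\<^sup>2) *\<^sub>R
       vector_derivative (\<lambda>a. vector_derivative (\<lambda>b. f (sph \<theta> b)) (at a)) (at \<phi>)"

text \<open>At the poles, which the chart does not cover, the value is the continuous extension.\<close>

definition laplace_beltrami :: "(real^3 \<Rightarrow> complex) \<Rightarrow> real^3 \<Rightarrow> complex" where
  "laplace_beltrami f x =
     (if x \<in> poles
      then Lim (at x within S2 - poles)
             (\<lambda>y. laplace_beltrami_chart f (colatitude y) (longitude y))
      else laplace_beltrami_chart f (colatitude x) (longitude x))"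

text \<open>The curve \<open>\<phi> \<mapsto> sph \<theta> \<phi>\<close> is constant at the poles, so this is \<open>0\<close> there.\<close>

definition drift_field :: "real \<Rightarrow> (real^3 \<Rightarrow> complex) \<Rightarrow> real^3 \<Rightarrow> complex" where
  "drift_field \<mu> f x =
     \<mu> *\<^sub>R vector_derivative (\<lambda>\<phi>. f (sph (colatitude x) \<phi>)) (at (longitude x))"

definition drift_operator :: "real \<Rightarrow> (real^3 \<Rightarrow> complex) \<Rightarrow> real^3 \<Rightarrow> complex" where
  "drift_operator \<mu> f x = laplace_beltrami f x + drift_field \<mu> f x"

section \<open>The diffusion on the sphere\<close>

text \<open>The sigma-algebra generated by the variables \<open>X t\<close>, \<open>t \<in> I\<close>.\<close>

definition process_events ::
    "'w measure \<Rightarrow> real set \<Rightarrow> (real \<Rightarrow> 'w \<Rightarrow> 'b::topological_space) \<Rightarrow> 'w set set" where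
  "process_events M I X =
     sigma_sets (space M) {X t -` B \<inter> space M |t B. t \<in> I \<and> B \<in> sets borel}"

definition transition_op ::
    "(real^3 \<Rightarrow> 'w measure) \<Rightarrow> (real \<Rightarrow> 'w \<Rightarrow> real^3) \<Rightarrow> real
      \<Rightarrow> (real^3 \<Rightarrow> complex) \<Rightarrow> real^3 \<Rightarrow> complex" where
  "transition_op P W t g x = (LINT \<omega>|P x. g (W t \<omega>))"

text \<open>A Feller process with continuous paths on the sphere: \<open>P x\<close> is the law on the sample
  space \<open>(space M, sets M)\<close> of the process started at \<open>x\<close>. The Markov property is with
  respect to the natural filtration and is spelled out as the defining property of the
  conditional expectation of \<open>g (W (s + t))\<close> given the past up to time \<open>s\<close>.\<close>

definition feller_diffusion ::
    "'w measure \<Rightarrow> (real^3 \<Rightarrow> 'w measure) \<Rightarrow> (real \<Rightarrow> 'w \<Rightarrow> real^3) \<Rightarrow> bool" where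
  "feller_diffusion M P W \<longleftrightarrow>
     (\<forall>x\<in>S2. prob_space (P x) \<and> sets (P x) = sets M)
     \<and> (\<forall>t\<ge>0. W t \<in> measurable M (restrict_space borel S2))
     \<and> (\<forall>\<omega>\<in>space M. continuous_on {0..} (\<lambda>t. W t \<omega>))
     \<and> (\<forall>x\<in>S2. AE \<omega> in P x. W 0 \<omega> = x)
     \<and> (\<forall>x\<in>S2. \<forall>s\<ge>0. \<forall>t\<ge>0. \<forall>A\<in>process_events M {0..s} W. \<forall>g. continuous_on S2 g \<longrightarrow>
          (LINT \<omega>:A|P x. g (W (s + t) \<omega>))
            = (LINT \<omega>:A|P x. transition_op P W t g (W s \<omega>)))
     \<and> (\<forall>t\<ge>0. \<forall>g. continuous_on S2 g \<longrightarrow> continuous_on S2 (transition_op P W t g))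
     \<and> (\<forall>g. continuous_on S2 g \<longrightarrow>
          uniform_limit S2 (\<lambda>t. transition_op P W t g) g (at_right 0))"

text \<open>The infinitesimal generator on \<open>C(S2)\<close>, as a graph. Functions on the sphere are
  represented by functions on \<open>real^3\<close> whose values off the sphere are irrelevant.\<close>

definition feller_generator ::
    "(real \<Rightarrow> (real^3 \<Rightarrow> complex) \<Rightarrow> real^3 \<Rightarrow> complex)
      \<Rightarrow> ((real^3 \<Rightarrow> complex) \<times> (real^3 \<Rightarrow> complex)) set" where
  "feller_generator T =
     {(g, h). continuous_on S2 g \<and> continuous_on S2 h \<and>
        uniform_limit S2 (\<lambda>t x. (T t g x - g x) /\<^sub>R t) h (at_right 0)}"

text \<open>The closure in \<open>C(S2) \<times> C(S2)\<close> of the graph of \<open>A\<close> on the smooth functions.\<close>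

definition closure_of_operator ::
    "((real^3 \<Rightarrow> complex) \<Rightarrow> real^3 \<Rightarrow> complex)
      \<Rightarrow> ((real^3 \<Rightarrow> complex) \<times> (real^3 \<Rightarrow> complex)) set" where
  "closure_of_operator A =
     {(g, h). \<exists>G. (\<forall>n. smooth_on_sphere (G n))
        \<and> uniform_limit S2 G g sequentially
        \<and> uniform_limit S2 (\<lambda>n. A (G n)) h sequentially}"

definition spherical_BM_with_drift ::
    "real \<Rightarrow> 'w measure \<Rightarrow> (real^3 \<Rightarrow> 'w measure) \<Rightarrow> (real \<Rightarrow> 'w \<Rightarrow> real^3) \<Rightarrow> bool" where
  "spherical_BM_with_drift \<mu> M P W \<longleftrightarrow>
     feller_diffusion M P W
     \<and> feller_generator (transition_op P W) = closure_of_operator (drift_operator \<mu>)"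

section \<open>The subordinator and its inverse\<close>

definition levy_measure :: "real measure \<Rightarrow> bool" where
  "levy_measure \<nu> \<longleftrightarrow> sets \<nu> = sets borel \<and> emeasure \<nu> {..0} = 0
     \<and> (\<integral>\<^sup>+ t. ennreal (min 1 t) \<partial>\<nu>) < \<infinity> \<and> emeasure \<nu> {0<..} = \<infinity>"

definition laplace_exponent :: "real measure \<Rightarrow> real \<Rightarrow> real" where
  "laplace_exponent \<nu> z = (LINT t|\<nu>. 1 - exp (- z * t))"

definition levy_process :: "'w measure \<Rightarrow> (real \<Rightarrow> 'w \<Rightarrow> real) \<Rightarrow> bool" where
  "levy_process M X \<longleftrightarrow>
     prob_space M
     \<and> (\<forall>t\<ge>0. X t \<in> borel_measurable M)
     \<and> (\<forall>\<omega>\<in>space M. X 0 \<omega> = 0)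
     \<and> (\<forall>n. \<forall>\<tau>::nat \<Rightarrow> real. 0 \<le> \<tau> 0 \<and> mono \<tau> \<longrightarrow>
          prob_space.indep_vars M (\<lambda>_. borel) (\<lambda>i \<omega>. X (\<tau> (Suc i)) \<omega> - X (\<tau> i) \<omega>) {..<n})
     \<and> (\<forall>s\<ge>0. \<forall>t\<ge>0. distr M borel (\<lambda>\<omega>. X (s + t) \<omega> - X s \<omega>) = distr M borel (X t))
     \<and> (\<forall>\<omega>\<in>space M. \<forall>t\<ge>0. continuous (at_right t) (\<lambda>r. X r \<omega>))
     \<and> (\<forall>\<omega>\<in>space M. \<forall>t>0. \<exists>l. ((\<lambda>r. X r \<omega>) \<longlongrightarrow> l) (at_left t))"

definition subordinator :: "real measure \<Rightarrow> 'w measure \<Rightarrow> (real \<Rightarrow> 'w \<Rightarrow> real) \<Rightarrow> bool" where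
  "subordinator \<nu> M S \<longleftrightarrow>
     levy_process M S
     \<and> (\<forall>\<omega>\<in>space M. mono_on {0..} (\<lambda>t. S t \<omega>))
     \<and> (\<forall>t\<ge>0. \<forall>z\<ge>0. (LINT \<omega>|M. exp (- z * S t \<omega>)) = exp (- t * laplace_exponent \<nu> z))"

text \<open>The set is empty only on the null event that the path of \<open>S\<close> is bounded by \<open>t\<close>;
  the value \<open>0\<close> chosen there keeps the inverse measurable and nonnegative.\<close>

definition inverse_subordinator :: "(real \<Rightarrow> 'w \<Rightarrow> real) \<Rightarrow> real \<Rightarrow> 'w \<Rightarrow> real" where
  "inverse_subordinator S t \<omega> =
     (if \<exists>s>0. S s \<omega> > t then Inf {s. s > 0 \<and> S s \<omega> > t} else 0)"

definition exp_moment_inverse ::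
    "'w measure \<Rightarrow> (real \<Rightarrow> 'w \<Rightarrow> real) \<Rightarrow> real \<Rightarrow> complex \<Rightarrow> complex" where
  "exp_moment_inverse M S t z =
     (LINT \<omega>|M. exp (z * of_real (inverse_subordinator S t \<omega>)))"

definition independent_processes ::
    "'w measure \<Rightarrow> (real \<Rightarrow> 'w \<Rightarrow> 'b::topological_space)
      \<Rightarrow> (real \<Rightarrow> 'w \<Rightarrow> 'c::topological_space) \<Rightarrow> bool" where
  "independent_processes M X Y \<longleftrightarrow>
     prob_space.indep_set M (process_events M {0..} X) (process_events M {0..} Y)"

definition time_changed ::
    "(real \<Rightarrow> 'w \<Rightarrow> real^3) \<Rightarrow> (real \<Rightarrow> 'w \<Rightarrow> real) \<Rightarrow> real \<Rightarrow> 'w \<Rightarrow> real^3" where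
  "time_changed W S t \<omega> = W (inverse_subordinator S t \<omega>) \<omega>"

end

theory Submission
  imports Defs "HOL-Computational_Algebra.Polynomial" "HOL-Real_Asymp.Real_Asymp"
begin

text \<open>
  The proof is spectral. Put \<open>\<lambda>\<^sub>l\<^sub>m = i \<mu> m - l (l + 1)\<close>. The spherical harmonic \<open>Y\<^sub>l\<^sub>m\<close> is smooth and
  an eigenfunction of \<open>\<Delta> + X\<^sub>\<mu>\<close> with eigenvalue \<open>\<lambda>\<^sub>l\<^sub>m\<close>, so it lies in the domain of the Feller
  generator, and the Feller semigroup multiplies it by \<open>exp (\<lambda>\<^sub>l\<^sub>m t)\<close> (\<open>T_eigenfunction\<close>).
  Conditioning on the inverse subordinator, which is independent of the diffusion, replaces the
  exponential by its mean: \<open>\<E>\<^sub>x Y\<^sub>l\<^sub>m(W\<^sub>\<Phi>(t)) = e\<^sub>l\<^sub>m(t) Y\<^sub>l\<^sub>m(x)\<close> with \<open>e\<^sub>l\<^sub>m(t) = \<E> exp (\<lambda>\<^sub>l\<^sub>m L\<^sub>\<Phi>(t))\<close>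
  (\<open>independent_random_time\<close>). The multiplier does not depend on \<open>x\<close>, because the Laplace exponent
  determines the law of the subordinator and hence that of its inverse (\<open>exp_moment_unique\<close>).

  Thus the laws of \<open>W\<^sub>\<Phi>(t)\<close> form a Markov kernel on the sphere that is diagonal in the spherical
  harmonics. Such a kernel preserves the integral of every finite sum of harmonics, since all
  harmonics but the constant one have integral \<open>0\<close>; as these sums are uniformly dense in the
  continuous functions, it preserves the surface measure (\<open>surface_measure_invariant\<close>). By Jensen's
  inequality it is then a contraction of \<open>L\<^sup>2\<close>. This makes \<open>u(t)\<close> meaningful for \<open>f\<close> in \<open>L\<^sup>2\<close>, which is
  only determined up to null sets, and extends the expansion from finite sums to \<open>f\<close>
  (\<open>avg_expansion\<close>).

  The regularity in time is read off the multipliers. By Parseval's identity the distance of \<open>u(r)\<close>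
  and \<open>u(t)\<close> in \<open>L\<^sup>2\<close> or \<open>H\<^sup>2\<close> is a series over \<open>l\<close> with terms \<open>\<Sum>\<^sub>m \<bar>f\<^sub>l\<^sub>m (e\<^sub>l\<^sub>m(r) - e\<^sub>l\<^sub>m(t))\<bar>\<^sup>2\<close>, in
  the second case weighted by \<open>l\<^sup>4\<close>. Each term tends to \<open>0\<close> as \<open>r\<close> tends to \<open>t\<close>: the subordinator is
  strictly increasing, because its Levy measure is infinite, so its inverse has continuous paths.
  The series is dominated by a multiple of \<open>\<Sum>\<^sub>l A\<^sub>l(f)\<close>, in \<open>L\<^sup>2\<close> because \<open>\<bar>e\<^sub>l\<^sub>m\<bar> \<le> 1\<close> and in \<open>H\<^sup>2\<close>
  because \<open>e\<^sub>l\<^sub>m(r) = O(l\<^sup>-\<^sup>2)\<close> uniformly for \<open>r\<close> away from \<open>0\<close> (\<open>exp_moment_bound\<close>); the latter holds since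
  the inverse is rarely small, \<open>P(L\<^sub>\<Phi>(t) < s) = O(s)\<close>.

  The underlying facts about spherical harmonics (orthonormality, the eigenvalue equation and
  completeness) are derived from Rodrigues' formula in the Cartesian form
  \<open>Y\<^sub>l\<^sub>m(x) = c q(x\<^sub>3) (x\<^sub>1 \<plusminus> i x\<^sub>2)\<^sup>\<bar>\<^sup>m\<^sup>\<bar>\<close>, where \<open>q\<close> is a derivative of \<open>(y\<^sup>2 - 1)\<^sup>l\<close> of order \<open>l + \<bar>m\<bar>\<close>.
\<close>

section \<open>Derivatives of \<open>(x\<^sup>2 - 1)\<^sup>l\<close>\<close>

lemma poly_eqI_eval: "(\<And>x. poly p x = poly q x) \<Longrightarrow> p = (q :: real poly)"
  by (simp add: poly_eq_poly_eq_iff[symmetric] ext)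

text \<open>The Legendre polynomial of degree \<open>l\<close> is a multiple of \<open>rodrigues l l\<close>, and the associated Legendre
  functions of order \<open>m\<close> come from \<open>rodrigues l (l + m)\<close>.\<close>
definition rodrigues :: "nat \<Rightarrow> nat \<Rightarrow> real poly" where
  "rodrigues l j = (pderiv ^^ j) ([:-1, 0, 1:] ^ l)"

lemma pderiv_rodrigues [simp]: "pderiv (rodrigues l j) = rodrigues l (Suc j)"
  by (simp add: rodrigues_def)

lemma rodrigues_0: "rodrigues l 0 = [:-1, 0, 1:] ^ l"
  by (simp add: rodrigues_def)

lemma higher_deriv_poly:
  fixes p :: "real poly"
  shows "(deriv ^^ n) (poly p) = poly ((pderiv ^^ n) p)"
proof (induction n)
  case (Suc n)
  have "deriv (poly q) = poly (pderiv q)" for q :: "real poly"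
    by (intro ext DERIV_imp_deriv poly_DERIV)
  then show ?case using Suc by simp
qed simp

lemma higher_deriv_rodrigues:
  "(deriv ^^ n) (\<lambda>y::real. (y\<^sup>2 - 1) ^ l) = poly (rodrigues l n)"
proof -
  have "(\<lambda>y::real. (y\<^sup>2 - 1) ^ l) = poly ([:-1, 0, 1:] ^ l)"
    by (auto simp: power2_eq_square)
  then show ?thesis by (simp add: higher_deriv_poly rodrigues_def)
qed

text \<open>The function \<open>w = (x\<^sup>2 - 1)\<^sup>l\<close> satisfies \<open>(x\<^sup>2 - 1) w' = 2 l x w\<close>; the recurrence is this
  identity differentiated \<open>j + 1\<close> times. For \<open>j = l + m\<close> it is the differential equation of the
  \<open>m\<close>-th derivative of the Legendre polynomial.\<close>
lemma rodrigues_recurrence: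
  "[:-1, 0, 1:] * rodrigues l (j + 2) + [:0, 2 * (real j + 1 - real l):] * rodrigues l (j + 1)
     + [:(real j + 1) * (real j - 2 * real l):] * rodrigues l j = 0"
proof (induction j)
  case 0
  have base: "[:-1, 0, 1:] * rodrigues l 1 = [:0, 2 * real l:] * rodrigues l 0"
  proof (cases l)
    case 0 then show ?thesis by (simp add: rodrigues_def)
  next
    case (Suc k)
    have "rodrigues l 1 = pderiv ([:-1, 0, 1:] ^ Suc k)"
      by (simp add: rodrigues_def Suc)
    also have "\<dots> = smult (real (Suc k)) ([:-1, 0, 1:] ^ k) * [:0, 2:]"
      by (simp only: pderiv_power_Suc) (simp add: pderiv_pCons)
    finally have "[:-1, 0, 1:] * rodrigues l 1 = smult (real (Suc k)) ([:-1, 0, 1:] ^ Suc k) * [:0, 2:]"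
      by (simp only: mult.assoc mult_smult_left mult_smult_right power_Suc)
    also have "\<dots> = [:0, 2 * real l:] * rodrigues l 0"
      by (intro poly_eqI_eval) (simp add: rodrigues_0 Suc algebra_simps)
    finally show ?thesis .
  qed
  have "pderiv ([:-1, 0, 1:] * rodrigues l 1) = pderiv ([:0, 2 * real l:] * rodrigues l 0)"
    by (simp only: base)
  then have *: "[:-1, 0, 1:] * rodrigues l 2 + [:0, 2:] * rodrigues l 1
      = [:0, 2 * real l:] * rodrigues l 1 + [:2 * real l:] * rodrigues l 0"
    by (simp only: pderiv_mult pderiv_rodrigues) (simp add: pderiv_pCons numeral_2_eq_2 algebra_simps)
  show ?case
  proof (rule poly_eqI_eval)
    fix x
    show "poly ([:-1, 0, 1:] * rodrigues l (0 + 2) + [:0, 2 * (real 0 + 1 - real l):] * rodrigues l (0 + 1)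
     + [:(real 0 + 1) * (real 0 - 2 * real l):] * rodrigues l 0) x = poly 0 x"
      using arg_cong[OF *, of "\<lambda>p. poly p x"] by (simp add: algebra_simps numeral_2_eq_2)
  qed
next
  case (Suc j)
  have *: "[:-1, 0, 1:] * rodrigues l (j + 3) + [:0, 2:] * rodrigues l (j + 2)
     + [:0, 2 * (real j + 1 - real l):] * rodrigues l (j + 2) + [:2 * (real j + 1 - real l):] * rodrigues l (j + 1)
     + [:(real j + 1) * (real j - 2 * real l):] * rodrigues l (j + 1) = 0"
    using arg_cong[OF Suc, of pderiv]
    by (simp only: pderiv_mult pderiv_add pderiv_rodrigues)
       (simp add: pderiv_pCons numeral_2_eq_2 numeral_3_eq_3 algebra_simps)
  show ?case
  proof (rule poly_eqI_eval)
    fix x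
    show "poly ([:-1, 0, 1:] * rodrigues l (Suc j + 2) + [:0, 2 * (real (Suc j) + 1 - real l):] * rodrigues l (Suc j + 1)
     + [:(real (Suc j) + 1) * (real (Suc j) - 2 * real l):] * rodrigues l (Suc j)) x = poly 0 x"
      using arg_cong[OF *, of "\<lambda>p. poly p x"] 
      by (simp add: algebra_simps numeral_2_eq_2 numeral_3_eq_3)
  qed
qed

lemma legendre_ode:
  "(x\<^sup>2 - 1) * poly (rodrigues l (j + 2)) x + 2 * (real j + 1 - real l) * x * poly (rodrigues l (j + 1)) x
     + (real j + 1) * (real j - 2 * real l) * poly (rodrigues l j) x = 0"
  using arg_cong[OF rodrigues_recurrence[of l j], of "\<lambda>p. poly p x"]
  by (simp add: algebra_simps power2_eq_square)

text \<open>At \<open>x = \<plusminus>1\<close> the leading term of the differential equation drops out, so that each derivative is a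
  multiple of the preceding one, starting from \<open>0\<close>, until the factor \<open>j + 1 - l\<close> vanishes.\<close>
lemma rodrigues_vanishes:
  assumes "j < l" "x\<^sup>2 = 1"
  shows "poly (rodrigues l j) x = 0"
  using assms(1)
proof (induction j)
  case 0
  then show ?case using assms(2) by (simp add: rodrigues_0 power2_eq_square)
next
  case (Suc j)
  have "2 * (real j + 1 - real l) * x * poly (rodrigues l (j + 1)) x = 0"
    using legendre_ode[of x l j] Suc assms(2) by simp
  moreover have "x \<noteq> 0" "real j + 1 - real l \<noteq> 0" using assms(2) Suc.prems by auto
  ultimately show ?case by simp
qed

lemma degree_rodrigues: "degree (rodrigues l j) = 2 * l - j"
proof (induction j)
  case 0
  then show ?case by (simp add: rodrigues_0 degree_power_eq)
next
  case (Suc j)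
  have "degree (rodrigues l (Suc j)) = degree (rodrigues l j) - 1"
    by (metis degree_pderiv pderiv_rodrigues)
  then show ?case using Suc by simp
qed

lemma rodrigues_top: "rodrigues l (2 * l) = [:fact (2 * l):]"
proof -
  have deg: "degree ([:-1, 0, 1::real:] ^ l) = 2 * l"
    by (simp add: degree_power_eq)
  have "lead_coeff ([:-1, 0, 1::real:] ^ l) = 1"
    by (simp add: lead_coeff_power)
  then have "coeff (rodrigues l (2 * l)) 0 = fact (2 * l)"
    by (simp add: rodrigues_def coeff_higher_pderiv deg pochhammer_fact)
  moreover have "degree (rodrigues l (2 * l)) = 0" by (simp add: degree_rodrigues)
  ultimately show ?thesis by (metis degree_0_id of_real_eq_id)
qed

lemma rodrigues_nonzero: "j \<le> 2 * l \<Longrightarrow> rodrigues l j \<noteq> 0"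
proof
  assume j: "j \<le> 2 * l" "rodrigues l j = 0"
  have "(pderiv ^^ (2 * l - j)) (rodrigues l j) = rodrigues l (2 * l)"
    unfolding rodrigues_def using j(1) by (metis comp_apply funpow_add le_add_diff_inverse2)
  then have "rodrigues l (2 * l) = 0" using j by simp
  then show False by (simp add: rodrigues_top)
qed

lemma rodrigues_eq_0:
  assumes "2 * l < j"
  shows "rodrigues l j = 0"
proof -
  have "Suc (2 * l) \<le> j" using assms by simp
  then show ?thesis
  proof (induction j rule: dec_induct)
    case base
    show ?case by (simp only: pderiv_rodrigues[symmetric] rodrigues_top) (simp add: pderiv_pCons)
  next
    case (step j)
    then show ?case by (simp only: pderiv_rodrigues[symmetric]) simp
  qed
qed

text \<open>This is the classical relation between the associated Legendre functions of orders \<open>m\<close> and \<open>-m\<close>.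
  By induction on \<open>m\<close>: the two sides agree at \<open>x = 1\<close>, and by the differential equation at
  \<open>j = l + m\<close> their derivatives agree by the case \<open>m\<close>.\<close>
lemma rodrigues_reflection:
  assumes "m \<le> l"
  shows "fact (l + m) * poly (rodrigues l (l - m)) x
    = fact (l - m) * (x\<^sup>2 - 1) ^ m * poly (rodrigues l (l + m)) x"
  using assms
proof (induction m arbitrary: x)
  case (Suc m)
  define F where "F x = fact (l + Suc m) * poly (rodrigues l (l - Suc m)) x
     - fact (l - Suc m) * (x\<^sup>2 - 1) ^ Suc m * poly (rodrigues l (l + Suc m)) x" for x :: real
  have s: "Suc (l - Suc m) = l - m" using Suc.prems by simp
  have "(F has_real_derivative 0) (at x)" for x
  proof -
    have "(F has_real_derivative (fact (l + Suc m) * poly (rodrigues l (l - m)) x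
       - fact (l - Suc m) * ((Suc m * (x\<^sup>2 - 1) ^ m * (2 * x)) * poly (rodrigues l (l + Suc m)) x
           + (x\<^sup>2 - 1) ^ Suc m * poly (rodrigues l (Suc (l + Suc m))) x))) (at x)"
      unfolding F_def
      by (rule derivative_eq_intros refl | simp add: s del: power_Suc fact_Suc)+
         (simp add: algebra_simps)
    also have "(fact (l + Suc m) * poly (rodrigues l (l - m)) x
       - fact (l - Suc m) * ((Suc m * (x\<^sup>2 - 1) ^ m * (2 * x)) * poly (rodrigues l (l + Suc m)) x
           + (x\<^sup>2 - 1) ^ Suc m * poly (rodrigues l (Suc (l + Suc m))) x)) = 0"
    proof -
      have f: "fact (l - m) = (real l - real m) * fact (l - Suc m)"
        using Suc.prems by (metis Suc_diff_Suc Suc_le_lessD fact_Suc of_nat_diff less_imp_le_nat mult.commute of_nat_mult)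
      have e: "(x\<^sup>2 - 1) * poly (rodrigues l (Suc (l + Suc m))) x
         = - 2 * (real m + 1) * x * poly (rodrigues l (l + Suc m)) x
           + (real l + real m + 1) * (real l - real m) * poly (rodrigues l (l + m)) x"
        using legendre_ode[of x l "l + m"] by (simp add: algebra_simps)
      have t1: "(Suc m * (x\<^sup>2 - 1) ^ m * (2 * x)) * poly (rodrigues l (l + Suc m)) x
           + (x\<^sup>2 - 1) ^ Suc m * poly (rodrigues l (Suc (l + Suc m))) x
         = (x\<^sup>2 - 1) ^ m * ((real l + real m + 1) * (real l - real m) * poly (rodrigues l (l + m)) x)"
        using arg_cong[OF e, of "\<lambda>t. (x\<^sup>2 - 1) ^ m * t"] by (simp add: algebra_simps)
      have t2: "fact (l + Suc m) * poly (rodrigues l (l - m)) x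
         = (real l + real m + 1) * (fact (l - m) * (x\<^sup>2 - 1) ^ m * poly (rodrigues l (l + m)) x)"
        using Suc.IH[of x] Suc.prems by (simp add: algebra_simps)
      show ?thesis unfolding t1 t2 f by (simp add: algebra_simps)
    qed
    finally show ?thesis .
  qed
  then have "F x = F 1" by (rule DERIV_isconst_all[rule_format])
  also have "F 1 = 0"
    unfolding F_def using Suc.prems by (simp add: rodrigues_vanishes)
  finally show ?case by (simp add: F_def)
qed simp

section \<open>Orthogonality of the associated Legendre functions\<close>

text \<open>The integral of \<open>p\<close> over \<open>[-1, 1]\<close>, in the variable \<open>\<theta>\<close> in which it appears on the sphere.\<close>
definition polar_integral :: "real poly \<Rightarrow> real" where
  "polar_integral p = (LBINT \<theta>:{0..pi}. sin \<theta> * poly p (cos \<theta>))"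

lemma set_integrable_polar: "set_integrable lborel {0..pi} (\<lambda>\<theta>. sin \<theta> * poly p (cos \<theta>))"
  by (intro borel_integrable_atLeastAtMost') (intro continuous_intros)

lemma polar_integral_pderiv: "polar_integral (pderiv p) = poly p 1 - poly p (-1)"
proof -
  have "(LBINT \<theta>. indicator {0..pi} \<theta> *\<^sub>R (sin \<theta> * poly (pderiv p) (cos \<theta>))) = - poly p (cos pi) - (- poly p (cos 0))"
    by (rule integral_FTC_Icc)
       (auto intro!: derivative_eq_intros continuous_intros poly_DERIV[THEN DERIV_chain2]
         simp flip: has_real_derivative_iff_has_vector_derivative)
  then show ?thesis by (simp add: polar_integral_def set_lebesgue_integral_def)
qed

lemma polar_integral_add: "polar_integral (p + q) = polar_integral p + polar_integral q"
  using set_integral_add(2)[OF set_integrable_polar set_integrable_polar, of p q]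
  by (simp add: polar_integral_def algebra_simps)

lemma polar_integral_smult: "polar_integral (smult c p) = c * polar_integral p"
  using set_integral_mult_right[where a = c and M = lborel and A = "{0..pi}" and f = "\<lambda>\<theta>. sin \<theta> * poly p (cos \<theta>)"]
  by (simp add: polar_integral_def algebra_simps)

lemma polar_integral_by_parts:
  assumes "poly p 1 * poly q 1 = 0" "poly p (-1) * poly q (-1) = 0"
  shows "polar_integral (pderiv p * q) = - polar_integral (p * pderiv q)"
  using polar_integral_pderiv[of "p * q"] assms
  by (simp add: pderiv_mult polar_integral_add algebra_simps)

text \<open>Derivatives are moved from one factor to the other by parts; the boundary terms vanish because the
  first factor always carries a derivative of order below \<open>l\<close>.\<close>
lemma polar_integral_shift:
  "m \<le> l \<Longrightarrow> polar_integral (rodrigues l (l - m) * rodrigues l' (l' + m))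
     = (-1) ^ m * polar_integral (rodrigues l l * rodrigues l' l')"
proof (induction m)
  case (Suc m)
  have s: "Suc (l - Suc m) = l - m" using Suc.prems by simp
  have "polar_integral (pderiv (rodrigues l (l - Suc m)) * rodrigues l' (l' + m))
      = - polar_integral (rodrigues l (l - Suc m) * pderiv (rodrigues l' (l' + m)))"
    by (intro polar_integral_by_parts) (use Suc.prems in \<open>simp_all add: rodrigues_vanishes\<close>)
  then show ?case using Suc s by simp
qed simp

text \<open>Integrating the factor \<open>1\<close> by parts relates the integrals for \<open>l + 1\<close> and \<open>l\<close>.\<close>
lemma polar_integral_wallis:
  "polar_integral ([:-1, 0, 1:] ^ l) = (-1) ^ l * 2 ^ (2 * l + 1) * (fact l)\<^sup>2 / fact (2 * l + 1)"
proof (induction l)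
  case 0
  have "polar_integral (pderiv [:0, 1:]) = 2"
    by (subst polar_integral_pderiv) simp
  then show ?case by (simp add: pderiv_pCons one_pCons)
next
  case (Suc l)
  let ?q = "[:-1, 0, 1::real:]"
  have "polar_integral (pderiv [:0, 1:] * ?q ^ Suc l) = - polar_integral ([:0, 1:] * pderiv (?q ^ Suc l))"
    by (intro polar_integral_by_parts) simp_all
  also have "pderiv [:0, 1:] * ?q ^ Suc l = ?q ^ Suc l" by (simp add: pderiv_pCons)
  also have "[:0, 1:] * pderiv (?q ^ Suc l) = smult (2 * real (Suc l)) (?q ^ Suc l + ?q ^ l)"
  proof -
    have "pderiv (?q ^ Suc l) = smult (real (Suc l)) (?q ^ l) * [:0, 2:]"
      by (simp only: pderiv_power_Suc) (simp add: pderiv_pCons)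
    then show ?thesis
      by (intro poly_eqI_eval) (simp add: algebra_simps)
  qed
  finally have "polar_integral (?q ^ Suc l) * (2 * real l + 3) = - 2 * (real l + 1) * polar_integral (?q ^ l)"
    by (simp add: polar_integral_smult polar_integral_add algebra_simps del: power_Suc)
  then have "polar_integral (?q ^ Suc l) = - 2 * (real l + 1) * polar_integral (?q ^ l) / (2 * real l + 3)"
    by (simp add: field_simps del: power_Suc)
  then have *: "polar_integral (?q ^ Suc l)
      = - 2 * (real l + 1) * ((-1) ^ l * 2 ^ (2 * l + 1) * (fact l)\<^sup>2 / fact (2 * l + 1)) / (2 * real l + 3)"
    by (simp only: Suc)
  have alg: "- 2 * (n + 1) * (a / F) / (2 * n + 3) = - 4 * (n + 1)\<^sup>2 * a / ((2 * n + 3) * ((2 * n + 2) * F))"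
    if "n \<ge> 0" "F > 0" for n F a :: real
    using that by (simp add: divide_simps add_eq_0_iff power2_eq_square) (simp add: algebra_simps)
  have "fact (2 * Suc l + 1) = (2 * real l + 3) * ((2 * real l + 2) * fact (2 * l + 1))"
    by (simp add: algebra_simps)
  moreover have "(-1) ^ Suc l * 2 ^ (2 * Suc l + 1) * (fact (Suc l))\<^sup>2
      = - 4 * (real l + 1)\<^sup>2 * ((-1) ^ l * 2 ^ (2 * l + 1) * (fact l)\<^sup>2)"
    by (simp add: power_mult_distrib)
  ultimately show ?case unfolding * by (simp only: alg[OF of_nat_0_le_iff fact_gt_zero])
qed

text \<open>The reflection formula turns the weight \<open>(1 - x\<^sup>2)\<^sup>m\<close> into a lowering of one order to \<open>l - m\<close>, after which
  all derivatives can be shifted to the factor of smaller degree. For \<open>l' < l\<close> nothing is left of it;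
  for \<open>l' = l\<close> it becomes the constant \<open>(2 l)!\<close>.\<close>
lemma rodrigues_orthogonal:
  assumes "m \<le> l" "m \<le> l'"
  shows "polar_integral ([:1, 0, -1:] ^ m * rodrigues l (l + m) * rodrigues l' (l' + m))
    = (if l = l' then fact (l + m) / fact (l - m) * (2 ^ l * fact l)\<^sup>2 * 2 / (2 * real l + 1) else 0)"
proof -
  have gen: "polar_integral ([:1, 0, -1:] ^ m * rodrigues l (l + m) * rodrigues l' (l' + m))
    = (if l = l' then fact (l + m) / fact (l - m) * (2 ^ l * fact l)\<^sup>2 * 2 / (2 * real l + 1) else 0)"
    if m: "m \<le> l" "m \<le> l'" and le: "l' \<le> l" for l l'
  proof -
    have "[:1, 0, -1:] ^ m * rodrigues l (l + m) * rodrigues l' (l' + m)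
      = smult ((-1) ^ m * fact (l + m) / fact (l - m)) (rodrigues l (l - m) * rodrigues l' (l' + m))"
    proof (rule poly_eqI_eval)
      fix x :: real
      have "(1 - x\<^sup>2) ^ m = (-1) ^ m * (x\<^sup>2 - 1) ^ m" 
        by (simp flip: power_mult_distrib)
      then have "(1 - x\<^sup>2) ^ m * poly (rodrigues l (l + m)) x = (-1) ^ m * fact (l + m) / fact (l - m) * poly (rodrigues l (l - m)) x"
        using rodrigues_reflection[OF m(1), of x] by (simp add: field_simps)
      then show "poly ([:1, 0, -1:] ^ m * rodrigues l (l + m) * rodrigues l' (l' + m)) x
        = poly (smult ((-1) ^ m * fact (l + m) / fact (l - m)) (rodrigues l (l - m) * rodrigues l' (l' + m))) x"
        by (simp add: power2_eq_square)
    qed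
    then have "polar_integral ([:1, 0, -1:] ^ m * rodrigues l (l + m) * rodrigues l' (l' + m))
      = fact (l + m) / fact (l - m) * polar_integral (rodrigues l l * rodrigues l' l')"
      by (simp add: polar_integral_smult polar_integral_shift[OF m(1)])
    also have "polar_integral (rodrigues l l * rodrigues l' l') = (-1) ^ l * polar_integral (rodrigues l 0 * rodrigues l' (l' + l))"
      using polar_integral_shift[of l l l'] by simp
    also have "\<dots> = (if l = l' then (2 ^ l * fact l)\<^sup>2 * 2 / (2 * real l + 1) else 0)"
    proof (cases "l = l'")
      case True
      have "rodrigues l 0 * rodrigues l' (l' + l) = smult (fact (2 * l)) ([:-1, 0, 1:] ^ l)"
        using rodrigues_top[of l] by (simp add: True rodrigues_0 mult_2)
      then have "polar_integral (rodrigues l 0 * rodrigues l' (l' + l))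
          = (-1) ^ l * (fact (2 * l) * (2 ^ (2 * l + 1) * (fact l)\<^sup>2 / fact (2 * l + 1)))"
        by (simp only: polar_integral_smult polar_integral_wallis) simp
      moreover have "fact (2 * l) * (2 ^ (2 * l + 1) * (fact l)\<^sup>2 / fact (2 * l + 1)) = (2 ^ l * fact l)\<^sup>2 * 2 / (2 * real l + 1)"
        by (simp add: power_mult_distrib power_mult[symmetric] mult.commute[of l] mult.commute[of _ "2::real"] add.commute)
      moreover have "(-1) ^ l * ((-1) ^ l * c) = c" for c :: real
        by (simp flip: mult.assoc power_add)
      ultimately show ?thesis using True by simp
    next
      case False
      then have "rodrigues l' (l' + l) = 0" using le by (intro rodrigues_eq_0) simp
      then show ?thesis using False polar_integral_smult[of 0 0] by simp
    qed
    finally show ?thesis by (cases "l = l'") simp_all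
  qed
  show ?thesis
  proof (cases "l' \<le> l")
    case True then show ?thesis using gen assms by blast
  next
    case False
    then have "polar_integral ([:1, 0, -1:] ^ m * rodrigues l' (l' + m) * rodrigues l (l + m)) = 0"
      using gen[of l' l] assms by simp
    moreover have "[:1, 0, -1:] ^ m * rodrigues l (l + m) * rodrigues l' (l' + m)
        = [:1, 0, -1:] ^ m * rodrigues l' (l' + m) * rodrigues l (l + m)"
      by (simp only: mult.assoc mult.commute[of "rodrigues l (l + m)" "rodrigues l' (l' + m)"])
    moreover have "l \<noteq> l'" using False by simp
    ultimately show ?thesis by (simp only: if_False)
  qed
qed

section \<open>Spherical harmonics in Cartesian coordinates\<close>

lemma sph_nth [simp]:
  "sph \<theta> \<phi> $ 1 = sin \<theta> * cos \<phi>" "sph \<theta> \<phi> $ 2 = sin \<theta> * sin \<phi>" "sph \<theta> \<phi> $ 3 = cos \<theta>"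
  by (simp_all add: sph_def vector_3)

lemma S2_iff: "x \<in> S2 \<longleftrightarrow> (x $ 1)\<^sup>2 + (x $ 2)\<^sup>2 + (x $ 3)\<^sup>2 = 1"
  by (simp add: norm_vec_def L2_set_def sum_3)

lemma sph_in_S2 [simp]: "sph \<theta> \<phi> \<in> S2"
proof -
  have "(sin \<theta> * cos \<phi>)\<^sup>2 + (sin \<theta> * sin \<phi>)\<^sup>2 + (cos \<theta>)\<^sup>2
      = (sin \<theta>)\<^sup>2 * ((cos \<phi>)\<^sup>2 + (sin \<phi>)\<^sup>2) + (cos \<theta>)\<^sup>2"
    by (simp only: power_mult_distrib distrib_left)
  also have "\<dots> = 1" by simp
  finally show ?thesis unfolding S2_iff by simp
qed

lemma norm_sph [simp]: "norm (sph \<theta> \<phi>) = 1"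
  using sph_in_S2[of \<theta> \<phi>] by simp

lemma S2_third:
  assumes "x \<in> S2"
  shows "\<bar>x $ 3\<bar> \<le> 1" "cmod (Complex (x $ 1) (x $ 2)) = sqrt (1 - (x $ 3)\<^sup>2)"
proof -
  have *: "(x $ 1)\<^sup>2 + (x $ 2)\<^sup>2 = 1 - (x $ 3)\<^sup>2"
    using assms unfolding S2_iff by linarith
  then have "(x $ 3)\<^sup>2 \<le> 1"
    by (smt (verit) zero_le_power2)
  then show "\<bar>x $ 3\<bar> \<le> 1" by (simp add: abs_square_le_1)
  show "cmod (Complex (x $ 1) (x $ 2)) = sqrt (1 - (x $ 3)\<^sup>2)"
    using * by (simp add: cmod_def)
qed

lemma sph_colatitude_longitude:
  assumes "x \<in> S2"
  shows "sph (colatitude x) (longitude x) = x"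
proof -
  define z where "z = Complex (x $ 1) (x $ 2)"
  have c: "cos (colatitude x) = x $ 3" "sin (colatitude x) = cmod z"
    using S2_third[OF assms] by (simp_all add: colatitude_def cos_arccos_abs sin_arccos_abs z_def)
  have "z = of_real (cmod z) * exp (\<i> * of_real (longitude x))"
    unfolding longitude_def z_def[symmetric] by (rule Arg2pi_eq)
  then have "Re z = cmod z * cos (longitude x)" "Im z = cmod z * sin (longitude x)"
    by (auto dest: arg_cong[where f = Re] arg_cong[where f = Im] simp: Re_exp Im_exp)
  then show ?thesis
    by (simp add: vec_eq_iff forall_3 c z_def)
qed

text \<open>On the sphere this is \<open>sin\<^sup>\<bar>\<^sup>m\<^sup>\<bar> \<theta> exp (i m \<phi>)\<close>, written as a polynomial in the coordinates.\<close>
definition azimuthal :: "int \<Rightarrow> real^3 \<Rightarrow> complex" where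
  "azimuthal m x =
     (if 0 \<le> m then Complex (x $ 1) (x $ 2) ^ nat m else cnj (Complex (x $ 1) (x $ 2)) ^ nat (- m))"

lemma azimuthal_sph:
  "azimuthal m (sph \<theta> \<phi>) = of_real (sin \<theta> ^ nat \<bar>m\<bar>) * exp (\<i> * of_int m * of_real \<phi>)"
proof -
  have z: "Complex (sin \<theta> * cos \<phi>) (sin \<theta> * sin \<phi>) = of_real (sin \<theta>) * exp (\<i> * of_real \<phi>)"
    by (simp add: complex_eq_iff Re_exp Im_exp)
  have cz: "cnj (Complex (sin \<theta> * cos \<phi>) (sin \<theta> * sin \<phi>)) = of_real (sin \<theta>) * exp (- \<i> * of_real \<phi>)"
    by (simp add: complex_eq_iff Re_exp Im_exp)
  show ?thesis
  proof (cases "0 \<le> m")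
    case True
    then obtain n where "m = int n" by (metis nonneg_int_cases)
    then show ?thesis
      unfolding azimuthal_def sph_nth z power_mult_distrib
      by (simp add: mult_ac flip: exp_of_nat_mult)
  next
    case False
    then obtain n where "m = - int n" "n > 0" by (metis neg_int_cases not_le)
    then show ?thesis using False
      unfolding azimuthal_def sph_nth cz power_mult_distrib
      by (simp add: mult_ac flip: exp_of_nat_mult)
  qed
qed

text \<open>The sign \<open>(-1)\<^sup>m\<close> of the definition of the associated Legendre functions survives only for \<open>m \<ge> 0\<close>: for
  negative orders the reflection formula contributes the same sign once more.\<close>
definition harm_const :: "nat \<Rightarrow> int \<Rightarrow> real" where
  "harm_const l m = (if 0 \<le> m then (-1) ^ nat m else 1)
     * sqrt ((2 * real l + 1) * fact (l - nat \<bar>m\<bar>) / (4 * pi * fact (l + nat \<bar>m\<bar>))) / (2 ^ l * fact l)"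

text \<open>For \<open>m < 0\<close> the singular power of \<open>1 - x\<^sub>3\<^sup>2\<close> is compensated by the zeros of the derivative of order
  \<open>l + m\<close>, which the reflection formula makes explicit. The polynomial form makes smoothness and
  continuity evident, also at the poles.\<close>
lemma sph_harm_closed_form:
  assumes "x \<in> S2" "m \<in> {- int l..int l}"
  shows "sph_harm l m x
    = of_real (harm_const l m * poly (rodrigues l (l + nat \<bar>m\<bar>)) (x $ 3)) * azimuthal m x"
proof -
  define k where "k = nat \<bar>m\<bar>"
  have k: "k \<le> l" using assms(2) by (auto simp: k_def)
  define s where "s = sqrt (1 - (x $ 3)\<^sup>2)"
  have s2: "s ^ 2 = 1 - (x $ 3)\<^sup>2"
    using S2_third(1)[OF assms(1)] by (simp add: s_def abs_square_le_1)
  have c: "cos (colatitude x) = x $ 3" "sin (colatitude x) = s"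
    using S2_third(1)[OF assms(1)] by (simp_all add: colatitude_def cos_arccos_abs sin_arccos_abs s_def)
  have az: "azimuthal m x = of_real (s ^ k) * exp (\<i> * of_int m * of_real (longitude x))"
    using azimuthal_sph[of m "colatitude x" "longitude x"]
    by (simp add: sph_colatitude_longitude[OF assms(1)] c k_def)
  have "sqrt ((2 * real l + 1) * fact (nat (int l - m)) / (4 * pi * fact (nat (int l + m))))
         * assoc_legendre l m (x $ 3) = harm_const l m * poly (rodrigues l (l + k)) (x $ 3) * s ^ k"
  proof (cases "0 \<le> m")
    case True
    then have m: "m = int k" by (simp add: k_def)
    have "nat (int l + int k) = l + k" "nat (int l - int k) = l - k" using k by auto
    then show ?thesis
      by (simp add: m assoc_legendre_def harm_const_def higher_deriv_rodrigues s_def field_simps)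
  next
    case False
    then have m: "m = - int k" and k0: "k > 0" by (auto simp: k_def)
    have n: "nat (int l + m) = l - k" "nat (int l - m) = l + k" using k m by auto
    have sk: "(1 - (x $ 3)\<^sup>2) ^ k = s ^ k * s ^ k"
      unfolding s2[symmetric] by (simp add: power2_eq_square power_mult_distrib)
    have refl: "fact (l + k) * poly (rodrigues l (l - k)) (x $ 3)
        = fact (l - k) * ((-1) ^ k * (s ^ k * s ^ k)) * poly (rodrigues l (l + k)) (x $ 3)"
    proof -
      have "((x $ 3)\<^sup>2 - 1) ^ k = ((-1) * (1 - (x $ 3)\<^sup>2)) ^ k" by simp
      then have "((x $ 3)\<^sup>2 - 1) ^ k = (-1) ^ k * (s ^ k * s ^ k)"
        by (simp only: power_mult_distrib sk)
      then show ?thesis using rodrigues_reflection[OF k, of "x $ 3"] by simp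
    qed
    then have w: "poly (rodrigues l (l - k)) (x $ 3)
        = fact (l - k) / fact (l + k) * ((-1) ^ k * (s ^ k * s ^ k)) * poly (rodrigues l (l + k)) (x $ 3)"
      by (simp add: field_simps)
    have al: "assoc_legendre l m (x $ 3)
       = fact (l - k) / fact (l + k) * poly (rodrigues l (l + k)) (x $ 3) * s ^ k / (2 ^ l * fact l)"
    \<comment> \<open>At the poles both sides vanish, as \<open>k > 0\<close>.\<close>
    proof (cases "s = 0")
      case True
      then show ?thesis using k0
        by (simp add: assoc_legendre_def m s_def power_int_minus power_0_left)
    next
      case False
      have "s powi m * (s ^ k * s ^ k) = s ^ k"
        using False by (simp add: m power_int_minus)
      moreover have "(-1) powi m * (-1) ^ k = (1::real)"
        by (simp add: m power_int_minus flip: power_mult_distrib)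
      ultimately show ?thesis
        unfolding assoc_legendre_def higher_deriv_rodrigues n s_def[symmetric] w
        by (auto simp: field_simps)
    qed
    have root: "sqrt (a * B / (p * A)) * (A / B) = sqrt (a * A / (p * B))"
      if "A > 0" "B > 0" for a A B p :: real
    proof -
      have "sqrt (a * B / (p * A)) * (A / B) = sqrt (a * B / (p * A)) * sqrt ((A / B)\<^sup>2)"
        using that by (simp add: real_sqrt_abs)
      also have "\<dots> = sqrt (a * B / (p * A) * (A / B)\<^sup>2)" by (simp only: real_sqrt_mult)
      also have "a * B / (p * A) * (A / B)\<^sup>2 = a * A / (p * B)"
        using that by (simp add: field_simps power2_eq_square)
      finally show ?thesis .
    qed
    have "sqrt ((2 * real l + 1) * fact (l + k) / (4 * pi * fact (l - k))) * (fact (l - k) / fact (l + k))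
        = sqrt ((2 * real l + 1) * fact (l - k) / (4 * pi * fact (l + k)))"
      by (rule root) simp_all
    moreover have "r * (a * w * t / d) = r * a / d * w * t" for r a w t d :: real by simp
    ultimately show ?thesis
      using False unfolding al n harm_const_def k_def[symmetric] by (simp only: if_False mult_1)
  qed
  then show ?thesis
    unfolding sph_harm_def az c k_def[symmetric] by (simp only: flip: of_real_mult mult.assoc)
qed

lemma sph_harm_sph:
  assumes "m \<in> {- int l..int l}"
  shows "sph_harm l m (sph \<theta> \<phi>)
    = of_real (harm_const l m * poly (rodrigues l (l + nat \<bar>m\<bar>)) (cos \<theta>) * sin \<theta> ^ nat \<bar>m\<bar>)
        * exp (\<i> * of_int m * of_real \<phi>)"
  using assms by (simp add: sph_harm_closed_form azimuthal_sph)

lemma continuous_on_azimuthal [continuous_intros]: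
  "continuous_on A (azimuthal m)"
proof -
  have "continuous_on A (\<lambda>x::real^3. Complex (x $ 1) (x $ 2))"
    unfolding Complex_eq by (intro continuous_intros)
  then show ?thesis
    unfolding azimuthal_def by (cases "0 \<le> m") (auto intro!: continuous_intros)
qed

lemma continuous_on_sph_harm:
  assumes "m \<in> {- int l..int l}"
  shows "continuous_on S2 (sph_harm l m)"
proof -
  have "continuous_on S2 (\<lambda>x. of_real (harm_const l m * poly (rodrigues l (l + nat \<bar>m\<bar>)) (x $ 3)) * azimuthal m x)"
    by (intro continuous_intros)
  then show ?thesis
    by (rule continuous_on_eq) (simp add: sph_harm_closed_form[OF _ assms])
qed

section \<open>The surface measure and orthonormality\<close>

lemma sets_surface_measure [simp, measurable_cong]: "sets surface_measure = sets (restrict_space borel S2)"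
  by (simp add: surface_measure_def)

lemma space_surface_measure [simp]: "space surface_measure = S2"
  by (simp add: surface_measure_def space_restrict_space)

lemma continuous_on_sph: "continuous_on A (\<lambda>(\<theta>, \<phi>). sph \<theta> \<phi>)"
proof -
  have "continuous_on A (\<lambda>p. \<chi> i. (if i = 1 then sin (fst p) * cos (snd p)
      else if i = 2 then sin (fst p) * sin (snd p) else cos (fst p)) :: real^3)"
    apply (intro continuous_on_vec_lambda)
    subgoal for i by (cases "i = 1"; cases "i = 2"; simp; intro continuous_intros)
    done
  moreover have "(\<lambda>(\<theta>, \<phi>). sph \<theta> \<phi>) = (\<lambda>p. \<chi> i. (if i = 1 then sin (fst p) * cos (snd p)
      else if i = 2 then sin (fst p) * sin (snd p) else cos (fst p)) :: real^3)"
    by (auto simp: fun_eq_iff vec_eq_iff forall_3)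
  ultimately show ?thesis by simp
qed

lemma measurable_sph: "(\<lambda>(\<theta>, \<phi>). sph \<theta> \<phi>) \<in> borel \<rightarrow>\<^sub>M restrict_space borel S2"
  by (intro measurable_restrict_space2 borel_measurable_continuous_onI continuous_on_sph) auto

lemma nn_integral_surface_measure:
  assumes "g \<in> borel_measurable surface_measure"
  shows "(\<integral>\<^sup>+ x. g x \<partial>surface_measure)
    = (\<integral>\<^sup>+ p. ennreal (sin (fst p)) * g (sph (fst p) (snd p)) * indicator ({0..pi} \<times> {0..<2 * pi}) p \<partial>lborel)"
proof -
  have m: "(\<lambda>p. g (sph (fst p) (snd p))) \<in> borel_measurable borel"
    using measurable_comp[OF measurable_sph, of g borel] assms
    by (simp add: case_prod_unfold comp_def cong: measurable_cong_sets)
  have msin: "(\<lambda>p :: real \<times> real. sin (fst p)) \<in> borel_measurable borel"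
    by (intro borel_measurable_continuous_onI continuous_intros)
  show ?thesis
    unfolding surface_measure_def
    apply (subst nn_integral_distr)
    subgoal using measurable_sph by (simp add: measurable_restrict_space1)
    subgoal using assms by (simp cong: measurable_cong_sets)
    apply (subst nn_integral_density)
    subgoal using msin by (auto intro!: measurable_restrict_space1 simp: case_prod_unfold)
    subgoal using m by (auto intro!: measurable_restrict_space1 simp: case_prod_unfold)
    apply (subst nn_integral_restrict_space)
    subgoal by (simp add: borel_Times)
    apply (simp add: case_prod_unfold)
    done
qed

lemma integral_surface_measure:
  fixes g :: "real^3 \<Rightarrow> 'b::{banach, second_countable_topology}"
  assumes "g \<in> borel_measurable surface_measure"
  shows "(LINT x|surface_measure. g x)
    = (LBINT p:{0..pi} \<times> {0..<2 * pi}. sin (fst p) *\<^sub>R g (sph (fst p) (snd p)))"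
proof -
  have m: "(\<lambda>p. g (sph (fst p) (snd p))) \<in> borel_measurable borel"
    using measurable_comp[OF measurable_sph, of g borel] assms
    by (simp add: case_prod_unfold comp_def cong: measurable_cong_sets)
  have msin: "(\<lambda>p :: real \<times> real. sin (fst p)) \<in> borel_measurable borel"
    by (intro borel_measurable_continuous_onI continuous_intros)
  show ?thesis
    unfolding surface_measure_def
    apply (subst integral_distr)
    subgoal using measurable_sph by (simp add: measurable_restrict_space1)
    subgoal using assms by (simp cong: measurable_cong_sets)
    unfolding case_prod_unfold
    apply (subst integral_density)
    subgoal using m by (auto intro!: measurable_restrict_space1 simp: case_prod_unfold)
    subgoal using msin by (auto intro!: measurable_restrict_space1 simp: case_prod_unfold)
    subgoal by (auto intro!: AE_I2 sin_ge_zero simp: space_restrict_space)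
    apply (subst integral_restrict_space)
    subgoal by (simp add: borel_Times)
    apply (simp add: set_lebesgue_integral_def)
    done
qed

interpretation surface: finite_measure surface_measure
proof
  have "emeasure surface_measure (space surface_measure) = (\<integral>\<^sup>+ x. 1 \<partial>surface_measure)"
    by simp
  also have "\<dots> = (\<integral>\<^sup>+ p. ennreal (sin (fst p)) * 1 * indicator ({0..pi} \<times> {0..<2 * pi}) p \<partial>lborel)"
    by (rule nn_integral_surface_measure) simp
  also have "\<dots> \<le> (\<integral>\<^sup>+ p. indicator ({0..pi} \<times> {0..2 * pi}) p \<partial>(lborel :: (real \<times> real) measure))"
    by (intro nn_integral_mono) (auto simp: indicator_def ennreal_le_1)
  also have "\<dots> = emeasure (lborel \<Otimes>\<^sub>M lborel) ({0..pi} \<times> {0..2 * pi})"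
    by (simp add: lborel_prod borel_Times)
  also have "\<dots> = ennreal pi * ennreal (2 * pi)"
    by (subst lborel.emeasure_pair_measure_Times) auto
  also have "\<dots> < \<infinity>" by (simp add: ennreal_mult_less_top)
  finally show "emeasure surface_measure (space surface_measure) \<noteq> \<infinity>" by simp
qed

lemma continuous_imp_measurable_surface:
  fixes g :: "real^3 \<Rightarrow> 'b::{banach, second_countable_topology}"
  assumes "continuous_on S2 g"
  shows "g \<in> borel_measurable surface_measure"
  using borel_measurable_continuous_on_restrict[OF assms] by (simp cong: measurable_cong_sets)

lemma continuous_bounded_S2:
  fixes g :: "real^3 \<Rightarrow> 'b::real_normed_vector"
  assumes "continuous_on S2 g"
  obtains B where "\<And>x. x \<in> S2 \<Longrightarrow> norm (g x) \<le> B"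
proof -
  have "bounded (g ` S2)"
    using assms compact_sphere by (intro compact_imp_bounded compact_continuous_image)
  then show thesis using that unfolding bounded_iff by blast
qed

lemma continuous_imp_integrable_surface:
  fixes g :: "real^3 \<Rightarrow> 'b::{banach, second_countable_topology}"
  assumes "continuous_on S2 g"
  shows "integrable surface_measure g"
proof -
  obtain B where "\<And>x. x \<in> S2 \<Longrightarrow> norm (g x) \<le> B"
    using continuous_bounded_S2[OF assms] by blast
  then show ?thesis
    using continuous_imp_measurable_surface[OF assms]
    by (intro surface.integrable_const_bound[where B = B] AE_I2) auto
qed

text \<open>Fubini's theorem in the chart. As the rectangle is bounded and \<open>g\<close> is bounded on the sphere,
  integrability is automatic.\<close>
lemma surface_integral_separated:
  fixes g :: "real^3 \<Rightarrow> complex"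
  assumes g: "continuous_on S2 g"
    and sep: "\<And>\<theta> \<phi>. g (sph \<theta> \<phi>) = of_real (a \<theta>) * b \<phi>"
  shows "(LINT x|surface_measure. g x) = of_real (LBINT \<theta>:{0..pi}. sin \<theta> * a \<theta>) * (LBINT \<phi>:{0..<2 * pi}. b \<phi>)"
    (is "_ = ?R")
proof -
  have "integrable lborel (\<lambda>p. indicat_real ({0..pi} \<times> {0..2 * pi}) p *\<^sub>R (sin (fst p) *\<^sub>R g (sph (fst p) (snd p))))"
  proof (rule borel_integrable_compact)
    show "compact ({0..pi} \<times> {0..2 * pi})" by (intro compact_Times compact_Icc)
    have "continuous_on ({0..pi} \<times> {0..2 * pi}) (\<lambda>p. g (sph (fst p) (snd p)))"
      using continuous_on_sph[of "{0..pi} \<times> {0..2 * pi}"]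
      by (intro continuous_on_compose2[OF g]) (auto simp: case_prod_unfold)
    then show "continuous_on ({0..pi} \<times> {0..2 * pi}) (\<lambda>p. sin (fst p) *\<^sub>R g (sph (fst p) (snd p)))"
      by (intro continuous_intros)
  qed
  then have "set_integrable lborel ({0..pi} \<times> {0..2 * pi}) (\<lambda>p. sin (fst p) *\<^sub>R g (sph (fst p) (snd p)))"
    by (simp add: set_integrable_def)
  then have int: "set_integrable lborel ({0..pi} \<times> {0..<2 * pi}) (\<lambda>p. sin (fst p) *\<^sub>R g (sph (fst p) (snd p)))"
    by (rule set_integrable_subset) (auto simp: borel_Times)
  have "(LINT x|surface_measure. g x)
      = (LINT p|(lborel \<Otimes>\<^sub>M lborel). (\<lambda>(\<theta>, \<phi>). (indicat_real {0..pi} \<theta> * (sin \<theta> * a \<theta>)) *\<^sub>R (indicat_real {0..<2 * pi} \<phi> *\<^sub>R b \<phi>)) p)"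
    unfolding integral_surface_measure[OF continuous_imp_measurable_surface[OF g]] lborel_prod set_lebesgue_integral_def
    by (intro Bochner_Integration.integral_cong)
       (auto simp: sep indicator_times scaleR_conv_of_real)
  also have "\<dots> = (LBINT \<theta>. LBINT \<phi>. (indicat_real {0..pi} \<theta> * (sin \<theta> * a \<theta>)) *\<^sub>R (indicat_real {0..<2 * pi} \<phi> *\<^sub>R b \<phi>))"
  proof (rule lborel_pair.integral_fst[symmetric])
    show "integrable (lborel \<Otimes>\<^sub>M lborel) (\<lambda>(\<theta>, \<phi>). (indicat_real {0..pi} \<theta> * (sin \<theta> * a \<theta>)) *\<^sub>R (indicat_real {0..<2 * pi} \<phi> *\<^sub>R b \<phi>))"
      using int unfolding set_integrable_def lborel_prod
      by (rule Bochner_Integration.integrable_cong[THEN iffD1, rotated -1])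
         (auto simp: sep indicator_times scaleR_conv_of_real)
  qed
  also have "\<dots> = ?R"
    by (simp add: set_lebesgue_integral_def scaleR_conv_of_real flip: of_real_mult)
  finally show ?thesis .
qed

text \<open>The half-open interval of longitudes is first closed, which changes a null set.\<close>
lemma integral_exp_circle:
  "(LBINT \<phi>:{0..<2 * pi}. exp (\<i> * of_int n * of_real \<phi>)) = (if n = 0 then of_real (2 * pi) else 0)"
proof -
  have "(LBINT \<phi>:{0..<2 * pi}. exp (\<i> * of_int n * of_real \<phi>)) = (LBINT \<phi>:{0..2 * pi}. exp (\<i> * of_int n * of_real \<phi>))"
    unfolding set_lebesgue_integral_def
  proof (rule integral_cong_AE)
    show "AE x in lborel. indicat_real {0..<2 * pi} x *\<^sub>R exp (\<i> * of_int n * of_real x)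
        = indicat_real {0..2 * pi} x *\<^sub>R exp (\<i> * of_int n * of_real x)"
      using AE_lborel_singleton[of "2 * pi"] by eventually_elim (auto simp: indicator_def)
  qed measurable
  also have "\<dots> = (if n = 0 then of_real (2 * pi) else 0)"
  proof (cases "n = 0")
    case False
    have "(LBINT \<phi>. indicator {0..2 * pi} \<phi> *\<^sub>R exp (\<i> * of_int n * of_real \<phi>))
       = exp (\<i> * of_int n * of_real (2 * pi)) / (\<i> * of_int n) - exp (\<i> * of_int n * of_real 0) / (\<i> * of_int n)"
      by (rule integral_FTC_Icc)
         (use False in \<open>auto intro!: derivative_eq_intros continuous_intros has_vector_derivative_real_field simp: field_simps\<close>)
    also have "exp (\<i> * of_int n * of_real (2 * pi)) = 1"
      using exp_integer_2pi[of "of_int n"] by (simp add: mult_ac)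
    finally show ?thesis using False by (simp add: set_lebesgue_integral_def)
  qed (simp add: set_lebesgue_integral_def scaleR_conv_of_real)
  finally show ?thesis .
qed

lemma sph_harm_orthonormal:
  assumes "m \<in> {- int l..int l}" "m' \<in> {- int l'..int l'}"
  shows "(LINT x|surface_measure. sph_harm l m x * cnj (sph_harm l' m' x)) = (if l = l' \<and> m = m' then 1 else 0)"
proof -
  define k k' where "k = nat \<bar>m\<bar>" and "k' = nat \<bar>m'\<bar>"
  have k: "k \<le> l" "k' \<le> l'" using assms by (auto simp: k_def k'_def)
  have "(LINT x|surface_measure. sph_harm l m x * cnj (sph_harm l' m' x))
     = of_real (LBINT \<theta>:{0..pi}. sin \<theta> *
         (harm_const l m * harm_const l' m' * poly (rodrigues l (l + k)) (cos \<theta>)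
             * poly (rodrigues l' (l' + k')) (cos \<theta>) * sin \<theta> ^ k * sin \<theta> ^ k'))
       * (LBINT \<phi>:{0..<2 * pi}. exp (\<i> * of_int (m - m') * of_real \<phi>))"
  proof (rule surface_integral_separated)
    show "continuous_on S2 (\<lambda>x. sph_harm l m x * cnj (sph_harm l' m' x))"
      by (intro continuous_intros continuous_on_sph_harm assms)
    show "sph_harm l m (sph \<theta> \<phi>) * cnj (sph_harm l' m' (sph \<theta> \<phi>))
      = of_real (harm_const l m * harm_const l' m' * poly (rodrigues l (l + k)) (cos \<theta>)
             * poly (rodrigues l' (l' + k')) (cos \<theta>) * sin \<theta> ^ k * sin \<theta> ^ k') * exp (\<i> * of_int (m - m') * of_real \<phi>)"
      for \<theta> \<phi>
    proof -
      have "exp (\<i> * of_int (m - m') * of_real \<phi>) = exp (\<i> * of_int m * of_real \<phi>) * cnj (exp (\<i> * of_int m' * of_real \<phi>))"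
        unfolding exp_cnj exp_add[symmetric] by (simp add: algebra_simps)
      then show ?thesis
        by (simp add: sph_harm_sph[OF assms(1)] sph_harm_sph[OF assms(2)] k_def k'_def mult_ac)
    qed
  qed
  also have "\<dots> = (if l = l' \<and> m = m' then 1 else 0)"
  proof (cases "m = m'")
    case True
    then have kk: "k' = k" by (simp add: k_def k'_def)
    have "(LBINT \<theta>:{0..pi}. sin \<theta> *
         (harm_const l m * harm_const l' m' * poly (rodrigues l (l + k)) (cos \<theta>)
             * poly (rodrigues l' (l' + k')) (cos \<theta>) * sin \<theta> ^ k * sin \<theta> ^ k'))
       = polar_integral (smult (harm_const l m * harm_const l' m') ([:1, 0, -1:] ^ k * rodrigues l (l + k) * rodrigues l' (l' + k)))"
    proof -
      have "sin t ^ k * sin t ^ k = poly ([:1, 0, -1:] ^ k) (cos t)" for t :: real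
      proof -
        have "sin t ^ k * sin t ^ k = ((sin t)\<^sup>2) ^ k" by (simp add: power2_eq_square power_mult_distrib)
        also have "\<dots> = (1 - (cos t)\<^sup>2) ^ k" by (simp only: sin_squared_eq)
        finally show ?thesis by (simp add: power2_eq_square)
      qed
      then show ?thesis
        unfolding polar_integral_def kk by (intro arg_cong[where f = "set_lebesgue_integral _ _"] ext) (simp add: mult_ac)
    qed
    also have "\<dots> = (if l = l' then 1 / (2 * pi) else 0)"
    proof (cases "l = l'")
      case ll: True
      have "(harm_const l m)\<^sup>2 = (2 * real l + 1) * fact (l - k) / (4 * pi * fact (l + k)) / (2 ^ l * fact l)\<^sup>2"
        by (simp add: harm_const_def k_def power_mult_distrib power_divide minus_one_power_iff)
      then show ?thesis
        using ll True k
        by (simp add: polar_integral_smult rodrigues_orthogonal flip: power2_eq_square)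
    next
      case False
      then show ?thesis using k kk by (simp add: polar_integral_smult rodrigues_orthogonal)
    qed
    finally show ?thesis using True unfolding integral_exp_circle by simp
  next
    case False
    then show ?thesis unfolding integral_exp_circle by simp
  qed
  finally show ?thesis .
qed

section \<open>Smoothness of the spherical harmonics\<close>

text \<open>Polynomials in the coordinates with complex coefficients. The inductive form makes closure under
  directional derivatives an easy induction, and so smoothness of all orders.\<close>
inductive sphere_poly :: "(real^3 \<Rightarrow> complex) \<Rightarrow> bool" where
  const: "sphere_poly (\<lambda>x. c)"
| coordinate: "sphere_poly (\<lambda>x. of_real (x $ i))"
| add: "sphere_poly f \<Longrightarrow> sphere_poly g \<Longrightarrow> sphere_poly (\<lambda>x. f x + g x)"
| mult: "sphere_poly f \<Longrightarrow> sphere_poly g \<Longrightarrow> sphere_poly (\<lambda>x. f x * g x)"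

lemma sphere_poly_power: "sphere_poly f \<Longrightarrow> sphere_poly (\<lambda>x. f x ^ n)"
  by (induction n) (auto intro: sphere_poly.intros)

lemma sphere_poly_has_derivative:
  "sphere_poly f \<Longrightarrow> \<exists>D. (\<forall>x. (f has_derivative D x) (at x)) \<and> (\<forall>v. sphere_poly (\<lambda>x. D x v))"
proof (induction rule: sphere_poly.induct)
  case (const c)
  show ?case by (rule exI[of _ "\<lambda>x v. 0"]) (auto intro: sphere_poly.intros)
next
  case (coordinate i)
  have "((\<lambda>x::real^3. complex_of_real (x $ i)) has_derivative (\<lambda>v. of_real (v $ i))) (at x)" for x
    by (intro bounded_linear_imp_has_derivative bounded_linear_compose[OF bounded_linear_of_real] bounded_linear_vec_nth)
  then show ?case by (intro exI[of _ "\<lambda>x v. of_real (v $ i)"]) (auto intro: sphere_poly.intros)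
next
  case (add f g)
  then obtain D E where
    "\<And>x. (f has_derivative D x) (at x)" "\<And>v. sphere_poly (\<lambda>x. D x v)"
    "\<And>x. (g has_derivative E x) (at x)" "\<And>v. sphere_poly (\<lambda>x. E x v)" by blast
  then show ?case
    by (intro exI[of _ "\<lambda>x v. D x v + E x v"]) (auto intro!: sphere_poly.intros derivative_intros)
next
  case (mult f g)
  then obtain D E where
    "\<And>x. (f has_derivative D x) (at x)" "\<And>v. sphere_poly (\<lambda>x. D x v)"
    "\<And>x. (g has_derivative E x) (at x)" "\<And>v. sphere_poly (\<lambda>x. E x v)" by blast
  then show ?case using mult.hyps
    by (intro exI[of _ "\<lambda>x v. f x * E x v + D x v * g x"])
       (auto intro!: sphere_poly.add sphere_poly.mult derivative_eq_intros simp: fun_eq_iff)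
qed

lemma Ck_on_sphere_poly: "sphere_poly f \<Longrightarrow> Ck_on k f UNIV"
proof (induction k arbitrary: f)
  case 0
  then obtain D where "\<And>x. (f has_derivative D x) (at x)"
    using sphere_poly_has_derivative by blast
  then show ?case
    by (auto simp: continuous_on_eq_continuous_at intro: has_derivative_continuous)
next
  case (Suc k)
  then obtain D where D: "\<And>x. (f has_derivative D x) (at x)" "\<And>v. sphere_poly (\<lambda>x. D x v)"
    using sphere_poly_has_derivative by blast
  have "(\<lambda>x. frechet_derivative f (at x) v) = (\<lambda>x. D x v)" for v
    using frechet_derivative_at[OF D(1)] by simp
  moreover have "f differentiable_on UNIV"
    using D(1) by (auto simp: differentiable_on_def differentiable_def)
  ultimately show ?case using Suc.IH D(2) by simp
qed

lemma sphere_poly_poly: "sphere_poly (\<lambda>x. of_real (poly p (x $ 3)))"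
proof (induction p)
  case 0
  then show ?case by (simp add: sphere_poly.const)
next
  case (pCons a p)
  then show ?case
    using sphere_poly.add[OF sphere_poly.const[of "of_real a"] sphere_poly.mult[OF sphere_poly.coordinate[of 3] pCons(2)]]
    by simp
qed

lemma sphere_poly_azimuthal: "sphere_poly (azimuthal m)"
proof -
  have a: "sphere_poly (\<lambda>x. Complex (x $ 1) (x $ 2))"
    unfolding Complex_eq by (intro sphere_poly.intros)
  have "sphere_poly (\<lambda>x. of_real (x $ 1) + (- \<i>) * of_real (x $ 2))"
    by (intro sphere_poly.intros)
  moreover have "(\<lambda>x::real^3. of_real (x $ 1) + (- \<i>) * of_real (x $ 2)) = (\<lambda>x. cnj (Complex (x $ 1) (x $ 2)))"
    by (auto simp: complex_eq_iff)
  ultimately have "sphere_poly (\<lambda>x. cnj (Complex (x $ 1) (x $ 2)))" by simp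
  with a show ?thesis unfolding azimuthal_def
    by (cases "0 \<le> m") (auto intro: sphere_poly_power)
qed

lemma smooth_sph_harm:
  assumes "m \<in> {- int l..int l}"
  shows "smooth_on_sphere (sph_harm l m)"
  unfolding smooth_on_sphere_def
proof (intro exI conjI ballI allI)
  let ?F = "\<lambda>x. of_real (harm_const l m) * of_real (poly (rodrigues l (l + nat \<bar>m\<bar>)) (x $ 3)) * azimuthal m x"
  show "Ck_on k ?F UNIV" for k
    by (intro Ck_on_sphere_poly sphere_poly.mult sphere_poly.const sphere_poly_poly sphere_poly_azimuthal)
  show "?F x = sph_harm l m x" if "x \<in> S2" for x
    using sph_harm_closed_form[OF that assms] by simp
qed auto

section \<open>The spherical harmonics as eigenfunctions\<close>

text \<open>With \<open>x = cos \<theta>\<close>, the polar part of the Laplacian applied to \<open>q(cos \<theta>) sin\<^sup>k \<theta>\<close> is the differential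
  equation of \<open>q\<close> in disguise. The statement is multiplied through by \<open>sin\<^sup>2 \<theta>\<close>, so that it holds for all
  \<open>\<theta>\<close>, also at the poles.\<close>
lemma associated_legendre_eigen:
  fixes l k :: nat
  defines "p \<equiv> \<lambda>\<theta>. poly (rodrigues l (l + k)) (cos \<theta>) * sin \<theta> ^ k"
  obtains p' q' where "\<And>\<theta>. (p has_real_derivative p' \<theta>) (at \<theta>)"
    "\<And>\<theta>. ((\<lambda>a. sin a * p' a) has_real_derivative q' \<theta>) (at \<theta>)"
    "\<And>\<theta>. sin \<theta> * q' \<theta> - (real k)\<^sup>2 * p \<theta> = - (real l * (real l + 1)) * (sin \<theta>)\<^sup>2 * p \<theta>"
proof
  define W where "W j \<theta> = poly (rodrigues l (l + k + j)) (cos \<theta>)" for j \<theta>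
  have dW: "(W j has_real_derivative - sin \<theta> * W (Suc j) \<theta>) (at \<theta>)" for j \<theta>
    unfolding W_def by (rule derivative_eq_intros poly_DERIV[THEN DERIV_chain2] refl | simp)+
  have ds: "((\<lambda>\<theta>. sin \<theta> ^ n) has_real_derivative real n * sin \<theta> ^ (n - 1) * cos \<theta>) (at \<theta>)" for n \<theta>
    by (rule derivative_eq_intros refl | simp)+
  have ks: "real k * sin \<theta> ^ (k - 1) * sin \<theta> = real k * sin \<theta> ^ k" for \<theta>
    by (cases k) simp_all
  define p' where "p' \<theta> = - sin \<theta> * W 1 \<theta> * sin \<theta> ^ k + W 0 \<theta> * (real k * sin \<theta> ^ (k - 1) * cos \<theta>)" for \<theta>
  define q' where "q' \<theta> = - (- sin \<theta> * W 2 \<theta> * sin \<theta> ^ (k + 2) + W 1 \<theta> * (real (k + 2) * sin \<theta> ^ (k + 1) * cos \<theta>))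
     + real k * ((- sin \<theta> * W 1 \<theta> * sin \<theta> ^ k + W 0 \<theta> * (real k * sin \<theta> ^ (k - 1) * cos \<theta>)) * cos \<theta>
     - W 0 \<theta> * sin \<theta> ^ k * sin \<theta>)" for \<theta>
  have p: "p = (\<lambda>\<theta>. W 0 \<theta> * sin \<theta> ^ k)" by (simp add: p_def W_def)
  show dp: "(p has_real_derivative p' \<theta>) (at \<theta>)" for \<theta>
    unfolding p p'_def by (rule derivative_eq_intros dW ds refl | simp)+
  have "sin \<theta> * p' \<theta> = - (W 1 \<theta> * sin \<theta> ^ (k + 2)) + real k * (W 0 \<theta> * sin \<theta> ^ k * cos \<theta>)" for \<theta>
  proof -
    have "sin \<theta> * p' \<theta> = - (W 1 \<theta> * sin \<theta> ^ (k + 2)) + W 0 \<theta> * (real k * sin \<theta> ^ (k - 1) * sin \<theta>) * cos \<theta>"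
      unfolding p'_def by (simp add: algebra_simps)
    then show ?thesis unfolding ks by (simp add: algebra_simps)
  qed
  moreover have "((\<lambda>\<theta>. - (W 1 \<theta> * sin \<theta> ^ (k + 2)) + real k * (W 0 \<theta> * sin \<theta> ^ k * cos \<theta>)) has_real_derivative q' \<theta>) (at \<theta>)" for \<theta>
    unfolding q'_def by (rule derivative_eq_intros dW ds refl)+ (simp add: numeral_2_eq_2 algebra_simps)
  ultimately show "((\<lambda>a. sin a * p' a) has_real_derivative q' \<theta>) (at \<theta>)" for \<theta> by simp
  show "sin \<theta> * q' \<theta> - (real k)\<^sup>2 * p \<theta> = - (real l * (real l + 1)) * (sin \<theta>)\<^sup>2 * p \<theta>" for \<theta>
  proof -
    define s x where "s = sin \<theta>" and "x = cos \<theta>"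
    have x2: "x * x = 1 - s * s"
      using sin_cos_squared_add[of \<theta>] by (simp add: s_def x_def power2_eq_square)
    have ode: "s * s * W 2 \<theta> = 2 * (real k + 1) * x * W 1 \<theta> + (real l + real k + 1) * (real k - real l) * W 0 \<theta>"
      using legendre_ode[of x l "l + k"] by (simp add: W_def x_def[symmetric] x2 power2_eq_square algebra_simps)
    have "s * q' \<theta> = s ^ k * (s * s * (s * s * W 2 \<theta>)) - s ^ k * (real k + 2) * W 1 \<theta> * x * (s * s)
        - real k * s ^ k * (s * s) * W 1 \<theta> * x + real k * (real k * s ^ (k - 1) * s) * W 0 \<theta> * (x * x) - real k * W 0 \<theta> * s ^ k * (s * s)"
      unfolding q'_def s_def[symmetric] x_def[symmetric] by (simp add: algebra_simps power2_eq_square)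
    also have "real k * s ^ (k - 1) * s = real k * s ^ k" using ks by (simp add: s_def)
    finally show ?thesis
      unfolding ode x2 p s_def[symmetric] by (simp add: algebra_simps power2_eq_square)
  qed
qed

lemma sin_colatitude_nonzero:
  assumes "x \<in> S2 - poles"
  shows "sin (colatitude x) \<noteq> 0"
proof
  assume "sin (colatitude x) = 0"
  moreover have x3: "\<bar>x $ 3\<bar> \<le> 1" using S2_third assms by blast
  ultimately have "(x $ 3)\<^sup>2 = 1"
    by (simp add: colatitude_def sin_arccos_abs)
  moreover have "(x $ 1)\<^sup>2 + (x $ 2)\<^sup>2 + (x $ 3)\<^sup>2 = 1" using assms S2_iff by blast
  ultimately have "x $ 1 = 0" "x $ 2 = 0" "x $ 3 = 1 \<or> x $ 3 = -1"
    by (auto simp: sum_power2_eq_zero_iff power2_eq_1_iff)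
  then have "x = sph 0 0 \<or> x = sph pi 0"
    by (auto simp: vec_eq_iff forall_3)
  then show False using assms by (simp add: poles_def)
qed

lemma laplace_beltrami_chart_sph_harm:
  assumes m: "m \<in> {- int l..int l}" and s: "sin \<theta> \<noteq> 0"
  shows "laplace_beltrami_chart (sph_harm l m) \<theta> \<phi> = - of_nat (l * (l + 1)) * sph_harm l m (sph \<theta> \<phi>)"
proof -
  define k where "k = nat \<bar>m\<bar>"
  define p where "p = (\<lambda>\<theta>. poly (rodrigues l (l + k)) (cos \<theta>) * sin \<theta> ^ k)"
  obtain p' q' where p': "\<And>\<theta>. (p has_real_derivative p' \<theta>) (at \<theta>)"
    and q': "\<And>\<theta>. ((\<lambda>a. sin a * p' a) has_real_derivative q' \<theta>) (at \<theta>)"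
    and eq: "\<And>\<theta>. sin \<theta> * q' \<theta> - (real k)\<^sup>2 * p \<theta> = - (real l * (real l + 1)) * (sin \<theta>)\<^sup>2 * p \<theta>"
    unfolding p_def by (rule associated_legendre_eigen) blast
  define E where "E \<phi> = of_real (harm_const l m) * exp (\<i> * of_int m * of_real \<phi>)" for \<phi> :: real
  have Y: "sph_harm l m (sph \<theta> \<phi>) = of_real (p \<theta>) * E \<phi>" for \<theta> \<phi>
    by (simp add: sph_harm_sph[OF m] p_def E_def k_def mult_ac)
  have vd: "((\<lambda>a. of_real (g a) * c) has_vector_derivative of_real g' * c) (at a)"
    if "(g has_real_derivative g') (at a)" for g g' a and c :: complex
    using that by (intro has_vector_derivative_mult_left has_vector_derivative_of_real)
      (simp add: has_real_derivative_iff_has_vector_derivative)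
  have E': "(E has_vector_derivative \<i> * of_int m * E \<phi>) (at \<phi>)" for \<phi>
    unfolding E_def by (auto intro!: derivative_eq_intros has_vector_derivative_real_field)
  have "vector_derivative (\<lambda>b. sph_harm l m (sph b \<phi>)) (at a) = of_real (p' a) * E \<phi>" for a
    unfolding Y by (intro vector_derivative_at vd p')
  then have 1: "vector_derivative (\<lambda>a. sin a *\<^sub>R vector_derivative (\<lambda>b. sph_harm l m (sph b \<phi>)) (at a)) (at \<theta>)
      = of_real (q' \<theta>) * E \<phi>"
    using vector_derivative_at[OF vd[OF q', of "E \<phi>" \<theta>]] by (simp add: scaleR_conv_of_real mult.assoc)
  have "vector_derivative (\<lambda>b. sph_harm l m (sph \<theta> b)) (at a) = of_real (p \<theta>) * (\<i> * of_int m * E a)" for a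
    unfolding Y by (intro vector_derivative_at has_vector_derivative_mult_right E')
  moreover have "((\<lambda>a. of_real (p \<theta>) * (\<i> * of_int m * E a)) has_vector_derivative
      of_real (p \<theta>) * (\<i> * of_int m * (\<i> * of_int m * E \<phi>))) (at \<phi>)"
    by (intro has_vector_derivative_mult_right E')
  ultimately have 2: "vector_derivative (\<lambda>a. vector_derivative (\<lambda>b. sph_harm l m (sph \<theta> b)) (at a)) (at \<phi>)
      = - (of_real (real k))\<^sup>2 * of_real (p \<theta>) * E \<phi>"
  proof -
    have "(of_real (real k))\<^sup>2 = (of_int m :: complex)\<^sup>2"
      by (simp add: k_def of_nat_nat flip: of_real_power of_int_power)
    then show ?thesis
      using vector_derivative_at[OF \<open>((\<lambda>a. of_real (p \<theta>) * (\<i> * of_int m * E a)) has_vector_derivative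
      of_real (p \<theta>) * (\<i> * of_int m * (\<i> * of_int m * E \<phi>))) (at \<phi>)\<close>] \<open>\<And>a. vector_derivative (\<lambda>b. sph_harm l m (sph \<theta> b)) (at a) = of_real (p \<theta>) * (\<i> * of_int m * E a)\<close>
      by (simp add: power2_eq_square mult_ac)
  qed
  have "1 / sin \<theta> * q' \<theta> - 1 / (sin \<theta>)\<^sup>2 * ((real k)\<^sup>2 * p \<theta>) = - (real l * (real l + 1)) * p \<theta>"
    using eq[of \<theta>] s by (simp add: field_simps power2_eq_square)
  then have "of_real (1 / sin \<theta> * q' \<theta> - 1 / (sin \<theta>)\<^sup>2 * ((real k)\<^sup>2 * p \<theta>)) * E \<phi> = of_real (- (real l * (real l + 1)) * p \<theta>) * E \<phi>"
    by simp
  then show ?thesis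
    unfolding laplace_beltrami_chart_def 1 2 unfolding Y by (simp add: scaleR_conv_of_real algebra_simps)
qed

text \<open>The value of the Laplacian at a pole is defined as a limit over the rest of the sphere; it is
  unique because the sphere is connected and so has no isolated points.\<close>
lemma poles_limit_point:
  assumes "x \<in> S2"
  shows "at x within (S2 - poles) \<noteq> bot"
proof -
  have "connected S2" by (rule connected_sphere) simp
  moreover have "\<not> (\<exists>a. S2 = {a})"
  proof
    assume "\<exists>a. S2 = {a}"
    then have "sph 0 0 = sph pi 0" using sph_in_S2 by (metis singletonD)
    then have "sph 0 0 $ 3 = sph pi 0 $ 3" by simp
    then show False by simp
  qed
  ultimately have "x islimpt S2" using connected_imp_perfect assms by blast
  then have "x islimpt (poles \<union> (S2 - poles))"
    by (rule islimpt_subset) auto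
  moreover have "finite poles" by (simp add: poles_def)
  ultimately have "x islimpt (S2 - poles)" by (simp only: islimpt_Un_finite)
  then show ?thesis by (simp only: trivial_limit_within not_not)
qed

lemma laplace_beltrami_sph_harm:
  assumes m: "m \<in> {- int l..int l}" and x: "x \<in> S2"
  shows "laplace_beltrami (sph_harm l m) x = - of_nat (l * (l + 1)) * sph_harm l m x"
proof -
  have off: "laplace_beltrami_chart (sph_harm l m) (colatitude y) (longitude y) = - of_nat (l * (l + 1)) * sph_harm l m y"
    if "y \<in> S2 - poles" for y
    using laplace_beltrami_chart_sph_harm[OF m sin_colatitude_nonzero[OF that]] that
    by (simp add: sph_colatitude_longitude)
  show ?thesis
  proof (cases "x \<in> poles")
    case True
    have "continuous_on S2 (\<lambda>y. - of_nat (l * (l + 1)) * sph_harm l m y)"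
      by (intro continuous_intros continuous_on_sph_harm m)
    then have "((\<lambda>y. - of_nat (l * (l + 1)) * sph_harm l m y) \<longlongrightarrow> - of_nat (l * (l + 1)) * sph_harm l m x) (at x within S2)"
      using x by (auto simp: continuous_on)
    then have "((\<lambda>y. - of_nat (l * (l + 1)) * sph_harm l m y) \<longlongrightarrow> - of_nat (l * (l + 1)) * sph_harm l m x) (at x within (S2 - poles))"
      by (rule tendsto_within_subset) auto
    then have "((\<lambda>y. laplace_beltrami_chart (sph_harm l m) (colatitude y) (longitude y)) \<longlongrightarrow> - of_nat (l * (l + 1)) * sph_harm l m x) (at x within (S2 - poles))"
      by (rule Lim_transform_eventually) (use off in \<open>auto simp: eventually_at_filter\<close>)
    then show ?thesis
      using True poles_limit_point[OF x] by (simp add: laplace_beltrami_def tendsto_Lim)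
  next
    case False
    then show ?thesis using off x by (simp add: laplace_beltrami_def)
  qed
qed

lemma drift_field_sph_harm:
  assumes m: "m \<in> {- int l..int l}" and x: "x \<in> S2"
  shows "drift_field \<mu> (sph_harm l m) x = \<i> * of_real \<mu> * of_int m * sph_harm l m x"
proof -
  define c where "c = complex_of_real (harm_const l m * poly (rodrigues l (l + nat \<bar>m\<bar>)) (cos (colatitude x)) * sin (colatitude x) ^ nat \<bar>m\<bar>)"
  have Y: "(\<lambda>\<phi>. sph_harm l m (sph (colatitude x) \<phi>)) = (\<lambda>\<phi>. c * exp (\<i> * of_int m * of_real \<phi>))"
    by (simp add: sph_harm_sph[OF m] c_def)
  have "((\<lambda>\<phi>. c * exp (\<i> * of_int m * of_real \<phi>)) has_vector_derivative
      \<i> * of_int m * (c * exp (\<i> * of_int m * of_real \<phi>))) (at \<phi>)" for \<phi>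
    by (auto intro!: derivative_eq_intros has_vector_derivative_real_field)
  then have "drift_field \<mu> (sph_harm l m) x = \<mu> *\<^sub>R (\<i> * of_int m * sph_harm l m (sph (colatitude x) (longitude x)))"
    unfolding drift_field_def Y by (simp add: vector_derivative_at Y[THEN fun_cong])
  then show ?thesis
    by (simp add: sph_colatitude_longitude[OF x] scaleR_conv_of_real)
qed

lemma drift_operator_sph_harm:
  assumes "m \<in> {- int l..int l}" "x \<in> S2"
  shows "drift_operator \<mu> (sph_harm l m) x
    = (\<i> * of_real \<mu> * of_int m - of_nat (l * (l + 1))) * sph_harm l m x"
  by (simp only: drift_operator_def laplace_beltrami_sph_harm[OF assms] drift_field_sph_harm[OF assms])
     (simp add: algebra_simps)

section \<open>The space \<open>L\<^sup>2\<close> of the sphere\<close>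

lemma L2_measurable: "L2 f \<Longrightarrow> f \<in> borel_measurable surface_measure"
  and L2_integrable_square: "L2 f \<Longrightarrow> integrable surface_measure (\<lambda>x. (cmod (f x))\<^sup>2)"
  by (simp_all add: L2_def)

lemma L2_norm_nonneg [simp]: "0 \<le> L2_norm f"
  by (simp add: L2_norm_def)

lemma L2_norm_square: "(L2_norm f)\<^sup>2 = (LINT x|surface_measure. (cmod (f x))\<^sup>2)"
  by (simp add: L2_norm_def)

lemma L2_cong:
  assumes "\<And>x. x \<in> S2 \<Longrightarrow> f x = g x"
  shows "L2 f \<longleftrightarrow> L2 g" "L2_norm f = L2_norm g" "fourier_laplace f l m = fourier_laplace g l m"
proof -
  have "f \<in> borel_measurable surface_measure \<longleftrightarrow> g \<in> borel_measurable surface_measure"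
    by (rule measurable_cong) (simp add: assms)
  moreover have "integrable surface_measure (\<lambda>x. (cmod (f x))\<^sup>2) \<longleftrightarrow> integrable surface_measure (\<lambda>x. (cmod (g x))\<^sup>2)"
    by (rule Bochner_Integration.integrable_cong) (simp_all add: assms)
  ultimately show "L2 f \<longleftrightarrow> L2 g" by (simp add: L2_def)
  show "L2_norm f = L2_norm g"
    unfolding L2_norm_def by (intro arg_cong[where f = sqrt] Bochner_Integration.integral_cong) (simp_all add: assms)
  show "fourier_laplace f l m = fourier_laplace g l m"
    unfolding fourier_laplace_def by (intro Bochner_Integration.integral_cong) (simp_all add: assms)
qed

lemma L2_continuous: "continuous_on S2 f \<Longrightarrow> L2 f"
  unfolding L2_def
  by (intro conjI continuous_imp_measurable_surface continuous_imp_integrable_surface continuous_intros)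

lemma L2_dominated:
  assumes "f \<in> borel_measurable surface_measure" "integrable surface_measure h"
    "\<And>x. x \<in> S2 \<Longrightarrow> (cmod (f x))\<^sup>2 \<le> h x"
  shows "L2 f"
  unfolding L2_def
proof
  have "0 \<le> h x" if "x \<in> S2" for x using assms(3)[OF that] order_trans zero_le_power2 by blast
  then show "integrable surface_measure (\<lambda>x. (cmod (f x))\<^sup>2)"
    using assms by (intro Bochner_Integration.integrable_bound[OF assms(2)]) (auto intro!: AE_I2)
qed (rule assms)

lemma cmod_add_square_le: "(cmod (a + b))\<^sup>2 \<le> 2 * (cmod a)\<^sup>2 + 2 * (cmod b)\<^sup>2"
proof -
  have "(cmod (a + b))\<^sup>2 \<le> (cmod a + cmod b)\<^sup>2"
    by (intro power_mono norm_triangle_ineq) simp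
  also have "\<dots> \<le> 2 * (cmod a)\<^sup>2 + 2 * (cmod b)\<^sup>2"
    using sum_squares_bound[of "cmod a" "cmod b"] by (simp add: power2_eq_square algebra_simps)
  finally show ?thesis .
qed

lemma L2_add: "L2 f \<Longrightarrow> L2 g \<Longrightarrow> L2 (\<lambda>x. f x + g x)"
  by (rule L2_dominated[where h = "\<lambda>x. 2 * (cmod (f x))\<^sup>2 + 2 * (cmod (g x))\<^sup>2"])
     (auto simp: L2_def cmod_add_square_le)

lemma L2_cmult: "L2 f \<Longrightarrow> L2 (\<lambda>x. c * f x)"
  by (auto simp: L2_def norm_mult power_mult_distrib)

lemma L2_diff: "L2 f \<Longrightarrow> L2 g \<Longrightarrow> L2 (\<lambda>x. f x - g x)"
  using L2_add[of f "\<lambda>x. (-1) * g x"] L2_cmult[of g "-1"] by simp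

lemma L2_zero: "L2 (\<lambda>x. 0)" by (simp add: L2_def)

lemma L2_sum: "(\<And>i. i \<in> I \<Longrightarrow> L2 (f i)) \<Longrightarrow> L2 (\<lambda>x. \<Sum>i\<in>I. f i x)"
  by (induction I rule: infinite_finite_induct) (auto intro: L2_zero L2_add)

lemma L2_norm_mult_integrable:
  assumes "L2 f" "L2 g"
  shows "integrable surface_measure (\<lambda>x. cmod (f x) * cmod (g x))"
proof (rule Bochner_Integration.integrable_bound)
  show "integrable surface_measure (\<lambda>x. (cmod (f x))\<^sup>2 + (cmod (g x))\<^sup>2)"
    using assms by (auto simp: L2_def)
  show "AE x in surface_measure. norm (cmod (f x) * cmod (g x)) \<le> norm ((cmod (f x))\<^sup>2 + (cmod (g x))\<^sup>2)"
  proof (intro AE_I2)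
    fix x
    have "2 * (cmod (f x) * cmod (g x)) \<le> (cmod (f x))\<^sup>2 + (cmod (g x))\<^sup>2"
      using sum_squares_bound[of "cmod (f x)" "cmod (g x)"] by simp
    moreover have "0 \<le> cmod (f x) * cmod (g x)" by simp
    ultimately have "cmod (f x) * cmod (g x) \<le> (cmod (f x))\<^sup>2 + (cmod (g x))\<^sup>2" by linarith
    then show "norm (cmod (f x) * cmod (g x)) \<le> norm ((cmod (f x))\<^sup>2 + (cmod (g x))\<^sup>2)"
      by simp
  qed
qed (use assms in \<open>auto simp: L2_def\<close>)

lemma borel_measurable_cnj: "f \<in> borel_measurable M \<Longrightarrow> (\<lambda>x. cnj (f x)) \<in> borel_measurable M"
  by (rule measurable_compose[where g = cnj and N = borel])
     (auto intro!: borel_measurable_continuous_onI continuous_intros)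

lemma L2_mult_integrable:
  assumes "L2 f" "L2 g"
  shows "integrable surface_measure (\<lambda>x. f x * cnj (g x))"
  by (rule Bochner_Integration.integrable_bound[OF L2_norm_mult_integrable[OF assms]])
     (use assms in \<open>auto simp: L2_def norm_mult intro!: AE_I2 borel_measurable_times borel_measurable_cnj\<close>)

lemma L2_norm_square_complex:
  "complex_of_real ((L2_norm g)\<^sup>2) = (LINT x|surface_measure. g x * cnj (g x))"
proof -
  have "(LINT x|surface_measure. g x * cnj (g x)) = (LINT x|surface_measure. complex_of_real ((cmod (g x))\<^sup>2))"
    by (simp only: complex_norm_square)
  also have "\<dots> = of_real (LINT x|surface_measure. (cmod (g x))\<^sup>2)" by (rule integral_complex_of_real)
  finally show ?thesis by (simp only: L2_norm_square)
qed

text \<open>The quadratic polynomial \<open>t \<mapsto> \<integral> (\<bar>f\<bar> - t \<bar>g\<bar>)\<^sup>2\<close> is nonnegative; evaluate it at its minimum, or, if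
  \<open>g\<close> has norm \<open>0\<close>, at a \<open>t\<close> that would make it negative.\<close>
lemma Cauchy_Schwarz_norms:
  assumes "L2 f" "L2 g"
  shows "(LINT x|surface_measure. cmod (f x) * cmod (g x)) \<le> L2_norm f * L2_norm g"
proof -
  let ?I = "LINT x|surface_measure. cmod (f x) * cmod (g x)"
  note int = L2_norm_mult_integrable[OF assms] L2_integrable_square[OF assms(1)] L2_integrable_square[OF assms(2)]
  have I0: "0 \<le> ?I" by (rule Bochner_Integration.integral_nonneg) simp
  have quad: "0 \<le> (L2_norm f)\<^sup>2 - 2 * t * ?I + t\<^sup>2 * (L2_norm g)\<^sup>2" for t
  proof -
    have "0 \<le> (LINT x|surface_measure. (cmod (f x) - t * cmod (g x))\<^sup>2)" by simp
    also have "\<dots> = (LINT x|surface_measure. (cmod (f x))\<^sup>2 - 2 * t * (cmod (f x) * cmod (g x)) + t\<^sup>2 * (cmod (g x))\<^sup>2)"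
      by (intro Bochner_Integration.integral_cong) (auto simp: power2_eq_square algebra_simps)
    also have "\<dots> = (L2_norm f)\<^sup>2 - 2 * t * ?I + t\<^sup>2 * (L2_norm g)\<^sup>2"
      using int by (simp add: L2_norm_square)
    finally show ?thesis .
  qed
  have "?I\<^sup>2 \<le> (L2_norm f)\<^sup>2 * (L2_norm g)\<^sup>2"
  proof (cases "L2_norm g = 0")
    case True
    have "?I = 0"
    proof (rule ccontr)
      assume "?I \<noteq> 0"
      then have "2 * (((L2_norm f)\<^sup>2 + 1) / (2 * ?I)) * ?I = (L2_norm f)\<^sup>2 + 1" by (simp add: field_simps)
      then show False using quad[of "((L2_norm f)\<^sup>2 + 1) / (2 * ?I)"] True by simp
    qed
    then show ?thesis by simp
  next
    case False
    then have "(L2_norm f)\<^sup>2 - 2 * (?I / (L2_norm g)\<^sup>2) * ?I + (?I / (L2_norm g)\<^sup>2)\<^sup>2 * (L2_norm g)\<^sup>2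
        = (L2_norm f)\<^sup>2 - ?I\<^sup>2 / (L2_norm g)\<^sup>2"
      by (simp add: field_simps power2_eq_square)
    then have "?I\<^sup>2 / (L2_norm g)\<^sup>2 \<le> (L2_norm f)\<^sup>2" using quad[of "?I / (L2_norm g)\<^sup>2"] by simp
    then show ?thesis using False by (simp add: field_simps)
  qed
  then have "?I\<^sup>2 \<le> (L2_norm f * L2_norm g)\<^sup>2" by (simp add: power_mult_distrib)
  then show ?thesis by (rule power2_le_imp_le) simp
qed

lemma Cauchy_Schwarz_L2:
  assumes "L2 f" "L2 g"
  shows "cmod (LINT x|surface_measure. f x * cnj (g x)) \<le> L2_norm f * L2_norm g"
proof -
  have "cmod (LINT x|surface_measure. f x * cnj (g x)) \<le> (LINT x|surface_measure. cmod (f x * cnj (g x)))"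
    by (rule integral_norm_bound)
  also have "\<dots> = (LINT x|surface_measure. cmod (f x) * cmod (g x))" by (simp add: norm_mult)
  finally show ?thesis using Cauchy_Schwarz_norms[OF assms] by simp
qed

lemma L2_norm_triangle:
  assumes "L2 f" "L2 g"
  shows "L2_norm (\<lambda>x. f x + g x) \<le> L2_norm f + L2_norm g"
proof (rule power2_le_imp_le)
  note int = L2_norm_mult_integrable[OF assms] L2_integrable_square[OF assms(1)] L2_integrable_square[OF assms(2)]
  have "(L2_norm (\<lambda>x. f x + g x))\<^sup>2 \<le> (LINT x|surface_measure. (cmod (f x))\<^sup>2 + 2 * (cmod (f x) * cmod (g x)) + (cmod (g x))\<^sup>2)"
    unfolding L2_norm_square
  proof (rule integral_mono)
    show "(cmod (f x + g x))\<^sup>2 \<le> (cmod (f x))\<^sup>2 + 2 * (cmod (f x) * cmod (g x)) + (cmod (g x))\<^sup>2" for x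
      using power_mono[OF norm_triangle_ineq[of "f x" "g x"], of 2]
      by (simp add: power2_eq_square algebra_simps)
  qed (use int L2_add[OF assms] in \<open>auto simp: L2_def\<close>)
  also have "\<dots> = (L2_norm f)\<^sup>2 + 2 * (LINT x|surface_measure. cmod (f x) * cmod (g x)) + (L2_norm g)\<^sup>2"
    using int by (simp add: L2_norm_square)
  also have "\<dots> \<le> (L2_norm f)\<^sup>2 + 2 * (L2_norm f * L2_norm g) + (L2_norm g)\<^sup>2"
    using Cauchy_Schwarz_norms[OF assms] by simp
  finally show "(L2_norm (\<lambda>x. f x + g x))\<^sup>2 \<le> (L2_norm f + L2_norm g)\<^sup>2"
    by (simp add: power2_eq_square algebra_simps)
qed simp

lemma L2_norm_cmult: "L2_norm (\<lambda>x. c * f x) = cmod c * L2_norm f"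
  by (simp add: L2_norm_def norm_mult power_mult_distrib real_sqrt_mult)

lemma L2_norm_diff_triangle:
  assumes "L2 f" "L2 g" "L2 h"
  shows "L2_norm (\<lambda>x. f x - h x) \<le> L2_norm (\<lambda>x. f x - g x) + L2_norm (\<lambda>x. g x - h x)"
  using L2_norm_triangle[OF L2_diff[OF assms(1,2)] L2_diff[OF assms(2,3)]] by simp

lemma L2_norm_le_uniform:
  assumes "f \<in> borel_measurable surface_measure" "\<And>x. x \<in> S2 \<Longrightarrow> cmod (f x) \<le> e" "0 \<le> e"
  shows "L2_norm f \<le> e * sqrt (measure surface_measure S2)"
proof -
  have "(LINT x|surface_measure. (cmod (f x))\<^sup>2) \<le> (LINT x|surface_measure. e\<^sup>2)"
  proof (rule integral_mono)
    have "L2 f" by (rule L2_dominated[of _ "\<lambda>x. e\<^sup>2"]) (use assms in \<open>auto intro: power_mono\<close>)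
    then show "integrable surface_measure (\<lambda>x. (cmod (f x))\<^sup>2)" by (rule L2_integrable_square)
  qed (use assms in \<open>auto intro: power_mono\<close>)
  also have "\<dots> = e\<^sup>2 * measure surface_measure S2" by simp
  finally show ?thesis
    unfolding L2_norm_def using assms(3)
    by (metis abs_of_nonneg real_sqrt_abs real_sqrt_le_iff real_sqrt_mult)
qed

section \<open>Fourier-Laplace coefficients\<close>

lemma L2_sph_harm: "m \<in> {- int l..int l} \<Longrightarrow> L2 (sph_harm l m)"
  by (intro L2_continuous continuous_on_sph_harm)

definition harm_sum :: "nat \<Rightarrow> (nat \<Rightarrow> int \<Rightarrow> complex) \<Rightarrow> real^3 \<Rightarrow> complex" where
  "harm_sum N c x = (\<Sum>l\<le>N. \<Sum>m\<in>{- int l..int l}. c l m * sph_harm l m x)"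

lemma L2_harm_sum: "L2 (harm_sum N c)"
  unfolding harm_sum_def by (intro L2_sum L2_cmult L2_sph_harm)

lemma continuous_on_harm_sum: "continuous_on S2 (harm_sum N c)"
  unfolding harm_sum_def by (intro continuous_intros continuous_on_sph_harm)

lemma fourier_laplace_diff:
  assumes "L2 f" "L2 g" "m \<in> {- int l..int l}"
  shows "fourier_laplace (\<lambda>x. f x - g x) l m = fourier_laplace f l m - fourier_laplace g l m"
  unfolding fourier_laplace_def
  using L2_mult_integrable[OF assms(1) L2_sph_harm[OF assms(3)]] L2_mult_integrable[OF assms(2) L2_sph_harm[OF assms(3)]]
  by (simp only: left_diff_distrib Bochner_Integration.integral_diff)

lemma fourier_laplace_bound:
  assumes "L2 f" "m \<in> {- int l..int l}"
  shows "cmod (fourier_laplace f l m) \<le> L2_norm f"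
proof -
  have "(L2_norm (sph_harm l m))\<^sup>2 = 1"
  proof -
    have "complex_of_real ((L2_norm (sph_harm l m))\<^sup>2) = (LINT x|surface_measure. sph_harm l m x * cnj (sph_harm l m x))"
      by (rule L2_norm_square_complex)
    then show ?thesis unfolding sph_harm_orthonormal[OF assms(2,2)]
      by (simp only: simp_thms if_True of_real_eq_1_iff)
  qed
  then have "L2_norm (sph_harm l m) = 1"
    using L2_norm_nonneg[of "sph_harm l m"] by (auto simp: power2_eq_1_iff)
  then show ?thesis
    using Cauchy_Schwarz_L2[OF assms(1) L2_sph_harm[OF assms(2)]] by (simp add: fourier_laplace_def)
qed

text \<open>The measure and the factor \<open>h\<close> are general, because both inner products on the sphere
  and integrals against a Markov kernel are computed in this way.\<close>
lemma integral_harm_sum: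
  assumes int: "\<And>l m. m \<in> {- int l..int l} \<Longrightarrow> integrable R (\<lambda>x. sph_harm l m x * h x)"
  shows "(LINT x|R. harm_sum N c x * h x) = (\<Sum>l\<le>N. \<Sum>m\<in>{- int l..int l}. c l m * (LINT x|R. sph_harm l m x * h x))"
proof -
  have int': "integrable R (\<lambda>x. c l m * (sph_harm l m x * h x))" if "m \<in> {- int l..int l}" for l m
    using int[OF that] by simp
  have "(LINT x|R. harm_sum N c x * h x)
      = (LINT x|R. (\<Sum>l\<le>N. \<Sum>m\<in>{- int l..int l}. c l m * (sph_harm l m x * h x)))"
    unfolding harm_sum_def by (simp add: sum_distrib_right mult.assoc)
  also have "\<dots> = (\<Sum>l\<le>N. (LINT x|R. (\<Sum>m\<in>{- int l..int l}. c l m * (sph_harm l m x * h x))))"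
    by (rule Bochner_Integration.integral_sum) (intro Bochner_Integration.integrable_sum int')
  also have "\<dots> = (\<Sum>l\<le>N. \<Sum>m\<in>{- int l..int l}. (LINT x|R. c l m * (sph_harm l m x * h x)))"
    by (intro sum.cong refl Bochner_Integration.integral_sum int')
  finally show ?thesis by simp
qed

lemma fourier_laplace_harm_sum:
  assumes "m \<in> {- int l..int l}"
  shows "fourier_laplace (harm_sum N c) l m = (if l \<le> N then c l m else 0)"
proof -
  have "fourier_laplace (harm_sum N c) l m
      = (\<Sum>l'\<le>N. \<Sum>m'\<in>{- int l'..int l'}. c l' m' * (LINT x|surface_measure. sph_harm l' m' x * cnj (sph_harm l m x)))"
    unfolding fourier_laplace_def
    by (rule integral_harm_sum) (rule L2_mult_integrable[OF L2_sph_harm L2_sph_harm[OF assms]])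
  also have "\<dots> = (\<Sum>l'\<le>N. \<Sum>m'\<in>{- int l'..int l'}. if l' = l \<and> m' = m then c l' m' else 0)"
    by (intro sum.cong refl) (simp add: sph_harm_orthonormal[OF _ assms])
  also have "\<dots> = (\<Sum>l'\<le>N. if l' = l then c l m else 0)"
  proof (intro sum.cong refl)
    fix l'
    have "(\<Sum>m'\<in>{- int l'..int l'}. if l' = l \<and> m' = m then c l' m' else 0)
        = (\<Sum>m'\<in>{- int l'..int l'}. if m' = m then (if l' = l then c l m else 0) else 0)"
      by (intro sum.cong refl) simp
    also have "\<dots> = (if l' = l then c l m else 0)" using assms by simp
    finally show "(\<Sum>m'\<in>{- int l'..int l'}. if l' = l \<and> m' = m then c l' m' else 0) = (if l' = l then c l m else 0)" .
  qed
  also have "\<dots> = (if l \<le> N then c l m else 0)" by simp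
  finally show ?thesis .
qed

lemma inner_harm_sum:
  assumes "L2 f"
  shows "(LINT x|surface_measure. f x * cnj (harm_sum N c x))
    = (\<Sum>l\<le>N. \<Sum>m\<in>{- int l..int l}. fourier_laplace f l m * cnj (c l m))"
proof -
  have "(LINT x|surface_measure. sph_harm l m x * cnj (f x)) = cnj (fourier_laplace f l m)" for l m
    unfolding fourier_laplace_def Bochner_Integration.integral_cnj[symmetric] by (simp add: mult.commute)
  moreover have "(LINT x|surface_measure. harm_sum N c x * cnj (f x))
      = (\<Sum>l\<le>N. \<Sum>m\<in>{- int l..int l}. c l m * (LINT x|surface_measure. sph_harm l m x * cnj (f x)))"
    by (rule integral_harm_sum) (rule L2_mult_integrable[OF L2_sph_harm assms])
  moreover have "(LINT x|surface_measure. f x * cnj (harm_sum N c x)) = cnj (LINT x|surface_measure. harm_sum N c x * cnj (f x))"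
    unfolding Bochner_Integration.integral_cnj[symmetric] by (simp add: mult.commute)
  ultimately show ?thesis
    by (simp only: cnj_sum complex_cnj_mult complex_cnj_cnj) (simp only: mult.commute)
qed

text \<open>Completing the square in the coefficients. With \<open>c = 0\<close> or \<open>c\<close> the Fourier-Laplace coefficients this
  contains Bessel's inequality and the optimality of the partial sums.\<close>
lemma L2_norm_diff_harm_sum:
  assumes "L2 f"
  shows "(L2_norm (\<lambda>x. f x - harm_sum N c x))\<^sup>2
    = (L2_norm f)\<^sup>2 - (\<Sum>l\<le>N. power_spectrum f l)
      + (\<Sum>l\<le>N. \<Sum>m\<in>{- int l..int l}. (cmod (fourier_laplace f l m - c l m))\<^sup>2)"
proof -
  let ?s = "harm_sum N c"
  let ?\<Sigma> = "\<lambda>a :: nat \<Rightarrow> int \<Rightarrow> complex. \<Sum>l\<le>N. \<Sum>m\<in>{- int l..int l}. a l m"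
  note int = L2_mult_integrable[OF assms assms] L2_mult_integrable[OF assms L2_harm_sum[of N c]]
    L2_mult_integrable[OF L2_harm_sum[of N c] assms] L2_mult_integrable[OF L2_harm_sum[of N c] L2_harm_sum[of N c]]
  note sq = L2_norm_square_complex
  have fs: "(LINT x|surface_measure. f x * cnj (?s x)) = ?\<Sigma> (\<lambda>l m. fourier_laplace f l m * cnj (c l m))"
    by (rule inner_harm_sum[OF assms])
  have "(LINT x|surface_measure. ?s x * cnj (f x)) = (LINT x|surface_measure. cnj (f x * cnj (?s x)))"
    by (simp add: mult.commute)
  also have "\<dots> = cnj (LINT x|surface_measure. f x * cnj (?s x))" by (rule Bochner_Integration.integral_cnj)
  finally have sf: "(LINT x|surface_measure. ?s x * cnj (f x)) = ?\<Sigma> (\<lambda>l m. c l m * cnj (fourier_laplace f l m))"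
    unfolding fs by (simp add: mult.commute)
  have ss: "(LINT x|surface_measure. ?s x * cnj (?s x)) = ?\<Sigma> (\<lambda>l m. c l m * cnj (c l m))"
    unfolding inner_harm_sum[OF L2_harm_sum] by (intro sum.cong refl) (simp add: fourier_laplace_harm_sum)
  have "complex_of_real ((L2_norm (\<lambda>x. f x - ?s x))\<^sup>2)
     = (LINT x|surface_measure. f x * cnj (f x) - f x * cnj (?s x) - ?s x * cnj (f x) + ?s x * cnj (?s x))"
    unfolding sq by (simp add: algebra_simps)
  also have "\<dots> = of_real ((L2_norm f)\<^sup>2) - ?\<Sigma> (\<lambda>l m. fourier_laplace f l m * cnj (c l m))
      - ?\<Sigma> (\<lambda>l m. c l m * cnj (fourier_laplace f l m)) + ?\<Sigma> (\<lambda>l m. c l m * cnj (c l m))"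
    using int by (simp add: fs sf ss) (simp flip: sq)
  also have "\<dots> = of_real ((L2_norm f)\<^sup>2) - ?\<Sigma> (\<lambda>l m. fourier_laplace f l m * cnj (fourier_laplace f l m))
      + ?\<Sigma> (\<lambda>l m. (fourier_laplace f l m - c l m) * cnj (fourier_laplace f l m - c l m))"
    by (simp add: algebra_simps sum.distrib sum_subtractf)
  also have "\<dots> = of_real ((L2_norm f)\<^sup>2 - (\<Sum>l\<le>N. power_spectrum f l)
      + (\<Sum>l\<le>N. \<Sum>m\<in>{- int l..int l}. (cmod (fourier_laplace f l m - c l m))\<^sup>2))"
    unfolding power_spectrum_def of_real_add of_real_diff of_real_sum complex_norm_square by simp
  finally show ?thesis by (simp only: of_real_eq_iff)
qed

lemma power_spectrum_nonneg [simp]: "0 \<le> power_spectrum f l"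
  by (auto simp: power_spectrum_def intro: sum_nonneg)

lemma projection_error:
  assumes "L2 f"
  shows "(L2_norm (\<lambda>x. f x - harm_sum N (fourier_laplace f) x))\<^sup>2 = (L2_norm f)\<^sup>2 - (\<Sum>l\<le>N. power_spectrum f l)"
  using L2_norm_diff_harm_sum[OF assms, of N "fourier_laplace f"] by simp

lemma projection_best:
  assumes "L2 f" "N \<le> N'"
  shows "L2_norm (\<lambda>x. f x - harm_sum N' (fourier_laplace f) x) \<le> L2_norm (\<lambda>x. f x - harm_sum N c x)"
proof (rule power2_le_imp_le)
  have "(\<Sum>l\<le>N. power_spectrum f l) \<le> (\<Sum>l\<le>N'. power_spectrum f l)"
    using assms(2) by (intro sum_mono2) auto
  moreover have "0 \<le> (\<Sum>l\<le>N. \<Sum>m\<in>{- int l..int l}. (cmod (fourier_laplace f l m - c l m))\<^sup>2)"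
    by (intro sum_nonneg) simp
  ultimately show "(L2_norm (\<lambda>x. f x - harm_sum N' (fourier_laplace f) x))\<^sup>2 \<le> (L2_norm (\<lambda>x. f x - harm_sum N c x))\<^sup>2"
    unfolding L2_norm_diff_harm_sum[OF assms(1), of N c] projection_error[OF assms(1)] by linarith
qed simp

section \<open>Uniform density of the spherical harmonics\<close>

text \<open>An intermediate description of the span of the harmonics, in which all polynomials \<open>p\<close> are
  allowed at once. It is visibly an algebra containing the coordinates, hence contains all polynomials;
  that it is not larger than the span of the harmonics is a matter of degrees. The last clause
  ignores values off the sphere.\<close>
inductive azimuthal_span :: "(real^3 \<Rightarrow> complex) \<Rightarrow> bool" where
  generator: "azimuthal_span (\<lambda>x. c * of_real (poly p (x $ 3)) * azimuthal m x)"
| add: "azimuthal_span f \<Longrightarrow> azimuthal_span g \<Longrightarrow> azimuthal_span (\<lambda>x. f x + g x)"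
| cong: "azimuthal_span f \<Longrightarrow> (\<And>x. x \<in> S2 \<Longrightarrow> g x = f x) \<Longrightarrow> azimuthal_span g"

text \<open>Longitudes add up; the surplus power of \<open>sin \<theta>\<close> is even, since \<open>\<bar>m\<bar> + \<bar>m'\<bar>\<close> and \<open>\<bar>m + m'\<bar>\<close> have the same
  parity, and so is a polynomial in \<open>cos \<theta>\<close>.\<close>
lemma azimuthal_mult:
  "\<exists>j. \<forall>x\<in>S2.
    azimuthal m x * azimuthal m' x = of_real (poly ([:1, 0, -1:] ^ j) (x $ 3)) * azimuthal (m + m') x"
proof -
  \<comment> \<open>Half of the amount by which the triangle inequality is strict.\<close>
  define i where "i = (if (0 \<le> m) = (0 \<le> m') then 0 else min \<bar>m\<bar> \<bar>m'\<bar>)"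
  define j where "j = nat i"
  have "i \<ge> 0" by (simp add: i_def)
  have "\<bar>m\<bar> + \<bar>m'\<bar> = 2 * i + \<bar>m + m'\<bar>"
    unfolding i_def by (cases "0 \<le> m"; cases "0 \<le> m'"; simp add: min_def abs_if)
  then have "nat (\<bar>m\<bar> + \<bar>m'\<bar>) = nat (2 * i + \<bar>m + m'\<bar>)" by simp
  then have j: "nat \<bar>m\<bar> + nat \<bar>m'\<bar> = 2 * j + nat \<bar>m + m'\<bar>"
    using \<open>i \<ge> 0\<close> by (simp add: j_def nat_add_distrib nat_mult_distrib)
  have "azimuthal m x * azimuthal m' x = of_real (poly ([:1, 0, -1:] ^ j) (x $ 3)) * azimuthal (m + m') x"
    if "x \<in> S2" for x
  proof -
    define \<theta> \<phi> where "\<theta> = colatitude x" and "\<phi> = longitude x"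
    have x: "x = sph \<theta> \<phi>" using sph_colatitude_longitude[OF that] by (simp add: \<theta>_def \<phi>_def)
    have "sin \<theta> ^ nat \<bar>m\<bar> * sin \<theta> ^ nat \<bar>m'\<bar> = (1 - (cos \<theta>)\<^sup>2) ^ j * sin \<theta> ^ nat \<bar>m + m'\<bar>"
      unfolding power_add[symmetric] j by (simp only: power_add power_mult sin_squared_eq)
    then have s: "complex_of_real (sin \<theta> ^ nat \<bar>m\<bar>) * of_real (sin \<theta> ^ nat \<bar>m'\<bar>)
        = of_real ((1 - (cos \<theta>)\<^sup>2) ^ j) * of_real (sin \<theta> ^ nat \<bar>m + m'\<bar>)"
      by (simp only: flip: of_real_mult)
    have e: "exp (\<i> * of_int (m + m') * of_real \<phi>) = exp (\<i> * of_int m * of_real \<phi>) * exp (\<i> * of_int m' * of_real \<phi>)"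
      unfolding exp_add[symmetric] by (simp add: algebra_simps)
    have "azimuthal m x * azimuthal m' x = (complex_of_real (sin \<theta> ^ nat \<bar>m\<bar>) * of_real (sin \<theta> ^ nat \<bar>m'\<bar>))
        * (exp (\<i> * of_int m * of_real \<phi>) * exp (\<i> * of_int m' * of_real \<phi>))"
      unfolding x azimuthal_sph by (simp only: mult_ac)
    also have "\<dots> = of_real ((1 - (cos \<theta>)\<^sup>2) ^ j) * azimuthal (m + m') x"
      unfolding s e[symmetric] x azimuthal_sph by (simp only: mult_ac)
    finally show ?thesis by (simp add: x power2_eq_square)
  qed
  then show ?thesis by blast
qed

lemma azimuthal_span_generator_mult:
  "azimuthal_span g \<Longrightarrow> azimuthal_span (\<lambda>x. c * of_real (poly p (x $ 3)) * azimuthal m x * g x)"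
proof (induction rule: azimuthal_span.induct)
  case (generator c' p' m')
  obtain j where j: "\<And>x. x \<in> S2 \<Longrightarrow>
    azimuthal m x * azimuthal m' x = of_real (poly ([:1, 0, -1:] ^ j) (x $ 3)) * azimuthal (m + m') x"
    using azimuthal_mult[of m m'] by blast
  show ?case
  proof (rule azimuthal_span.cong[OF azimuthal_span.generator[of "c * c'" "p * p' * [:1, 0, -1:] ^ j" "m + m'"]])
    fix x assume "x \<in> S2"
    have "c * of_real (poly p (x $ 3)) * azimuthal m x * (c' * of_real (poly p' (x $ 3)) * azimuthal m' x)
      = c * c' * of_real (poly p (x $ 3)) * of_real (poly p' (x $ 3)) * (azimuthal m x * azimuthal m' x)"
      by (simp only: mult_ac)
    then show "c * of_real (poly p (x $ 3)) * azimuthal m x * (c' * of_real (poly p' (x $ 3)) * azimuthal m' x)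
      = c * c' * of_real (poly (p * p' * [:1, 0, -1:] ^ j) (x $ 3)) * azimuthal (m + m') x"
      unfolding j[OF \<open>x \<in> S2\<close>] by simp
  qed
next
  case (add f g)
  show ?case using azimuthal_span.add[OF add.IH] by (simp add: algebra_simps)
next
  case (cong f g)
  show ?case by (rule azimuthal_span.cong[OF cong.IH]) (simp add: cong.hyps)
qed

lemma azimuthal_span_mult: "azimuthal_span f \<Longrightarrow> azimuthal_span g \<Longrightarrow> azimuthal_span (\<lambda>x. f x * g x)"
proof (induction rule: azimuthal_span.induct)
  case (generator c p m)
  then show ?case by (rule azimuthal_span_generator_mult)
next
  case (add f h)
  show ?case using azimuthal_span.add[OF add.IH(1) add.IH(2)] add.prems by (simp add: algebra_simps)
next
  case (cong f h)
  show ?case by (rule azimuthal_span.cong[OF cong.IH[OF cong.prems]]) (simp add: cong.hyps)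
qed

lemma sphere_poly_azimuthal_span: "sphere_poly f \<Longrightarrow> azimuthal_span f"
proof (induction rule: sphere_poly.induct)
  case (const c)
  show ?case using azimuthal_span.generator[of c "[:1:]" 0] by (simp add: azimuthal_def)
next
  case (coordinate i)
  have p: "azimuthal_span (\<lambda>x. c * azimuthal m x)" for c m
    using azimuthal_span.generator[of c "[:1:]" m] by simp
  consider "i = 1" | "i = 2" | "i = 3" using exhaust_3 by blast
  then show ?case
  proof cases
    case 1
    show ?thesis using azimuthal_span.add[OF p[of "1/2" 1] p[of "1/2" "-1"]] 1
      by (rule_tac azimuthal_span.cong) (auto simp: azimuthal_def complex_eq_iff)
  next
    case 2
    show ?thesis using azimuthal_span.add[OF p[of "- \<i> / 2" 1] p[of "\<i> / 2" "-1"]] 2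
      by (rule_tac azimuthal_span.cong) (auto simp: azimuthal_def complex_eq_iff)
  next
    case 3
    show ?thesis using azimuthal_span.generator[of 1 "[:0, 1:]" 0] 3 by (simp add: azimuthal_def)
  qed
qed (auto intro: azimuthal_span.add azimuthal_span_mult)

lemma harm_const_nonzero: "harm_const l m \<noteq> 0"
proof -
  have "2 * real l + 1 \<noteq> 0" by linarith
  then show ?thesis by (simp add: harm_const_def)
qed

lemma harm_sum_mono:
  assumes "N \<le> N'"
  shows "harm_sum N c = harm_sum N' (\<lambda>l m. if l \<le> N then c l m else 0)"
proof
  fix x
  have "{..N'} \<inter> {l. l \<le> N} = {..N}" using assms by auto
  then have "harm_sum N' (\<lambda>l m. if l \<le> N then c l m else 0) x
      = (\<Sum>l\<le>N'. if l \<le> N then (\<Sum>m\<in>{- int l..int l}. c l m * sph_harm l m x) else 0)"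
    unfolding harm_sum_def by (intro sum.cong refl) auto
  also have "\<dots> = harm_sum N c x"
    unfolding harm_sum_def using \<open>{..N'} \<inter> {l. l \<le> N} = {..N}\<close> by (simp add: sum.If_cases)
  finally show "harm_sum N c x = harm_sum N' (\<lambda>l m. if l \<le> N then c l m else 0) x" by simp
qed

definition harmonic_span :: "(real^3 \<Rightarrow> complex) \<Rightarrow> bool" where
  "harmonic_span f \<longleftrightarrow> (\<exists>N c. \<forall>x\<in>S2. f x = harm_sum N c x)"

lemma harmonic_span_add:
  assumes "harmonic_span f" "harmonic_span g"
  shows "harmonic_span (\<lambda>x. f x + g x)"
proof -
  obtain N c N' c' where f: "\<And>x. x \<in> S2 \<Longrightarrow> f x = harm_sum N c x" and g: "\<And>x. x \<in> S2 \<Longrightarrow> g x = harm_sum N' c' x"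
    using assms unfolding harmonic_span_def by blast
  have "f x + g x = harm_sum (max N N') (\<lambda>l m. (if l \<le> N then c l m else 0) + (if l \<le> N' then c' l m else 0)) x"
    if "x \<in> S2" for x
    unfolding f[OF that] g[OF that] harm_sum_mono[of N "max N N'" c, simplified] harm_sum_mono[of N' "max N N'" c', simplified]
    unfolding harm_sum_def by (simp add: sum.distrib algebra_simps)
  then show ?thesis unfolding harmonic_span_def by blast
qed

lemma harmonic_span_sph_harm:
  assumes "m \<in> {- int l..int l}"
  shows "harmonic_span (\<lambda>x. c * sph_harm l m x)"
proof -
  have "c * sph_harm l m x = harm_sum l (\<lambda>l' m'. if l' = l \<and> m' = m then c else 0) x" for x
  proof -
    have "harm_sum l (\<lambda>l' m'. if l' = l \<and> m' = m then c else 0) x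
       = (\<Sum>l'\<le>l. if l' = l then c * sph_harm l m x else 0)"
      unfolding harm_sum_def
    proof (intro sum.cong refl)
      fix l'
      have "(\<Sum>m'\<in>{- int l'..int l'}. (if l' = l \<and> m' = m then c else 0) * sph_harm l' m' x)
        = (\<Sum>m'\<in>{- int l'..int l'}. if m' = m then (if l' = l then c * sph_harm l m x else 0) else 0)"
        by (intro sum.cong refl) auto
      then show "(\<Sum>m'\<in>{- int l'..int l'}. (if l' = l \<and> m' = m then c else 0) * sph_harm l' m' x)
        = (if l' = l then c * sph_harm l m x else 0)"
        using assms by auto
    qed
    then show ?thesis by simp
  qed
  then show ?thesis unfolding harmonic_span_def by blast
qed

text \<open>For fixed \<open>m\<close>, the polynomial factors of \<open>Y\<^sub>l\<^sub>m\<close> have the degrees \<open>l - \<bar>m\<bar> = 0, 1, 2, \<dots>\<close>, each exactly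
  once. Subtracting the right multiple of one of them lowers the degree of \<open>p\<close>.\<close>
lemma harmonic_span_generator: "harmonic_span (\<lambda>x. c * of_real (poly p (x $ 3)) * azimuthal m x)"
proof (induction "degree p" arbitrary: p c rule: less_induct)
  case less
  define k where "k = nat \<bar>m\<bar>"
  define l where "l = k + degree p"
  have m: "m \<in> {- int l..int l}" by (auto simp: l_def k_def)
  define W where "W = rodrigues l (l + k)"
  have degW: "degree W = degree p" by (simp add: W_def degree_rodrigues l_def)
  have W0: "W \<noteq> 0" unfolding W_def by (rule rodrigues_nonzero) (simp add: l_def)
  define a where "a = lead_coeff p / lead_coeff W"
  have lW: "lead_coeff W \<noteq> 0" using W0 by simp
  have Y: "of_real (poly (smult a W) (x $ 3)) * azimuthal m x = of_real (a / harm_const l m) * sph_harm l m x"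
    if "x \<in> S2" for x
    unfolding sph_harm_closed_form[OF that m] W_def k_def using harm_const_nonzero[of l m] by (simp add: field_simps)
  have part: "harmonic_span (\<lambda>x. c * of_real (poly (smult a W) (x $ 3)) * azimuthal m x)"
  proof -
    have "c * of_real (poly (smult a W) (x $ 3)) * azimuthal m x = c * of_real (a / harm_const l m) * sph_harm l m x"
      if "x \<in> S2" for x
      unfolding mult.assoc Y[OF that] by simp
    then show ?thesis
      using harmonic_span_sph_harm[OF m, of "c * of_real (a / harm_const l m)"]
      unfolding harmonic_span_def by simp
  qed
  show ?case
  proof (cases "degree p = 0")
    case True
    then obtain b d where "p = [:b:]" "W = [:d:]" using degW by (metis degree_0_id)
    then have "p = smult a W" using lW by (simp add: a_def)
    then show ?thesis using part by simp
  next
    case False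
    have "degree (p - smult a W) < degree p"
    proof (rule coeff_0_degree_minus_1[THEN le_less_trans])
      show "coeff (p - smult a W) (degree p) = 0"
        using lW degW by (simp add: a_def)
      show "degree (p - smult a W) \<le> degree p"
        using degW by (intro degree_diff_le) (auto intro: order_trans[OF degree_smult_le])
      show "degree p - 1 < degree p" using False by simp
    qed
    then have "harmonic_span (\<lambda>x. c * of_real (poly (p - smult a W) (x $ 3)) * azimuthal m x)"
      by (rule less)
    from harmonic_span_add[OF this part] show ?thesis by (simp add: algebra_simps)
  qed
qed

lemma azimuthal_span_harmonic_span: "azimuthal_span f \<Longrightarrow> harmonic_span f"
proof (induction rule: azimuthal_span.induct)
  case (cong f g)
  then show ?case by (simp add: harmonic_span_def)
qed (auto intro: harmonic_span_generator harmonic_span_add)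

lemma real_polynomial_function_sphere_poly:
  fixes p :: "real^3 \<Rightarrow> real"
  shows "real_polynomial_function p \<Longrightarrow> sphere_poly (\<lambda>x. of_real (p x))"
proof (induction rule: real_polynomial_function.induct)
  case (linear h)
  then interpret h: bounded_linear h .
  have hx: "h x = (\<Sum>i\<in>UNIV. x $ i * h (axis i 1))" for x
  proof -
    have "h x = h (\<Sum>i\<in>UNIV. (x $ i) *\<^sub>R axis i 1)" using basis_expansion[of x] by (simp add: scalar_mult_eq_scaleR)
    then show ?thesis by (simp add: h.sum h.scaleR)
  qed
  have "sphere_poly (\<lambda>x::real^3. of_real (x $ 1) * of_real (h (axis 1 1)) + of_real (x $ 2) * of_real (h (axis 2 1))
      + of_real (x $ 3) * of_real (h (axis 3 1)))"
    by (intro sphere_poly.intros)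
  moreover have "(\<lambda>x. complex_of_real (h x)) = (\<lambda>x. of_real (x $ 1) * of_real (h (axis 1 1))
      + of_real (x $ 2) * of_real (h (axis 2 1)) + of_real (x $ 3) * of_real (h (axis 3 1)))"
    by (rule ext, rule trans[OF arg_cong[OF trans[OF hx sum_3]]]) simp
  ultimately show ?case by (simp only:)
qed (auto intro: sphere_poly.intros)

lemma sph_harm_uniformly_dense:
  assumes "continuous_on S2 g" "0 < e"
  obtains N c where "\<And>x. x \<in> S2 \<Longrightarrow> cmod (g x - harm_sum N c x) < e"
proof -
  obtain p where p: "polynomial_function p" "\<And>x. x \<in> S2 \<Longrightarrow> cmod (g x - p x) < e"
    using Stone_Weierstrass_polynomial_function[OF compact_sphere assms] by blast
  have "real_polynomial_function (\<lambda>x. Re (p x))" "real_polynomial_function (\<lambda>x. Im (p x))"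
    using p(1) bounded_linear_Re bounded_linear_Im by (auto simp: polynomial_function_def comp_def)
  then have "sphere_poly (\<lambda>x. of_real (Re (p x)) + \<i> * of_real (Im (p x)))"
    by (intro sphere_poly.intros real_polynomial_function_sphere_poly)
  then have "sphere_poly p" by (simp flip: complex_eq)
  then have "harmonic_span p" by (intro azimuthal_span_harmonic_span sphere_poly_azimuthal_span)
  then obtain N c where "\<And>x. x \<in> S2 \<Longrightarrow> p x = harm_sum N c x" unfolding harmonic_span_def by blast
  then show thesis using p(2) that by metis
qed

section \<open>Completeness in \<open>L\<^sup>2\<close>\<close>

text \<open>The approximating functions decrease linearly with the distance from \<open>A\<close>, ever more steeply.\<close>
lemma indicator_closed_limit:
  assumes "closed (A :: (real^3) set)"
  obtains g :: "nat \<Rightarrow> real^3 \<Rightarrow> real" where "\<And>n. continuous_on UNIV (g n)"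
    "\<And>n x. 0 \<le> g n x" "\<And>n x. g n x \<le> 1" "\<And>x. (\<lambda>n. g n x) \<longlonglongrightarrow> indicator A x"
proof (cases "A = {}")
  case True
  show ?thesis by (rule that[of "\<lambda>n x. 0"]) (auto simp: True)
next
  case False
  define g :: "nat \<Rightarrow> real^3 \<Rightarrow> real" where "g n x = max 0 (1 - real n * infdist x A)" for n x
  show ?thesis
  proof (rule that[of g])
    show "continuous_on UNIV (g n)" for n
      unfolding g_def by (intro continuous_intros)
    show "0 \<le> g n x" "g n x \<le> 1" for n x by (simp_all add: g_def infdist_nonneg)
    show "(\<lambda>n. g n x) \<longlonglongrightarrow> indicator A x" for x
    proof (cases "x \<in> A")
      case True
      then show ?thesis by (simp add: g_def)
    next
      case out: False
      then have pos: "infdist x A > 0"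
        using in_closed_iff_infdist_zero[OF assms False] infdist_nonneg[of x A] by (metis less_eq_real_def)
      obtain n0 where n0: "1 / infdist x A < real n0" using reals_Archimedean2 by blast
      have "g n x = 0" if "n \<ge> n0" for n
      proof -
        have "1 / infdist x A < real n" using n0 that by linarith
        then have "1 < real n * infdist x A" using pos by (simp add: field_simps)
        then show ?thesis by (simp add: g_def)
      qed
      then have "eventually (\<lambda>n. g n x = 0) sequentially" by (auto simp: eventually_sequentially)
      then show ?thesis using out by (simp add: tendsto_eventually)
    qed
  qed
qed

lemma L2_norm_dominated_convergence:
  assumes "\<And>n. s n \<in> borel_measurable surface_measure" "f \<in> borel_measurable surface_measure"
    and "integrable surface_measure h" "\<And>n x. x \<in> S2 \<Longrightarrow> (cmod (f x - s n x))\<^sup>2 \<le> h x"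
    and "\<And>x. x \<in> S2 \<Longrightarrow> (\<lambda>n. s n x) \<longlonglongrightarrow> f x"
  shows "(\<lambda>n. L2_norm (\<lambda>x. f x - s n x)) \<longlonglongrightarrow> 0"
proof -
  have "(\<lambda>n. LINT x|surface_measure. (cmod (f x - s n x))\<^sup>2) \<longlonglongrightarrow> (LINT x|surface_measure. 0)"
  proof (rule integral_dominated_convergence[where w = h])
    show "AE x in surface_measure. (\<lambda>n. (cmod (f x - s n x))\<^sup>2) \<longlonglongrightarrow> 0"
    proof (intro AE_I2)
      fix x assume "x \<in> space surface_measure"
      then have "(\<lambda>n. (cmod (f x - s n x))\<^sup>2) \<longlonglongrightarrow> (cmod (f x - f x))\<^sup>2"
        by (intro tendsto_intros assms(5)) simp
      then show "(\<lambda>n. (cmod (f x - s n x))\<^sup>2) \<longlonglongrightarrow> 0" by simp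
    qed
  qed (use assms in \<open>auto intro!: AE_I2\<close>)
  then have "(\<lambda>n. sqrt (LINT x|surface_measure. (cmod (f x - s n x))\<^sup>2)) \<longlonglongrightarrow> sqrt 0"
    by (intro tendsto_intros) simp
  then show ?thesis by (simp add: L2_norm_def)
qed

definition L2_approximable :: "(real^3 \<Rightarrow> complex) \<Rightarrow> bool" where
  "L2_approximable f \<longleftrightarrow> L2 f \<and> (\<forall>e>0. \<exists>g. continuous_on S2 g \<and> L2_norm (\<lambda>x. f x - g x) < e)"

lemma L2_approximable_cong:
  assumes "L2_approximable g" "\<And>x. x \<in> S2 \<Longrightarrow> f x = g x"
  shows "L2_approximable f"
proof -
  have "L2_norm (\<lambda>x. f x - h x) = L2_norm (\<lambda>x. g x - h x)" for h
    by (rule L2_cong(2)) (simp add: assms(2))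
  moreover have "L2 f = L2 g" by (rule L2_cong(1)) (rule assms(2))
  ultimately show ?thesis using assms(1) unfolding L2_approximable_def by simp
qed

lemma L2_approximable_limit:
  assumes "L2 f" "\<And>n. L2_approximable (s n)" "(\<lambda>n. L2_norm (\<lambda>x. f x - s n x)) \<longlonglongrightarrow> 0"
  shows "L2_approximable f"
  unfolding L2_approximable_def
proof (intro conjI allI impI)
  fix e :: real assume "0 < e"
  then have "eventually (\<lambda>n. L2_norm (\<lambda>x. f x - s n x) < e / 2) sequentially"
    using order_tendstoD(2)[OF assms(3), of "e / 2"] by simp
  then obtain n where n: "L2_norm (\<lambda>x. f x - s n x) < e / 2" by (auto simp: eventually_sequentially)
  obtain g where g: "continuous_on S2 g" "L2_norm (\<lambda>x. s n x - g x) < e / 2"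
    using assms(2)[of n] \<open>0 < e\<close> unfolding L2_approximable_def by (meson half_gt_zero)
  have "L2_norm (\<lambda>x. f x - g x) \<le> L2_norm (\<lambda>x. f x - s n x) + L2_norm (\<lambda>x. s n x - g x)"
    using assms(1,2) L2_continuous[OF g(1)] by (intro L2_norm_diff_triangle) (auto simp: L2_approximable_def)
  then show "\<exists>g. continuous_on S2 g \<and> L2_norm (\<lambda>x. f x - g x) < e" using g n by (intro exI[of _ g]) auto
qed (rule assms)

lemma L2_approximable_continuous: "continuous_on S2 g \<Longrightarrow> L2_approximable g"
  unfolding L2_approximable_def by (auto intro!: L2_continuous exI[of _ g] simp: L2_norm_def)

lemma L2_approximable_add:
  assumes "L2_approximable f" "L2_approximable g"
  shows "L2_approximable (\<lambda>x. f x + g x)"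
  unfolding L2_approximable_def
proof (intro conjI allI impI)
  show "L2 (\<lambda>x. f x + g x)" using assms by (auto simp: L2_approximable_def intro: L2_add)
  fix e :: real assume "0 < e"
  then obtain f' g' where *: "continuous_on S2 f'" "L2_norm (\<lambda>x. f x - f' x) < e / 2"
      "continuous_on S2 g'" "L2_norm (\<lambda>x. g x - g' x) < e / 2"
    using assms unfolding L2_approximable_def by (meson half_gt_zero)
  have "L2_norm (\<lambda>x. (f x - f' x) + (g x - g' x)) \<le> L2_norm (\<lambda>x. f x - f' x) + L2_norm (\<lambda>x. g x - g' x)"
    using assms L2_continuous[OF *(1)] L2_continuous[OF *(3)]
    by (intro L2_norm_triangle L2_diff) (auto simp: L2_approximable_def)
  then show "\<exists>h. continuous_on S2 h \<and> L2_norm (\<lambda>x. f x + g x - h x) < e"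
    using * by (intro exI[of _ "\<lambda>x. f' x + g' x"]) (auto intro: continuous_intros simp: algebra_simps)
qed

lemma L2_approximable_cmult:
  assumes "L2_approximable f"
  shows "L2_approximable (\<lambda>x. c * f x)"
  unfolding L2_approximable_def
proof (intro conjI allI impI)
  show "L2 (\<lambda>x. c * f x)" using assms by (auto simp: L2_approximable_def intro: L2_cmult)
  fix e :: real assume "0 < e"
  then have "e / (cmod c + 1) > 0" by (simp add: add_nonneg_pos)
  then obtain f' where *: "continuous_on S2 f'" "L2_norm (\<lambda>x. f x - f' x) < e / (cmod c + 1)"
    using assms unfolding L2_approximable_def by blast
  have "L2_norm (\<lambda>x. c * f x - c * f' x) = cmod c * L2_norm (\<lambda>x. f x - f' x)"
    by (simp flip: L2_norm_cmult right_diff_distrib)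
  also have "\<dots> \<le> (cmod c + 1) * L2_norm (\<lambda>x. f x - f' x)" by (intro mult_right_mono) auto
  also have "\<dots> < e" using *(2) by (simp add: pos_less_divide_eq add_nonneg_pos mult.commute)
  finally show "\<exists>h. continuous_on S2 h \<and> L2_norm (\<lambda>x. c * f x - h x) < e"
    using * by (intro exI[of _ "\<lambda>x. c * f' x"]) (auto intro: continuous_intros)
qed

lemma L2_approximable_sum:
  "(\<And>i. i \<in> I \<Longrightarrow> L2_approximable (f i)) \<Longrightarrow> L2_approximable (\<lambda>x. \<Sum>i\<in>I. f i x)"
  by (induction I rule: infinite_finite_induct)
     (auto intro: L2_approximable_add L2_approximable_continuous)

text \<open>Closed sets generate the Borel sets of the sphere. As they are stable under intersections and their
  indicators are limits of continuous functions, they allow both the density of continuous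
  functions and the invariance of the surface measure to be checked on continuous functions.\<close>
lemma sets_S2_sigma: "sets (restrict_space borel S2) = sigma_sets S2 {A. A \<subseteq> S2 \<and> closed A}"
proof -
  have b: "sets (borel :: (real^3) measure) = sigma_sets UNIV (Collect closed)"
    by (simp add: borel_eq_closed)
  have "S2 \<in> sigma_sets UNIV (Collect closed)" by (auto intro: sigma_sets.Basic)
  then have "sets (restrict_space borel S2) = sigma_sets S2 ((\<inter>) S2 ` Collect closed)"
    unfolding sets_restrict_space b by (rule sigma_sets_Int) auto
  also have "(\<inter>) S2 ` Collect closed = {A. A \<subseteq> S2 \<and> closed A}" by (auto intro!: closed_Int)
  finally show ?thesis .
qed

lemma L2_approximable_indicator:
  assumes "A \<in> sets surface_measure"
  shows "L2_approximable (indicator A)"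
proof -
  have "Int_stable {A :: (real^3) set. A \<subseteq> S2 \<and> closed A}" by (auto simp: Int_stable_def)
  moreover have "{A :: (real^3) set. A \<subseteq> S2 \<and> closed A} \<subseteq> Pow S2" by auto
  moreover have "A \<in> sigma_sets S2 {A. A \<subseteq> S2 \<and> closed A}" using assms by (simp add: sets_S2_sigma)
  ultimately show ?thesis
  proof (induction rule: sigma_sets_induct_disjoint)
    case (basic A)
    then have "closed A" by simp
    then obtain g :: "nat \<Rightarrow> real^3 \<Rightarrow> real" where g: "\<And>n. continuous_on UNIV (g n)"
      "\<And>n x. 0 \<le> g n x" "\<And>n x. g n x \<le> 1" "\<And>x. (\<lambda>n. g n x) \<longlonglongrightarrow> indicator A x"
      using indicator_closed_limit by blast
    have c: "continuous_on S2 (\<lambda>x. complex_of_real (g n x))" for n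
      by (intro continuous_intros continuous_on_subset[OF g(1)]) auto
    have A: "A \<in> sets surface_measure" using basic by (auto simp: sets_S2_sigma)
    then have m: "(indicator A :: _ \<Rightarrow> complex) \<in> borel_measurable surface_measure" by (rule borel_measurable_indicator)
    have "(\<lambda>n. L2_norm (\<lambda>x. indicator A x - complex_of_real (g n x))) \<longlonglongrightarrow> 0"
    proof (rule L2_norm_dominated_convergence[where h = "\<lambda>_. 1"])
      show "(cmod (indicator A x - of_real (g n x)))\<^sup>2 \<le> 1" for n x
      proof -
        have "(indicator A x - of_real (g n x) :: complex) = of_real (indicator A x - g n x)"
          by (simp add: indicator_def)
        then have "cmod (indicator A x - of_real (g n x)) = \<bar>indicator A x - g n x\<bar>"
          by (simp only: norm_of_real)
        also have "\<dots> \<le> 1" using g(2,3)[of n x] by (auto simp: indicator_def)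
        finally show ?thesis by (simp add: power_le_one)
      qed
      show "(\<lambda>n. complex_of_real (g n x)) \<longlonglongrightarrow> indicator A x" for x
        using tendsto_of_real[OF g(4)[of x], where 'a = complex] by (cases "x \<in> A") simp_all
    qed (use m c in \<open>auto intro: continuous_imp_measurable_surface\<close>)
    then show ?case
      by (rule L2_approximable_limit[rotated -1, OF _ L2_dominated[where h = "\<lambda>_. 1", OF m]])
         (auto intro: L2_approximable_continuous[OF c] simp: indicator_def)
  next
    case empty
    show ?case by (simp add: indicator_def L2_approximable_continuous)
  next
    case (compl A)
    have "L2_approximable (\<lambda>x. 1 + (-1) * indicator A x)"
      by (intro L2_approximable_add L2_approximable_cmult compl.IH L2_approximable_continuous continuous_intros)
    then show ?case by (rule L2_approximable_cong) (simp add: indicator_def)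
  next
    case (union A)
    then have A: "A i \<in> sets surface_measure" for i by (auto simp: sets_S2_sigma)
    have fin: "L2_approximable (\<lambda>x. \<Sum>i<n. indicator (A i) x)" for n by (intro L2_approximable_sum union.IH)
    have eq: "(\<Sum>i<n. indicator (A i) x) = (indicator (\<Union>i<n. A i) x :: complex)" for n x
      using union.hyps(1) by (intro indicator_UN_disjoint[symmetric]) (auto simp: disjoint_family_on_def)
    have m: "(indicator (\<Union>i. A i) :: _ \<Rightarrow> complex) \<in> borel_measurable surface_measure"
      using A by (intro borel_measurable_indicator) auto
    have lim: "(\<lambda>n. L2_norm (\<lambda>x. indicator (\<Union>i. A i) x - (\<Sum>i<n. indicator (A i) x))) \<longlonglongrightarrow> 0"
    proof (rule L2_norm_dominated_convergence[where h = "\<lambda>_. 1"])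
      show "(cmod (indicator (\<Union>i. A i) x - (\<Sum>i<n. indicator (A i) x)))\<^sup>2 \<le> 1" for n x
        unfolding eq by (auto simp: indicator_def)
      show "(\<lambda>n. \<Sum>i<n. indicator (A i) x :: complex) \<longlonglongrightarrow> indicator (\<Union>i. A i) x" for x
        unfolding eq by (rule LIMSEQ_indicator_UN)
    qed (use m fin in \<open>auto simp: L2_approximable_def dest: L2_measurable\<close>)
    show ?case
      by (rule L2_approximable_limit[OF L2_dominated[where h = "\<lambda>_. 1", OF m] fin lim])
         (auto simp: indicator_def)
  qed
qed

lemma L2_imp_approximable:
  assumes "L2 f"
  shows "L2_approximable f"
proof -
  obtain F where F: "\<And>i. simple_function surface_measure (F i)" "\<And>x. x \<in> S2 \<Longrightarrow> (\<lambda>i. F i x) \<longlonglongrightarrow> f x"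
    "\<And>i x. x \<in> S2 \<Longrightarrow> dist (F i x) 0 \<le> 2 * dist (f x) 0"
    using borel_measurable_implies_sequence_metric[OF L2_measurable[OF assms], of 0]
    unfolding space_surface_measure by blast
  have Fm: "F i \<in> borel_measurable surface_measure" for i using F(1) by (rule borel_measurable_simple_function)
  have appr: "L2_approximable (F i)" for i
  proof -
    have "L2_approximable (\<lambda>x. \<Sum>y\<in>F i ` S2. y * indicator (F i -` {y} \<inter> S2) x)"
      using simple_functionD(2)[OF F(1)[of i]]
      by (intro L2_approximable_sum L2_approximable_cmult L2_approximable_indicator) (simp add: sets_surface_measure[symmetric] del: sets_surface_measure)
    moreover have "F i x = (\<Sum>y\<in>F i ` S2. y * indicator (F i -` {y} \<inter> S2) x)" if "x \<in> S2" for x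
    proof -
      have "(\<Sum>y\<in>F i ` S2. y * indicator (F i -` {y} \<inter> S2) x) = (\<Sum>y\<in>F i ` S2. if F i x = y then y else 0)"
        using that by (intro sum.cong refl) (auto simp: indicator_def)
      also have "\<dots> = F i x" using that simple_functionD(1)[OF F(1)[of i]] by simp
      finally show ?thesis by simp
    qed
    ultimately show ?thesis by (rule L2_approximable_cong)
  qed
  have "(\<lambda>n. L2_norm (\<lambda>x. f x - F n x)) \<longlonglongrightarrow> 0"
  proof (rule L2_norm_dominated_convergence[where h = "\<lambda>x. 9 * (cmod (f x))\<^sup>2"])
    show "(cmod (f x - F n x))\<^sup>2 \<le> 9 * (cmod (f x))\<^sup>2" if "x \<in> S2" for n x
    proof -
      have "cmod (f x - F n x) \<le> 3 * cmod (f x)"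
        using F(3)[OF that, of n] norm_triangle_ineq4[of "f x" "F n x"] by simp
      from power_mono[OF this, of 2] show ?thesis by (simp add: power_mult_distrib)
    qed
  qed (use assms F Fm in \<open>auto simp: L2_def\<close>)
  then show ?thesis by (rule L2_approximable_limit[OF assms appr])
qed

text \<open>Partial sums of the Fourier-Laplace series are the best approximations of their degree, so it is
  enough that some finite sums of harmonics approximate \<open>f\<close>.\<close>
theorem harmonic_expansion:
  assumes "L2 f"
  shows "(\<lambda>N. L2_norm (\<lambda>x. f x - harm_sum N (fourier_laplace f) x)) \<longlonglongrightarrow> 0"
proof (rule LIMSEQ_I)
  fix e :: real assume e: "0 < e"
  obtain g where g: "continuous_on S2 g" "L2_norm (\<lambda>x. f x - g x) < e / 2"
    using L2_imp_approximable[OF assms] e unfolding L2_approximable_def by (meson half_gt_zero)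
  define v where "v = sqrt (measure surface_measure S2)"
  have v: "v \<ge> 0" by (simp add: v_def)
  define d where "d = e / (2 * (v + 1))"
  have d: "d > 0" using e v by (simp add: d_def)
  obtain N c where Nc: "\<And>x. x \<in> S2 \<Longrightarrow> cmod (g x - harm_sum N c x) < d"
    using sph_harm_uniformly_dense[OF g(1) d] by blast
  have "L2_norm (\<lambda>x. g x - harm_sum N c x) \<le> d * v"
    unfolding v_def using Nc d
    by (intro L2_norm_le_uniform continuous_imp_measurable_surface continuous_intros g continuous_on_harm_sum)
       (auto intro: less_imp_le)
  also have "d * v \<le> e / 2" using e v by (simp add: d_def field_simps)
  finally have "L2_norm (\<lambda>x. f x - harm_sum N c x) < e"
    using L2_norm_diff_triangle[OF assms L2_continuous[OF g(1)] L2_harm_sum[of N c]] g(2) by simp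
  then have "L2_norm (\<lambda>x. f x - harm_sum N' (fourier_laplace f) x) < e" if "N' \<ge> N" for N'
    using projection_best[OF assms that, of c] by simp
  then show "\<exists>N0. \<forall>N\<ge>N0. norm (L2_norm (\<lambda>x. f x - harm_sum N (fourier_laplace f) x) - 0) < e" by auto
qed

theorem Parseval:
  assumes "L2 f"
  shows "power_spectrum f sums (L2_norm f)\<^sup>2"
proof -
  have "(\<lambda>N. (L2_norm f)\<^sup>2 - (L2_norm (\<lambda>x. f x - harm_sum N (fourier_laplace f) x))\<^sup>2) \<longlonglongrightarrow> (L2_norm f)\<^sup>2 - 0\<^sup>2"
    by (intro tendsto_intros harmonic_expansion assms)
  then have "(\<lambda>N. \<Sum>l\<le>N. power_spectrum f l) \<longlonglongrightarrow> (L2_norm f)\<^sup>2"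
    by (simp add: projection_error[OF assms])
  then show ?thesis by (simp add: sums_def_le)
qed

section \<open>Markov kernels that are diagonal in the spherical harmonics\<close>

locale spherical_kernel =
  fixes K :: "real^3 \<Rightarrow> (real^3) measure" and e :: "nat \<Rightarrow> int \<Rightarrow> complex"
  assumes prob_space_K: "x \<in> S2 \<Longrightarrow> prob_space (K x)"
    and sets_K: "x \<in> S2 \<Longrightarrow> sets (K x) = sets surface_measure"
    and eigen: "\<And>x l m. x \<in> S2 \<Longrightarrow> m \<in> {- int l..int l} \<Longrightarrow> (LINT y|K x. sph_harm l m y) = e l m * sph_harm l m x"
    and e_0_0: "e 0 0 = 1"
begin

definition avg :: "(real^3 \<Rightarrow> complex) \<Rightarrow> real^3 \<Rightarrow> complex" where
  "avg f x = (LINT y|K x. f y)"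

lemma space_K: "x \<in> S2 \<Longrightarrow> space (K x) = S2"
  using sets_eq_imp_space_eq[OF sets_K] by simp

lemma K_measurable:
  "x \<in> S2 \<Longrightarrow> f \<in> borel_measurable surface_measure \<Longrightarrow> f \<in> borel_measurable (K x)"
  using sets_K by (simp cong: measurable_cong_sets)

lemma K_integrable_bounded:
  fixes f :: "real^3 \<Rightarrow> 'b::{banach, second_countable_topology}"
  assumes "x \<in> S2" "f \<in> borel_measurable surface_measure" "\<And>y. y \<in> S2 \<Longrightarrow> norm (f y) \<le> B"
  shows "integrable (K x) f"
proof -
  interpret prob_space "K x" by (rule prob_space_K[OF assms(1)])
  show ?thesis
    using assms K_measurable by (intro integrable_const_bound[where B = B] AE_I2) (auto simp: space_K)
qed

lemma K_integrable_continuous: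
  fixes f :: "real^3 \<Rightarrow> 'b::{banach, second_countable_topology}"
  assumes "x \<in> S2" "continuous_on S2 f"
  shows "integrable (K x) f"
proof -
  obtain B where "\<And>y. y \<in> S2 \<Longrightarrow> norm (f y) \<le> B"
    using continuous_bounded_S2[OF assms(2)] by blast
  then show ?thesis
    by (intro K_integrable_bounded assms continuous_imp_measurable_surface) auto
qed

lemma avg_harm_sum:
  assumes "x \<in> S2"
  shows "avg (harm_sum N c) x = harm_sum N (\<lambda>l m. c l m * e l m) x"
proof -
  have "avg (harm_sum N c) x = (\<Sum>l\<le>N. \<Sum>m\<in>{- int l..int l}. c l m * (LINT y|K x. sph_harm l m y))"
    using integral_harm_sum[of "K x" "\<lambda>_. 1" N c] K_integrable_continuous[OF assms continuous_on_sph_harm]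
    by (simp add: avg_def)
  also have "\<dots> = harm_sum N (\<lambda>l m. c l m * e l m) x"
    unfolding harm_sum_def by (intro sum.cong refl) (simp add: eigen[OF assms] del: atLeastAtMost_iff)
  finally show ?thesis .
qed

lemma avg_uniform_bound:
  assumes "continuous_on S2 f" "continuous_on S2 g" "\<And>y. y \<in> S2 \<Longrightarrow> cmod (f y - g y) \<le> d" "x \<in> S2"
  shows "cmod (avg f x - avg g x) \<le> d"
proof -
  interpret prob_space "K x" by (rule prob_space_K[OF assms(4)])
  have "avg f x - avg g x = (LINT y|K x. f y - g y)"
    unfolding avg_def using assms by (simp add: K_integrable_continuous)
  also have "cmod \<dots> \<le> (LINT y|K x. cmod (f y - g y))" by (rule integral_norm_bound)
  also have "\<dots> \<le> (LINT y|K x. d)"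
    using assms by (intro integral_mono K_integrable_continuous continuous_intros) (auto simp: space_K)
  also have "\<dots> = d" by (simp add: prob_space)
  finally show ?thesis .
qed

text \<open>Averages of finite sums of harmonics are again such sums, hence continuous in \<open>x\<close>; averages of
  continuous functions are uniform limits of them. The measurability of the kernel itself will
  follow from this.\<close>
lemma avg_measurable_continuous:
  assumes "continuous_on S2 g"
  shows "avg g \<in> borel_measurable surface_measure"
proof -
  have "\<exists>N c. \<forall>y\<in>S2. cmod (g y - harm_sum N c y) < 1 / real (Suc n)" for n
    using sph_harm_uniformly_dense[OF assms, of "1 / real (Suc n)"] by (metis of_nat_0_less_iff zero_less_Suc zero_less_divide_1_iff)
  then obtain N c where Nc: "\<And>n y. y \<in> S2 \<Longrightarrow> cmod (g y - harm_sum (N n) (c n) y) < 1 / real (Suc n)"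
    by metis
  show ?thesis
  proof (rule borel_measurable_LIMSEQ_metric)
    show "harm_sum (N n) (\<lambda>l m. c n l m * e l m) \<in> borel_measurable surface_measure" for n
      by (intro continuous_imp_measurable_surface continuous_on_harm_sum)
    fix x assume "x \<in> space surface_measure"
    then have x: "x \<in> S2" by simp
    have "cmod (avg g x - avg (harm_sum (N n) (c n)) x) \<le> 1 / real (Suc n)" for n
      by (rule avg_uniform_bound) (use Nc x assms in \<open>auto intro: less_imp_le continuous_on_harm_sum\<close>)
    then have b: "cmod (avg (harm_sum (N n) (c n)) x - avg g x) \<le> 1 / real (Suc n)" for n
      by (simp add: norm_minus_commute)
    have "(\<lambda>n. avg (harm_sum (N n) (c n)) x - avg g x) \<longlonglongrightarrow> 0"
      by (rule Lim_null_comparison[OF always_eventually LIMSEQ_Suc[OF lim_1_over_n]]) (use b in simp)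
    then show "(\<lambda>n. harm_sum (N n) (\<lambda>l m. c n l m * e l m) x) \<longlonglongrightarrow> avg g x"
      by (simp add: avg_harm_sum[OF x] LIM_zero_iff)
  qed
qed

lemma avg_bound:
  assumes "continuous_on S2 g" "\<And>y. y \<in> S2 \<Longrightarrow> cmod (g y) \<le> B" "x \<in> S2"
  shows "cmod (avg g x) \<le> B"
  using avg_uniform_bound[OF assms(1), of "\<lambda>_. 0" B x] assms by (simp add: avg_def)

lemma avg_integrable_continuous:
  assumes "continuous_on S2 g"
  shows "integrable surface_measure (avg g)"
proof -
  obtain B where "\<And>y. y \<in> S2 \<Longrightarrow> cmod (g y) \<le> B"
    using continuous_bounded_S2[OF assms] by blast
  then show ?thesis
    using avg_measurable_continuous[OF assms] avg_bound[OF assms]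
    by (intro surface.integrable_const_bound[where B = B] AE_I2) auto
qed

text \<open>Orthogonality to \<open>Y\<^sub>0\<^sub>0\<close>, which is constant.\<close>
lemma integral_sph_harm_nonconstant:
  assumes "m \<in> {- int l..int l}" "l \<noteq> 0 \<or> m \<noteq> 0"
  shows "(LINT x|surface_measure. sph_harm l m x) = 0"
proof -
  define a where "a = complex_of_real (harm_const 0 0)"
  have a: "a \<noteq> 0" using harm_const_nonzero by (simp add: a_def)
  have Y0: "sph_harm 0 0 x = a" if "x \<in> S2" for x
    using sph_harm_closed_form[OF that, of 0 0] by (simp add: azimuthal_def rodrigues_def a_def)
  have "(LINT x|surface_measure. sph_harm l m x) * cnj a = (LINT x|surface_measure. sph_harm l m x * cnj (sph_harm 0 0 x))"
    unfolding integral_mult_left_zero[symmetric]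
    by (intro Bochner_Integration.integral_cong) (simp_all add: Y0)
  also have "\<dots> = 0" using sph_harm_orthonormal[OF assms(1), of 0 0] assms(2) by auto
  finally show ?thesis using a by simp
qed

lemma integral_harm_sum_invariant:
  "(LINT x|surface_measure. harm_sum N (\<lambda>l m. c l m * e l m) x) = (LINT x|surface_measure. harm_sum N c x)"
proof -
  have gen: "(LINT x|surface_measure. harm_sum N c x)
    = (\<Sum>l\<le>N. \<Sum>m\<in>{- int l..int l}. c l m * (LINT x|surface_measure. sph_harm l m x))" for c
    using integral_harm_sum[of surface_measure "\<lambda>_. 1" N c] continuous_imp_integrable_surface[OF continuous_on_sph_harm]
    by simp
  have "c l m * e l m * (LINT x|surface_measure. sph_harm l m x) = c l m * (LINT x|surface_measure. sph_harm l m x)"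
    if "m \<in> {- int l..int l}" for l m
    using integral_sph_harm_nonconstant[OF that] e_0_0 by (cases "l = 0 \<and> m = 0") auto
  then show ?thesis unfolding gen by (intro sum.cong refl)
qed

lemma avg_integral_continuous:
  assumes "continuous_on S2 g"
  shows "(LINT x|surface_measure. avg g x) = (LINT x|surface_measure. g x)"
proof -
  define v where "v = measure surface_measure S2"
  have v: "v \<ge> 0" by (simp add: v_def)
  have small: "cmod (LINT x|surface_measure. h x) \<le> d * v"
    if "integrable surface_measure h" "\<And>x. x \<in> S2 \<Longrightarrow> cmod (h x) \<le> d" for h :: "real^3 \<Rightarrow> complex" and d
  proof -
    have "cmod (LINT x|surface_measure. h x) \<le> (LINT x|surface_measure. cmod (h x))" by (rule integral_norm_bound)
    also have "\<dots> \<le> (LINT x|surface_measure. d)" using that by (intro integral_mono) auto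
    finally show ?thesis by (simp add: v_def mult.commute)
  qed
  have "cmod ((LINT x|surface_measure. avg g x) - (LINT x|surface_measure. g x)) \<le> 0 + \<epsilon>" if "\<epsilon> > 0" for \<epsilon>
  proof -
    define d where "d = \<epsilon> / 2 / (v + 1)"
    have d: "d > 0" using that v by (simp add: d_def)
    obtain N c where Nc: "\<And>x. x \<in> S2 \<Longrightarrow> cmod (g x - harm_sum N c x) < d"
      using sph_harm_uniformly_dense[OF assms d] by blast
    let ?h = "harm_sum N c"
    have h: "continuous_on S2 ?h" by (rule continuous_on_harm_sum)
    have "(LINT x|surface_measure. avg ?h x) = (LINT x|surface_measure. harm_sum N (\<lambda>l m. c l m * e l m) x)"
      by (intro Bochner_Integration.integral_cong) (simp_all add: avg_harm_sum)
    then have inv: "(LINT x|surface_measure. avg ?h x) = (LINT x|surface_measure. ?h x)"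
      by (simp add: integral_harm_sum_invariant)
    have "(LINT x|surface_measure. avg g x) - (LINT x|surface_measure. g x)
      = (LINT x|surface_measure. avg g x - avg ?h x) - (LINT x|surface_measure. g x - ?h x)"
      using assms h inv by (simp add: avg_integrable_continuous continuous_imp_integrable_surface)
    also have "cmod \<dots> \<le> d * v + d * v"
    proof (rule order_trans[OF norm_triangle_ineq4], rule add_mono; rule small)
      show "cmod (avg g x - avg ?h x) \<le> d" if "x \<in> S2" for x
        using avg_uniform_bound[OF assms h _ that] Nc by (auto intro: less_imp_le)
    qed (use assms h Nc in \<open>auto intro: less_imp_le avg_integrable_continuous continuous_imp_integrable_surface\<close>)
    also have "\<dots> \<le> 2 * (d * (v + 1))" using d by (simp add: algebra_simps)
    also have "d * (v + 1) = \<epsilon> / 2"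
      using nonzero_eq_divide_eq[of "v + 1" d "\<epsilon> / 2"] v d_def by linarith
    also have "2 * (\<epsilon> / 2) = \<epsilon>" by simp
    finally show ?thesis by simp
  qed
  then have "cmod ((LINT x|surface_measure. avg g x) - (LINT x|surface_measure. g x)) \<le> 0"
    by (rule field_le_epsilon)
  then show ?thesis by simp
qed

lemma K_closed:
  assumes "closed A" "A \<subseteq> S2"
  shows "(\<lambda>x. measure (K x) A) \<in> borel_measurable surface_measure"
    and "(LINT x|surface_measure. measure (K x) A) = measure surface_measure A"
proof -
  obtain g :: "nat \<Rightarrow> real^3 \<Rightarrow> real" where g: "\<And>n. continuous_on UNIV (g n)"
      "\<And>n x. 0 \<le> g n x" "\<And>n x. g n x \<le> 1" "\<And>x. (\<lambda>n. g n x) \<longlonglongrightarrow> indicator A x"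
    using indicator_closed_limit[OF assms(1)] by blast
  have A: "A \<in> sets surface_measure" using assms by (auto simp: sets_S2_sigma)
  have gc: "continuous_on S2 (g n)" for n by (rule continuous_on_subset[OF g(1)]) simp
  have c: "continuous_on S2 (\<lambda>x. complex_of_real (g n x))" for n
    by (intro continuous_intros gc)
  define T where "T n x = (LINT y|K x. g n y)" for n x
  have T: "avg (\<lambda>y. of_real (g n y)) x = of_real (T n x)" for n x
    by (simp add: avg_def T_def)
  have Tm: "T n \<in> borel_measurable surface_measure" for n
    using measurable_compose[OF avg_measurable_continuous[OF c[of n]] borel_measurable_Re] by (simp add: T)
  have Tlim: "(\<lambda>n. T n x) \<longlonglongrightarrow> measure (K x) A" if "x \<in> S2" for x
  proof -
    interpret prob_space "K x" by (rule prob_space_K[OF that])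
    have "(\<lambda>n. LINT y|K x. g n y) \<longlonglongrightarrow> (LINT y|K x. indicator A y)"
      by (rule integral_dominated_convergence[where w = "\<lambda>_. 1"])
         (use g A sets_K[OF that] K_measurable[OF that continuous_imp_measurable_surface[OF gc]] in
           \<open>auto intro!: AE_I2 borel_measurable_indicator\<close>)
    then show ?thesis using A sets_K[OF that] sets.sets_into_space[OF A] by (simp add: T_def space_K[OF that] Int_absorb2)
  qed
  show m: "(\<lambda>x. measure (K x) A) \<in> borel_measurable surface_measure"
    by (rule borel_measurable_LIMSEQ_real[of _ T]) (use Tm Tlim in auto)
  have lim: "(\<lambda>n. LINT x|surface_measure. T n x) \<longlonglongrightarrow> (LINT x|surface_measure. measure (K x) A)"
  proof (rule integral_dominated_convergence[where w = "\<lambda>_. 1"])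
    have "\<bar>T n x\<bar> \<le> 1" if "x \<in> S2" for n x
      using avg_bound[OF c[of n] _ that, of 1] g(2,3) by (simp add: T abs_of_nonneg)
    then show "AE x in surface_measure. norm (T n x) \<le> 1" for n by (auto intro!: AE_I2)
  qed (use Tm Tlim m in \<open>auto intro!: AE_I2\<close>)
  have Tg: "(LINT x|surface_measure. T n x) = (LINT x|surface_measure. g n x)" for n
  proof -
    have "complex_of_real (LINT x|surface_measure. T n x) = (LINT x|surface_measure. avg (\<lambda>y. of_real (g n y)) x)"
      by (simp add: T)
    also have "\<dots> = complex_of_real (LINT x|surface_measure. g n x)"
      by (simp add: avg_integral_continuous[OF c])
    finally show ?thesis by (simp only: of_real_eq_iff)
  qed
  have "(\<lambda>n. LINT x|surface_measure. g n x) \<longlonglongrightarrow> (LINT x|surface_measure. indicator A x)"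
    by (rule integral_dominated_convergence[where w = "\<lambda>_. 1"])
       (use g A continuous_imp_measurable_surface[OF gc] in \<open>auto intro!: AE_I2 borel_measurable_indicator\<close>)
  from LIMSEQ_unique[OF lim[unfolded Tg] this] show "(LINT x|surface_measure. measure (K x) A) = measure surface_measure A"
    using A sets.sets_into_space[OF A] by (simp add: Int_absorb2)
qed

lemma K_kernel: "K \<in> surface_measure \<rightarrow>\<^sub>M subprob_algebra surface_measure"
proof (rule measurable_subprob_algebra_generated)
  show "sets surface_measure = sigma_sets S2 {A. A \<subseteq> S2 \<and> closed A}" by (simp add: sets_S2_sigma)
  show "Int_stable {A :: (real^3) set. A \<subseteq> S2 \<and> closed A}" by (auto simp: Int_stable_def)
  show "{A :: (real^3) set. A \<subseteq> S2 \<and> closed A} \<subseteq> Pow S2" by auto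
  show "subprob_space (K x)" if "x \<in> space surface_measure" for x
    using that prob_space_K by (auto intro: prob_space_imp_subprob_space)
  have *: "(\<lambda>x. emeasure (K x) A) \<in> borel_measurable surface_measure" if "A \<in> {A. A \<subseteq> S2 \<and> closed A}" for A
  proof -
    have "(\<lambda>x. ennreal (measure (K x) A)) \<in> borel_measurable surface_measure"
      using K_closed(1)[of A] that by simp
    moreover have "emeasure (K x) A = ennreal (measure (K x) A)" if "x \<in> S2" for x
    proof -
      interpret prob_space "K x" by (rule prob_space_K[OF that])
      show ?thesis by (rule emeasure_eq_measure)
    qed
    ultimately show ?thesis
      by (subst measurable_cong[where g = "\<lambda>x. ennreal (measure (K x) A)"]) simp_all
  qed
  then show "\<And>A. A \<in> {A. A \<subseteq> S2 \<and> closed A} \<Longrightarrow> (\<lambda>x. emeasure (K x) A) \<in> borel_measurable surface_measure" .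
  show "(\<lambda>x. emeasure (K x) S2) \<in> borel_measurable surface_measure"
    by (rule *) auto
qed (simp add: sets_K)

text \<open>Averaging multiplies each \<open>Y\<^sub>l\<^sub>m\<close> by a number, which is \<open>1\<close> for the only harmonic with nonzero integral.
  So integrals of finite sums of harmonics are preserved, then those of continuous functions, and
  then the measures of closed sets.\<close>
lemma surface_measure_invariant: "surface_measure \<bind> K = surface_measure"
proof (rule measure_eqI_generator_eq)
  let ?E = "{A :: (real^3) set. A \<subseteq> S2 \<and> closed A}"
  have ne: "space surface_measure \<noteq> {}" using sph_in_S2[of 0 0] by (metis empty_iff space_surface_measure)
  show "Int_stable ?E" by (auto simp: Int_stable_def)
  show "?E \<subseteq> Pow S2" by auto
  show "sets (surface_measure \<bind> K) = sigma_sets S2 ?E"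
    using sets_bind[OF sets_kernel[OF K_kernel] ne] by (simp add: sets_S2_sigma)
  show "sets surface_measure = sigma_sets S2 ?E" by (simp add: sets_S2_sigma)
  show eq: "emeasure (surface_measure \<bind> K) A = emeasure surface_measure A" if A: "A \<in> ?E" for A
  proof -
    have As: "A \<in> sets surface_measure" using A by (auto simp: sets_S2_sigma)
    have K1: "0 \<le> measure (K x) A \<and> measure (K x) A \<le> 1 \<and> emeasure (K x) A = ennreal (measure (K x) A)" if "x \<in> S2" for x
    proof -
      interpret prob_space "K x" by (rule prob_space_K[OF that])
      show ?thesis by (auto simp: emeasure_eq_measure)
    qed
    have "emeasure (surface_measure \<bind> K) A = (\<integral>\<^sup>+ x. emeasure (K x) A \<partial>surface_measure)"
      by (rule emeasure_bind[OF ne K_kernel As])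
    also have "\<dots> = (\<integral>\<^sup>+ x. ennreal (measure (K x) A) \<partial>surface_measure)"
      using K1 by (intro nn_integral_cong) auto
    also have "\<dots> = ennreal (LINT x|surface_measure. measure (K x) A)"
      using K1 K_closed(1)[of A] A
      by (intro nn_integral_eq_integral surface.integrable_const_bound[where B = 1] AE_I2) auto
    also have "\<dots> = emeasure surface_measure A"
      using K_closed(2)[of A] A by (simp add: surface.emeasure_eq_measure)
    finally show ?thesis .
  qed
  show "range (\<lambda>i::nat. S2) \<subseteq> ?E" "(\<Union>i::nat. S2) = S2" by auto
  show "emeasure (surface_measure \<bind> K) S2 \<noteq> \<infinity>"
    using eq[of S2] surface.emeasure_finite by auto
qed

lemma nn_integral_invariant:
  assumes "f \<in> borel_measurable surface_measure"
  shows "(\<integral>\<^sup>+ x. (\<integral>\<^sup>+ y. f y \<partial>K x) \<partial>surface_measure) = (\<integral>\<^sup>+ x. f x \<partial>surface_measure)"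
  using nn_integral_bind[OF assms K_kernel] surface_measure_invariant by simp

lemma avg_measurable: "f \<in> borel_measurable surface_measure \<Longrightarrow> avg f \<in> borel_measurable surface_measure"
  unfolding avg_def[abs_def]
  by (rule measurable_compose[OF K_kernel integral_measurable_subprob_algebra])

text \<open>Invariance says that the averages of \<open>\<bar>f\<bar>\<^sup>2\<close> have a finite integral, so almost all of them are finite.\<close>
lemma AE_square_integrable:
  assumes "L2 f"
  shows "AE x in surface_measure. integrable (K x) (\<lambda>y. (cmod (f y))\<^sup>2) \<and> integrable (K x) f"
proof -
  have m: "f \<in> borel_measurable surface_measure" using assms by (rule L2_measurable)
  have m2: "(\<lambda>y. ennreal ((cmod (f y))\<^sup>2)) \<in> borel_measurable surface_measure" using m by simp
  have "(\<integral>\<^sup>+ x. (\<integral>\<^sup>+ y. ennreal ((cmod (f y))\<^sup>2) \<partial>K x) \<partial>surface_measure) \<noteq> \<infinity>"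
    unfolding nn_integral_invariant[OF m2]
    using L2_integrable_square[OF assms] by (simp add: nn_integral_eq_integral)
  then have "AE x in surface_measure. (\<integral>\<^sup>+ y. ennreal ((cmod (f y))\<^sup>2) \<partial>K x) \<noteq> \<infinity>"
    by (intro nn_integral_PInf_AE measurable_compose[OF K_kernel nn_integral_measurable_subprob_algebra] m2)
  then show ?thesis
    using AE_space
  proof eventually_elim
    case (elim x)
    then have x: "x \<in> S2" by simp
    interpret prob_space "K x" by (rule prob_space_K[OF x])
    have mK: "f \<in> borel_measurable (K x)" by (rule K_measurable[OF x m])
    have sq: "integrable (K x) (\<lambda>y. (cmod (f y))\<^sup>2)"
      using elim mK by (intro integrableI_nonneg) (auto simp: less_top)
    have "integrable (K x) f"
    proof (rule Bochner_Integration.integrable_bound)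
      show "integrable (K x) (\<lambda>y. 1 + (cmod (f y))\<^sup>2)" using sq by simp
      show "AE y in K x. norm (f y) \<le> norm (1 + (cmod (f y))\<^sup>2)"
      proof (intro AE_I2)
        fix y
        have "0 \<le> (cmod (f y) - 1)\<^sup>2 + (cmod (f y))\<^sup>2" by simp
        then have "2 * cmod (f y) \<le> 2 * (1 + (cmod (f y))\<^sup>2)"
          using zero_le_power2[of "cmod (f y)"] by (simp add: power2_eq_square algebra_simps)
        then show "norm (f y) \<le> norm (1 + (cmod (f y))\<^sup>2)" by simp
      qed
    qed (rule mK)
    with sq show ?case by simp
  qed
qed

lemma avg_square_le:
  assumes "x \<in> S2" "integrable (K x) f" "integrable (K x) (\<lambda>y. (cmod (f y))\<^sup>2)"
  shows "(cmod (avg f x))\<^sup>2 \<le> (LINT y|K x. (cmod (f y))\<^sup>2)"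
proof -
  interpret prob_space "K x" by (rule prob_space_K[OF assms(1)])
  let ?a = "LINT y|K x. cmod (f y)"
  have "0 \<le> (LINT y|K x. (cmod (f y) - ?a)\<^sup>2)" by simp
  also have "\<dots> = (LINT y|K x. (cmod (f y))\<^sup>2 - 2 * ?a * cmod (f y) + ?a\<^sup>2)"
    by (intro Bochner_Integration.integral_cong) (auto simp: power2_eq_square algebra_simps)
  also have "\<dots> = (LINT y|K x. (cmod (f y))\<^sup>2) - 2 * ?a * ?a + ?a\<^sup>2"
    using assms by (simp add: prob_space)
  finally have "?a\<^sup>2 \<le> (LINT y|K x. (cmod (f y))\<^sup>2)" by (simp add: power2_eq_square)
  moreover have "(cmod (avg f x))\<^sup>2 \<le> ?a\<^sup>2"
    unfolding avg_def by (intro power_mono integral_norm_bound) simp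
  ultimately show ?thesis by linarith
qed

lemma avg_L2:
  assumes "L2 f"
  shows "L2 (avg f)" "L2_norm (avg f) \<le> L2_norm f"
proof -
  have m: "f \<in> borel_measurable surface_measure" using assms by (rule L2_measurable)
  have m2: "(\<lambda>y. ennreal ((cmod (f y))\<^sup>2)) \<in> borel_measurable surface_measure" using m by simp
  have "(\<integral>\<^sup>+ x. ennreal ((cmod (avg f x))\<^sup>2) \<partial>surface_measure)
      \<le> (\<integral>\<^sup>+ x. (\<integral>\<^sup>+ y. ennreal ((cmod (f y))\<^sup>2) \<partial>K x) \<partial>surface_measure)"
  proof (rule nn_integral_mono_AE)
    show "AE x in surface_measure. ennreal ((cmod (avg f x))\<^sup>2) \<le> (\<integral>\<^sup>+ y. ennreal ((cmod (f y))\<^sup>2) \<partial>K x)"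
      using AE_square_integrable[OF assms] AE_space
    proof eventually_elim
      case (elim x)
      then show ?case using avg_square_le[of x f] by (simp add: nn_integral_eq_integral ennreal_leI)
    qed
  qed
  also have "\<dots> = ennreal ((L2_norm f)\<^sup>2)"
    unfolding nn_integral_invariant[OF m2] L2_norm_square
    using L2_integrable_square[OF assms] by (simp add: nn_integral_eq_integral)
  finally have le: "(\<integral>\<^sup>+ x. ennreal ((cmod (avg f x))\<^sup>2) \<partial>surface_measure) \<le> ennreal ((L2_norm f)\<^sup>2)" .
  have int: "integrable surface_measure (\<lambda>x. (cmod (avg f x))\<^sup>2)"
    using avg_measurable[OF m] le by (intro integrableI_nonneg) (auto intro: le_less_trans)
  then show "L2 (avg f)" using avg_measurable[OF m] by (simp add: L2_def)
  have "ennreal ((L2_norm (avg f))\<^sup>2) \<le> ennreal ((L2_norm f)\<^sup>2)"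
    using le unfolding L2_norm_square[of "avg f"] using int by (simp add: nn_integral_eq_integral)
  then have "(L2_norm (avg f))\<^sup>2 \<le> (L2_norm f)\<^sup>2" by simp
  then show "L2_norm (avg f) \<le> L2_norm f" by (rule power2_le_imp_le) simp
qed

text \<open>The error is the average of \<open>f\<close> minus the partial sum of its own expansion, and averaging is a
  contraction.\<close>
theorem avg_expansion:
  assumes "L2 f"
  shows "(\<lambda>N. L2_norm (\<lambda>x. avg f x - harm_sum N (\<lambda>l m. fourier_laplace f l m * e l m) x)) \<longlonglongrightarrow> 0"
proof -
  have le: "L2_norm (\<lambda>x. avg f x - harm_sum N (\<lambda>l m. fourier_laplace f l m * e l m) x)
      \<le> L2_norm (\<lambda>x. f x - harm_sum N (fourier_laplace f) x)" for N
  proof -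
    let ?h = "harm_sum N (fourier_laplace f)"
    have "AE x in surface_measure. avg f x - harm_sum N (\<lambda>l m. fourier_laplace f l m * e l m) x = avg (\<lambda>y. f y - ?h y) x"
      using AE_square_integrable[OF assms] AE_space
    proof eventually_elim
      case (elim x)
      then have x: "x \<in> S2" by simp
      have "avg (\<lambda>y. f y - ?h y) x = avg f x - avg ?h x"
        unfolding avg_def using elim K_integrable_continuous[OF x continuous_on_harm_sum] by simp
      then show ?case by (simp add: avg_harm_sum[OF x])
    qed
    then have "(LINT x|surface_measure. (cmod (avg f x - harm_sum N (\<lambda>l m. fourier_laplace f l m * e l m) x))\<^sup>2)
        = (LINT x|surface_measure. (cmod (avg (\<lambda>y. f y - ?h y) x))\<^sup>2)"
    proof (intro integral_cong_AE)
      show "(\<lambda>x. (cmod (avg f x - harm_sum N (\<lambda>l m. fourier_laplace f l m * e l m) x))\<^sup>2) \<in> borel_measurable surface_measure"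
        using L2_measurable[OF L2_diff[OF avg_L2(1)[OF assms] L2_harm_sum]] by measurable
      show "(\<lambda>x. (cmod (avg (\<lambda>y. f y - ?h y) x))\<^sup>2) \<in> borel_measurable surface_measure"
        using L2_measurable[OF avg_L2(1)[OF L2_diff[OF assms L2_harm_sum]]] by measurable
    qed (auto elim: eventually_mono)
    then have "L2_norm (\<lambda>x. avg f x - harm_sum N (\<lambda>l m. fourier_laplace f l m * e l m) x) = L2_norm (avg (\<lambda>y. f y - ?h y))"
      by (simp add: L2_norm_def)
    then show ?thesis using avg_L2(2)[OF L2_diff[OF assms L2_harm_sum]] by simp
  qed
  show ?thesis
    by (rule tendsto_sandwich[OF _ _ tendsto_const harmonic_expansion[OF assms]]) (auto intro!: always_eventually le)
qed

text \<open>Coefficients are continuous in \<open>L\<^sup>2\<close>, and those of the partial sums are constant from \<open>N = l\<close> on.\<close>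
lemma fourier_laplace_avg:
  assumes "L2 f" "m \<in> {- int l..int l}"
  shows "fourier_laplace (avg f) l m = fourier_laplace f l m * e l m"
proof -
  let ?h = "\<lambda>N. harm_sum N (\<lambda>l m. fourier_laplace f l m * e l m)"
  have "cmod (fourier_laplace (avg f) l m - fourier_laplace f l m * e l m) \<le> L2_norm (\<lambda>x. avg f x - ?h N x)"
    if "N \<ge> l" for N
  proof -
    have "fourier_laplace (\<lambda>x. avg f x - ?h N x) l m = fourier_laplace (avg f) l m - fourier_laplace f l m * e l m"
      using that by (simp add: fourier_laplace_diff[OF avg_L2(1)[OF assms(1)] L2_harm_sum assms(2)] fourier_laplace_harm_sum[OF assms(2)])
    then show ?thesis
      using fourier_laplace_bound[OF L2_diff[OF avg_L2(1)[OF assms(1)] L2_harm_sum] assms(2)] by metis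
  qed
  then have "cmod (fourier_laplace (avg f) l m - fourier_laplace f l m * e l m) \<le> 0"
    by (intro LIMSEQ_le_const[OF avg_expansion[OF assms(1)]]) blast
  then show ?thesis by simp
qed

end

section \<open>The Feller semigroup on eigenfunctions of its generator\<close>

lemma process_events_closed:
  "space M \<in> process_events M I X"
  "{} \<in> process_events M I X"
  "A \<in> process_events M I X \<Longrightarrow> space M - A \<in> process_events M I X"
  "(\<And>n::nat. B n \<in> process_events M I X) \<Longrightarrow> (\<Union>n. B n) \<in> process_events M I X"
  unfolding process_events_def
  by (auto intro: sigma_sets_top sigma_sets.Empty sigma_sets.Compl sigma_sets.Union)

lemma process_events_sigma_algebra: "sigma_algebra (space M) (process_events M I X)"
  unfolding process_events_def by (rule sigma_algebra_sigma_sets) auto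

lemma process_events_basic:
  "t \<in> I \<Longrightarrow> B \<in> sets borel \<Longrightarrow> X t -` B \<inter> space M \<in> process_events M I X"
  unfolding process_events_def by (rule sigma_sets.Basic) auto

locale feller =
  fixes M :: "'w measure" and P :: "real^3 \<Rightarrow> 'w measure" and W :: "real \<Rightarrow> 'w \<Rightarrow> real^3"
  assumes feller: "feller_diffusion M P W"
begin

abbreviation "T \<equiv> transition_op P W"

lemma prob_space_P: "x \<in> S2 \<Longrightarrow> prob_space (P x)"
  and sets_P: "x \<in> S2 \<Longrightarrow> sets (P x) = sets M"
  and W_measurable: "t \<ge> 0 \<Longrightarrow> W t \<in> measurable M (restrict_space borel S2)"
  and W_continuous: "\<omega> \<in> space M \<Longrightarrow> continuous_on {0..} (\<lambda>t. W t \<omega>)"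
  and W_start: "x \<in> S2 \<Longrightarrow> AE \<omega> in P x. W 0 \<omega> = x"
  and markov: "\<lbrakk>x \<in> S2; 0 \<le> s; 0 \<le> t; A \<in> process_events M {0..s} W; continuous_on S2 g\<rbrakk> \<Longrightarrow>
      (LINT \<omega>:A|P x. g (W (s + t) \<omega>)) = (LINT \<omega>:A|P x. T t g (W s \<omega>))"
  and feller_continuous: "\<lbrakk>0 \<le> t; continuous_on S2 g\<rbrakk> \<Longrightarrow> continuous_on S2 (T t g)"
  using feller unfolding feller_diffusion_def by blast+

lemma space_P: "x \<in> S2 \<Longrightarrow> space (P x) = space M"
  using sets_eq_imp_space_eq[OF sets_P] .

lemma W_in_S2: "t \<ge> 0 \<Longrightarrow> \<omega> \<in> space M \<Longrightarrow> W t \<omega> \<in> S2"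
  using measurable_space[OF W_measurable] by (auto simp: space_restrict_space)

lemma g_W_measurable:
  fixes g :: "real^3 \<Rightarrow> 'b::{banach, second_countable_topology}"
  assumes "x \<in> S2" "0 \<le> t" "continuous_on S2 g"
  shows "(\<lambda>\<omega>. g (W t \<omega>)) \<in> borel_measurable (P x)"
  using measurable_compose[OF W_measurable[OF assms(2)] borel_measurable_continuous_on_restrict[OF assms(3)]]
    sets_P[OF assms(1)] by (simp cong: measurable_cong_sets)

lemma g_W_integrable:
  fixes g :: "real^3 \<Rightarrow> 'b::{banach, second_countable_topology}"
  assumes "x \<in> S2" "0 \<le> t" "continuous_on S2 g"
  shows "integrable (P x) (\<lambda>\<omega>. g (W t \<omega>))"
proof -
  interpret prob_space "P x" by (rule prob_space_P[OF assms(1)])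
  obtain B where "\<And>y. y \<in> S2 \<Longrightarrow> norm (g y) \<le> B"
    using continuous_bounded_S2[OF assms(3)] by blast
  then show ?thesis
    using W_in_S2[OF assms(2)] space_P[OF assms(1)] g_W_measurable[OF assms]
    by (intro integrable_const_bound[where B = B] AE_I2) auto
qed

lemma T_uniform_bound:
  assumes "x \<in> S2" "0 \<le> t" "continuous_on S2 f" "continuous_on S2 g"
    "\<And>y. y \<in> S2 \<Longrightarrow> cmod (f y - g y) \<le> d"
  shows "cmod (T t f x - T t g x) \<le> d"
proof -
  interpret prob_space "P x" by (rule prob_space_P[OF assms(1)])
  have "T t f x - T t g x = (LINT \<omega>|P x. f (W t \<omega>) - g (W t \<omega>))"
    unfolding transition_op_def using assms by (simp add: g_W_integrable)
  also have "cmod \<dots> \<le> (LINT \<omega>|P x. cmod (f (W t \<omega>) - g (W t \<omega>)))" by (rule integral_norm_bound)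
  also have "\<dots> \<le> (LINT \<omega>|P x. d)"
    using g_W_integrable[OF assms(1,2,3)] g_W_integrable[OF assms(1,2,4)] assms(5) W_in_S2[OF assms(2)]
    by (intro integral_mono) (auto simp: space_P[OF assms(1)])
  also have "\<dots> = d" by (simp add: prob_space)
  finally show ?thesis .
qed

lemma semigroup:
  assumes "x \<in> S2" "0 \<le> s" "0 \<le> t" "continuous_on S2 g"
  shows "T (s + t) g x = T s (T t g) x"
proof -
  have full: "(LINT \<omega>:space M|P x. h \<omega>) = (LINT \<omega>|P x. h \<omega>)" for h :: "'w \<Rightarrow> complex"
    unfolding set_lebesgue_integral_def
    by (intro Bochner_Integration.integral_cong) (auto simp: space_P[OF assms(1)])
  show ?thesis
    using markov[OF assms(1-3) process_events_closed(1) assms(4)] unfolding full by (simp add: transition_op_def)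
qed

lemma T_0:
  assumes "x \<in> S2" "continuous_on S2 g"
  shows "T 0 g x = g x"
proof -
  interpret prob_space "P x" by (rule prob_space_P[OF assms(1)])
  have "T 0 g x = (LINT \<omega>|P x. g x)"
    unfolding transition_op_def
    by (rule integral_cong_AE) (use g_W_measurable[OF assms(1) _ assms(2), of 0] W_start[OF assms(1)] in auto)
  then show ?thesis by (simp add: prob_space)
qed

text \<open>The function \<open>v(s) = exp (- z s) T\<^sub>s g\<close> is constant: over a step of length \<open>h\<close> it changes by
  \<open>o(h)\<close>, uniformly in \<open>s \<le> t\<close> and \<open>x\<close>, because \<open>T\<^sub>h g\<close> and \<open>exp (z h) g\<close> agree to first order uniformly
  on the sphere and \<open>T\<^sub>s\<close> is a contraction. Adding up \<open>t / h\<close> such steps leaves an arbitrarily small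
  total change.\<close>
lemma T_eigenfunction:
  assumes gen: "(g, \<lambda>x. z * g x) \<in> feller_generator T" and "x \<in> S2" "0 \<le> t"
  shows "T t g x = exp (z * of_real t) * g x"
proof (cases "t = 0")
  case True
  then show ?thesis using T_0[OF assms(2)] gen by (simp add: feller_generator_def)
next
  case False
  then have t: "t > 0" using assms(3) by simp
  have g: "continuous_on S2 g"
    and lim: "uniform_limit S2 (\<lambda>t x. (T t g x - g x) /\<^sub>R t) (\<lambda>x. z * g x) (at_right 0)"
    using gen by (auto simp: feller_generator_def)
  obtain B0 where B0: "\<And>y. y \<in> S2 \<Longrightarrow> cmod (g y) \<le> B0"
    using continuous_bounded_S2[OF g] by blast
  define B where "B = max B0 1"
  have B: "B \<ge> 1" "\<And>y. y \<in> S2 \<Longrightarrow> cmod (g y) \<le> B" using B0 by (force simp: B_def)+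
  define v where "v s = exp (- z * of_real s) * T s g x" for s
  define C where "C = exp (cmod z * t)"
  have C: "cmod (exp (- z * of_real s)) \<le> C" if "0 \<le> s" "s \<le> t" for s
  proof -
    have "cmod (exp (- z * of_real s)) \<le> exp (cmod (- z * of_real s))" by (rule norm_exp)
    also have "\<dots> \<le> C" using that by (simp add: C_def norm_mult mult_left_mono)
    finally show ?thesis .
  qed
  have C0: "C > 0" by (simp add: C_def)
  have "cmod (v t - v 0) \<le> 0 + \<epsilon>" if "\<epsilon> > 0" for \<epsilon>
  proof -
    \<comment> \<open>The tolerance per unit of time; the factor \<open>C\<close> bounds \<open>exp (- z s)\<close> on \<open>[0, t]\<close>.\<close>
    define \<delta> where "\<delta> = \<epsilon> / (C * t)"
    have \<delta>: "\<delta> > 0" using that C0 t by (simp add: \<delta>_def)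
    have "\<forall>\<^sub>F h in at_right 0. \<forall>y\<in>S2. dist ((T h g y - g y) /\<^sub>R h) (z * g y) < \<delta> / 2"
      by (rule uniform_limitD[OF lim]) (simp add: \<delta>)
    moreover have "\<forall>\<^sub>F h in at_right (0::real). cmod ((exp (z * of_real h) - 1) / of_real h - z) < \<delta> / (2 * B)"
    proof -
      have "((\<lambda>w. exp (z * w)) has_field_derivative z) (at 0)"
        by (auto intro!: derivative_eq_intros)
      then have "((\<lambda>w. (exp (z * w) - 1) / w) \<longlongrightarrow> z) (at 0)"
        by (simp add: has_field_derivative_iff)
      moreover have "filterlim complex_of_real (at 0) (at_right 0)"
        by (auto simp: filterlim_at intro!: tendsto_eq_intros) (auto simp: eventually_at_filter)
      ultimately have "((\<lambda>h. (exp (z * of_real h) - 1) / of_real h) \<longlongrightarrow> z) (at_right 0)"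
        by (rule filterlim_compose)
      from tendstoD[OF this, of "\<delta> / (2 * B)"] show ?thesis using \<delta> B(1) by (simp add: dist_norm)
    qed
    moreover have "\<forall>\<^sub>F h in at_right (0::real). h > 0" by (simp add: eventually_at_right_less)
    ultimately have "\<forall>\<^sub>F h in at_right 0. \<forall>y\<in>S2. cmod (T h g y - exp (z * of_real h) * g y) \<le> \<delta> * h"
    proof eventually_elim
      case (elim h)
      show ?case
      proof
        fix y assume y: "y \<in> S2"
        define a b where "a = (T h g y - g y) /\<^sub>R h - z * g y" and "b = (exp (z * of_real h) - 1) / of_real h - z"
        have h: "complex_of_real h \<noteq> 0" using elim(3) by simp
        have "T h g y - exp (z * of_real h) * g y = of_real h * (a - b * g y)"
          using h by (simp add: a_def b_def field_simps scaleR_conv_of_real)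
        also have "cmod \<dots> \<le> h * (cmod a + cmod b * cmod (g y))"
          using elim(3) norm_triangle_ineq4[of a "b * g y"] by (simp add: norm_mult)
        also have "\<dots> \<le> h * (\<delta> / 2 + \<delta> / (2 * B) * B)"
          using elim y B \<delta> by (intro mult_left_mono add_mono mult_mono)
            (auto simp: a_def b_def dist_norm intro: less_imp_le)
        also have "\<dots> = \<delta> * h" using B(1) by (simp add: field_simps)
        finally show "cmod (T h g y - exp (z * of_real h) * g y) \<le> \<delta> * h" .
      qed
    qed
    then obtain b where b: "b > 0"
      "\<And>h y. \<lbrakk>0 < h; h < b; y \<in> S2\<rbrakk> \<Longrightarrow> cmod (T h g y - exp (z * of_real h) * g y) \<le> \<delta> * h"
      unfolding eventually_at_right_field by blast
    obtain n where n: "t / b < real n" using reals_Archimedean2 by blast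
    have n0: "n > 0" using n t b(1) by (metis divide_pos_pos less_trans of_nat_0_less_iff)
    define h where "h = t / real n"
    have h: "0 < h" "h < b" "real n * h = t" using n n0 t b(1) by (auto simp: h_def field_simps)
    have step: "cmod (v (real (Suc k) * h) - v (real k * h)) \<le> C * (\<delta> * h)" if "k < n" for k
    proof -
      define s where "s = real k * h"
      have s0: "0 \<le> s" using h(1) by (simp add: s_def)
      have sh: "real (Suc k) * h = s + h" by (simp add: s_def algebra_simps)
      have "real (Suc k) * h \<le> real n * h" using that h(1) by (intro mult_right_mono) auto
      then have st: "s + h \<le> t" unfolding sh h(3) .
      have e: "exp (- z * of_real s) = exp (- z * of_real (s + h)) * exp (z * of_real h)"
        unfolding exp_add[symmetric] by (simp add: algebra_simps)
      have "v (s + h) - v s = exp (- z * of_real (s + h)) * (T (s + h) g x - exp (z * of_real h) * T s g x)"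
        unfolding v_def e by (simp add: algebra_simps)
      also have "T (s + h) g x - exp (z * of_real h) * T s g x = T s (T h g) x - T s (\<lambda>y. exp (z * of_real h) * g y) x"
        using semigroup[OF assms(2) s0 less_imp_le[OF h(1)] g] by (simp add: transition_op_def)
      finally have "cmod (v (s + h) - v s) = cmod (exp (- z * of_real (s + h))) * cmod (T s (T h g) x - T s (\<lambda>y. exp (z * of_real h) * g y) x)"
        by (simp add: norm_mult)
      also have "\<dots> \<le> C * (\<delta> * h)"
      proof (rule mult_mono)
        show "cmod (exp (- z * of_real (s + h))) \<le> C" using s0 h(1) st by (intro C) auto
        show "cmod (T s (T h g) x - T s (\<lambda>y. exp (z * of_real h) * g y) x) \<le> \<delta> * h"
          using b(2)[OF h(1,2)] h(1)
          by (intro T_uniform_bound assms(2) s0 feller_continuous g continuous_intros) auto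
      qed (use C0 in auto)
      finally show ?thesis unfolding sh by (simp only: s_def)
    qed
    have "v t - v 0 = (\<Sum>k<n. v (real (Suc k) * h) - v (real k * h))"
      using sum_lessThan_telescope[of "\<lambda>k. v (real k * h)" n] h(3) by simp
    also have "cmod \<dots> \<le> (\<Sum>k<n. C * (\<delta> * h))"
      by (rule order_trans[OF norm_sum sum_mono]) (use step in auto)
    also have "\<dots> = C * \<delta> * (real n * h)" by simp
    also have "\<dots> = \<epsilon>" unfolding h(3) \<delta>_def using C0 t by simp
    finally show ?thesis by simp
  qed
  then have "cmod (v t - v 0) \<le> 0" by (rule field_le_epsilon)
  then have "exp (- z * of_real t) * T t g x = g x"
    using T_0[OF assms(2) g] by (simp add: v_def)
  then have "exp (z * of_real t) * g x = (exp (z * of_real t) * exp (- z * of_real t)) * T t g x"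
    by simp
  also have "exp (z * of_real t) * exp (- z * of_real t) = 1" by (simp flip: exp_add)
  finally show ?thesis by simp
qed

end

lemma sph_harm_in_generator:
  assumes "spherical_BM_with_drift \<mu> M P W" "m \<in> {- int l..int l}"
  shows "(sph_harm l m, \<lambda>x. (\<i> * of_real \<mu> * of_int m - of_nat (l * (l + 1))) * sph_harm l m x)
    \<in> feller_generator (transition_op P W)"
proof -
  have "uniform_limit S2 (\<lambda>n::nat. drift_operator \<mu> (sph_harm l m))
      (\<lambda>x. (\<i> * of_real \<mu> * of_int m - of_nat (l * (l + 1))) * sph_harm l m x) sequentially"
    by (rule uniform_limit_cong'[THEN iffD1, OF _ _ uniform_limit_const])
       (auto simp: drift_operator_sph_harm[OF assms(2)])
  then have "(sph_harm l m, \<lambda>x. (\<i> * of_real \<mu> * of_int m - of_nat (l * (l + 1))) * sph_harm l m x)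
    \<in> closure_of_operator (drift_operator \<mu>)"
    unfolding closure_of_operator_def
    using smooth_sph_harm[OF assms(2)] by (auto intro!: exI[of _ "\<lambda>n. sph_harm l m"] uniform_limit_const)
  then show ?thesis using assms(1) by (simp add: spherical_BM_with_drift_def)
qed

lemma transition_sph_harm:
  assumes "spherical_BM_with_drift \<mu> M P W" "m \<in> {- int l..int l}" "x \<in> S2" "0 \<le> t"
  shows "transition_op P W t (sph_harm l m) x
    = exp ((\<i> * of_real \<mu> * of_int m - of_nat (l * (l + 1))) * of_real t) * sph_harm l m x"
proof -
  interpret feller M P W using assms(1) by unfold_locales (simp add: spherical_BM_with_drift_def)
  show ?thesis by (rule T_eigenfunction[OF sph_harm_in_generator[OF assms(1,2)] assms(3,4)])
qed

section \<open>Independent random times\<close>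

lemma (in prob_space) independent_events_integral:
  fixes X :: "'a \<Rightarrow> complex"
  assumes ind: "indep_set E F" and F: "sigma_algebra (space M) F" "A \<in> F"
    and X: "X \<in> borel_measurable M" "\<And>B. B \<in> sets borel \<Longrightarrow> X -` B \<inter> space M \<in> E" "integrable M X"
  shows "(LINT \<omega>:A|M. X \<omega>) = of_real (prob A) * expectation X"
proof -
  interpret F: sigma_algebra "space M" F by (rule F)
  have A: "A \<in> events" using indep_setD_ev2[OF ind] F by blast
  let ?Y = "\<lambda>\<omega>. indicator A \<omega> :: complex"
  have Y: "?Y -` B \<inter> space M \<in> F" for B
  proof -
    have "?Y -` B \<inter> space M = (if 1 \<in> B then A else {}) \<union> (if 0 \<in> B then space M - A else {})"
    proof (rule set_eqI)
      fix \<omega>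
      show "\<omega> \<in> ?Y -` B \<inter> space M \<longleftrightarrow> \<omega> \<in> (if 1 \<in> B then A else {}) \<union> (if 0 \<in> B then space M - A else {})"
        using sets.sets_into_space[OF A] by (cases "\<omega> \<in> A") auto
    qed
    then show ?thesis using F(2) by auto
  qed
  have "indep_var borel X borel ?Y"
    unfolding indep_var_def indep_vars_def2
  proof
    show "\<forall>i\<in>UNIV. random_variable (case i of True \<Rightarrow> borel | False \<Rightarrow> borel) (case i of True \<Rightarrow> X | False \<Rightarrow> ?Y)"
      using X(1) A by (auto split: bool.split)
    show "indep_sets (\<lambda>i. {(case i of True \<Rightarrow> X | False \<Rightarrow> ?Y) -` B \<inter> space M |B. B \<in> sets (case i of True \<Rightarrow> borel | False \<Rightarrow> borel)}) UNIV"
      by (rule indep_sets_mono_sets[OF ind[unfolded indep_set_def]])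
         (use X(2) Y in \<open>auto split: bool.split\<close>)
  qed
  moreover have "integrable M ?Y" using A by (intro integrable_const_bound[where B = 1]) (auto simp: indicator_def)
  ultimately have "(LINT \<omega>|M. X \<omega> * ?Y \<omega>) = expectation X * expectation ?Y"
    using X(3) by (intro indep_var_lebesgue_integral)
  moreover have "expectation ?Y = of_real (prob A)"
  proof -
    have "expectation ?Y = expectation (\<lambda>\<omega>. complex_of_real (indicator A \<omega>))"
      by (intro Bochner_Integration.integral_cong) (auto simp: indicator_def)
    then show ?thesis using A sets.sets_into_space[OF A] by (simp add: Int_absorb2)
  qed
  moreover have "(LINT \<omega>:A|M. X \<omega>) = (LINT \<omega>|M. X \<omega> * ?Y \<omega>)"
    unfolding set_lebesgue_integral_def by (intro Bochner_Integration.integral_cong) (auto simp: indicator_def)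
  ultimately show ?thesis by simp
qed

text \<open>If the time \<open>L\<close> takes only countably many values, split according to its value and use independence
  on each piece. In general \<open>L\<close> is approximated from above by the next multiple of
  \<open>1 / (n + 1)\<close>, and the continuity of the paths permits the passage to the limit.\<close>
lemma (in prob_space) independent_random_time:
  fixes X :: "real \<Rightarrow> 'a \<Rightarrow> complex" and L :: "'a \<Rightarrow> real"
  assumes ind: "indep_set E F" and F: "sigma_algebra (space M) F"
    and X: "\<And>s. 0 \<le> s \<Longrightarrow> X s \<in> borel_measurable M"
      "\<And>s B. 0 \<le> s \<Longrightarrow> B \<in> sets borel \<Longrightarrow> X s -` B \<inter> space M \<in> E"
      "\<And>s \<omega>. 0 \<le> s \<Longrightarrow> \<omega> \<in> space M \<Longrightarrow> cmod (X s \<omega>) \<le> B"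
      "\<And>\<omega>. \<omega> \<in> space M \<Longrightarrow> continuous_on {0..} (\<lambda>s. X s \<omega>)"
    and L: "\<And>\<omega>. \<omega> \<in> space M \<Longrightarrow> 0 \<le> L \<omega>" "\<And>s. {\<omega> \<in> space M. L \<omega> < s} \<in> F"
  shows "(\<lambda>\<omega>. X (L \<omega>) \<omega>) \<in> borel_measurable M"
    and "expectation (\<lambda>\<omega>. X (L \<omega>) \<omega>) = expectation (\<lambda>\<omega>. expectation (X (L \<omega>)))"
proof -
  interpret F: sigma_algebra "space M" F by (rule F)
  have FM: "A \<in> events" if "A \<in> F" for A using indep_setD_ev2[OF ind] that by blast
  define k where "k n \<omega> = nat \<lfloor>real (Suc n) * L \<omega>\<rfloor>" for n \<omega>
  define \<tau> where "\<tau> n j = real (Suc j) / real (Suc n)" for n j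
  have \<tau>0: "0 \<le> \<tau> n j" for n j by (simp add: \<tau>_def)
  define A where "A n j = {\<omega> \<in> space M. k n \<omega> = j}" for n j
  have AF: "A n j \<in> F" for n j
  proof -
    have "A n j = {\<omega> \<in> space M. L \<omega> < real (Suc j) / real (Suc n)} - {\<omega> \<in> space M. L \<omega> < real j / real (Suc n)}"
    proof -
      have "k n \<omega> = j \<longleftrightarrow> L \<omega> < real (Suc j) / real (Suc n) \<and> \<not> L \<omega> < real j / real (Suc n)" if "\<omega> \<in> space M" for \<omega>
      proof -
        have "0 \<le> \<lfloor>real (Suc n) * L \<omega>\<rfloor>" using L(1)[OF that] by simp
        then have "k n \<omega> = j \<longleftrightarrow> \<lfloor>real (Suc n) * L \<omega>\<rfloor> = int j" unfolding k_def by linarith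
        also have "\<dots> \<longleftrightarrow> real j \<le> real (Suc n) * L \<omega> \<and> real (Suc n) * L \<omega> < real j + 1"
          by (simp add: floor_eq_iff)
        also have "\<dots> \<longleftrightarrow> L \<omega> < real (Suc j) / real (Suc n) \<and> \<not> L \<omega> < real j / real (Suc n)"
          by (simp add: field_simps not_less del: of_nat_Suc) (auto simp: algebra_simps)
        finally show ?thesis .
      qed
      then show ?thesis by (auto simp: A_def)
    qed
    then show ?thesis using L(2) by auto
  qed
  have km: "k n \<in> M \<rightarrow>\<^sub>M count_space UNIV" for n
  proof (rule measurable_count_space_eq_countable[THEN iffD2])
    show "k n \<in> space M \<rightarrow> UNIV \<and> (\<forall>j\<in>UNIV. k n -` {j} \<inter> space M \<in> events)"
    proof (intro conjI ballI)
      fix j show "k n -` {j} \<inter> space M \<in> events"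
        using FM[OF AF[of n j]] by (simp add: A_def vimage_def Int_def conj_commute)
    qed auto
  qed auto
  define L' where "L' n \<omega> = \<tau> n (k n \<omega>)" for n \<omega>
  have Xm: "(\<lambda>\<omega>. X (L' n \<omega>) \<omega>) \<in> borel_measurable M" for n
    unfolding L'_def by (rule measurable_compose_countable[OF X(1)[OF \<tau>0] km])
  have hm: "(\<lambda>\<omega>. expectation (X (L' n \<omega>))) \<in> borel_measurable M" for n
    unfolding L'_def by (rule measurable_compose_countable[OF _ km]) simp
  have L'0: "0 \<le> L' n \<omega>" for n \<omega> by (simp add: L'_def \<tau>0)
  have L'lim: "(\<lambda>n. L' n \<omega>) \<longlonglongrightarrow> L \<omega>" if "\<omega> \<in> space M" for \<omega>
  proof (rule tendsto_sandwich[OF always_eventually always_eventually tendsto_const])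
    have fl: "real (k n \<omega>) = of_int \<lfloor>real (Suc n) * L \<omega>\<rfloor>" for n
      using L(1)[OF that] by (simp add: k_def)
    have "real (Suc n) * L \<omega> \<le> real (Suc (k n \<omega>))" "real (Suc (k n \<omega>)) \<le> real (Suc n) * L \<omega> + 1" for n
      using fl[of n] of_int_floor_le[of "real (Suc n) * L \<omega>"] real_of_int_floor_add_one_ge[of "real (Suc n) * L \<omega>"]
      unfolding of_nat_Suc[of "k n \<omega>" for n] by linarith+
    then have b: "L \<omega> \<le> L' n \<omega>" "L' n \<omega> \<le> L \<omega> + 1 / real (Suc n)" for n
      unfolding L'_def \<tau>_def by (simp_all add: field_simps del: of_nat_Suc)
    show "\<forall>n. L \<omega> \<le> L' n \<omega>" "\<forall>n. L' n \<omega> \<le> L \<omega> + 1 / real (Suc n)" using b by auto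
    show "(\<lambda>n. L \<omega> + 1 / real (Suc n)) \<longlonglongrightarrow> L \<omega>"
      using tendsto_add[OF tendsto_const LIMSEQ_Suc[OF lim_1_over_n]] by fastforce
  qed
  have Xlim: "(\<lambda>n. X (L' n \<omega>) \<omega>') \<longlonglongrightarrow> X (L \<omega>) \<omega>'" if "\<omega> \<in> space M" "\<omega>' \<in> space M" for \<omega> \<omega>'
    by (rule continuous_on_tendsto_compose[OF X(4)[OF that(2)] L'lim[OF that(1)]])
       (use L(1)[OF that(1)] L'0 in auto)
  have Xint: "integrable M (X s)" if "0 \<le> s" for s
    using X(1,3)[OF that] by (intro integrable_const_bound[where B = B] AE_I2) auto
  have Ebound: "cmod (expectation (X s)) \<le> B" if "0 \<le> s" for s
  proof -
    have "cmod (expectation (X s)) \<le> expectation (\<lambda>\<omega>. cmod (X s \<omega>))" by (rule integral_norm_bound)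
    also have "\<dots> \<le> expectation (\<lambda>\<omega>. B)" using Xint[OF that] X(3)[OF that] by (intro integral_mono) auto
    finally show ?thesis by (simp add: prob_space)
  qed
  show meas: "(\<lambda>\<omega>. X (L \<omega>) \<omega>) \<in> borel_measurable M"
    by (rule borel_measurable_LIMSEQ_metric[where f = "\<lambda>n \<omega>. X (L' n \<omega>) \<omega>"]) (use Xm Xlim in auto)
  have Elim: "(\<lambda>n. expectation (X (L' n \<omega>))) \<longlonglongrightarrow> expectation (X (L \<omega>))" if "\<omega> \<in> space M" for \<omega>
    by (rule integral_dominated_convergence[where w = "\<lambda>_. B"])
       (use X L'0 L(1)[OF that] Xlim[OF that] in \<open>auto intro!: AE_I2\<close>)
  have Em: "(\<lambda>\<omega>. expectation (X (L \<omega>))) \<in> borel_measurable M"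
    by (rule borel_measurable_LIMSEQ_metric[where f = "\<lambda>n \<omega>. expectation (X (L' n \<omega>))"]) (use hm Elim in auto)
  have lim1: "(\<lambda>n. expectation (\<lambda>\<omega>. X (L' n \<omega>) \<omega>)) \<longlonglongrightarrow> expectation (\<lambda>\<omega>. X (L \<omega>) \<omega>)"
    by (rule integral_dominated_convergence[where w = "\<lambda>_. B"])
       (use meas Xm X(3) L'0 Xlim in \<open>auto intro!: AE_I2\<close>)
  have lim2: "(\<lambda>n. expectation (\<lambda>\<omega>. expectation (X (L' n \<omega>)))) \<longlonglongrightarrow> expectation (\<lambda>\<omega>. expectation (X (L \<omega>)))"
    by (rule integral_dominated_convergence[where w = "\<lambda>_. B"])
       (use Em hm Ebound L'0 Elim in \<open>auto intro!: AE_I2\<close>)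
  have disc: "expectation (\<lambda>\<omega>. X (L' n \<omega>) \<omega>) = expectation (\<lambda>\<omega>. expectation (X (L' n \<omega>)))" for n
  proof -
    have UA: "(\<Union>j. A n j) = space M" by (auto simp: A_def)
    have split: "expectation Z = (\<Sum>j. (LINT \<omega>:A n j|M. Z \<omega>))"
      if "Z \<in> borel_measurable M" "\<And>\<omega>. \<omega> \<in> space M \<Longrightarrow> cmod (Z \<omega>) \<le> B" for Z :: "'a \<Rightarrow> complex"
    proof -
      have Zi: "integrable M Z" using that by (intro integrable_const_bound[where B = B] AE_I2) auto
      have "(LINT \<omega>:(\<Union>j. A n j)|M. Z \<omega>) = (\<Sum>j. (LINT \<omega>:A n j|M. Z \<omega>))"
      proof (rule lebesgue_integral_countable_add)
        show "set_integrable M (\<Union>j. A n j) Z"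
          unfolding UA set_integrable_def using Zi
          by (rule Bochner_Integration.integrable_cong[THEN iffD1, rotated -1]) auto
      qed (use FM[OF AF] in \<open>auto simp: A_def\<close>)
      moreover have "(LINT \<omega>:space M|M. Z \<omega>) = expectation Z"
        unfolding set_lebesgue_integral_def by (intro Bochner_Integration.integral_cong) auto
      ultimately show ?thesis unfolding UA by simp
    qed
    have "(LINT \<omega>:A n j|M. X (L' n \<omega>) \<omega>) = (LINT \<omega>:A n j|M. expectation (X (L' n \<omega>)))" for j
    proof -
      have "(LINT \<omega>:A n j|M. X (L' n \<omega>) \<omega>) = (LINT \<omega>:A n j|M. X (\<tau> n j) \<omega>)"
        unfolding set_lebesgue_integral_def
        by (intro Bochner_Integration.integral_cong) (auto simp: A_def L'_def indicator_def)
      also have "\<dots> = of_real (prob (A n j)) * expectation (X (\<tau> n j))"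
        by (rule independent_events_integral[OF ind F AF X(1)[OF \<tau>0] X(2)[OF \<tau>0] Xint[OF \<tau>0]])
      also have "\<dots> = (LINT \<omega>:A n j|M. expectation (X (\<tau> n j)))"
        unfolding set_lebesgue_integral_def
        using FM[OF AF[of n j]] sets.sets_into_space[OF FM[OF AF[of n j]]]
        by (simp add: scaleR_conv_of_real Int_absorb2)
      also have "\<dots> = (LINT \<omega>:A n j|M. expectation (X (L' n \<omega>)))"
        unfolding set_lebesgue_integral_def
        by (intro Bochner_Integration.integral_cong) (auto simp: A_def L'_def indicator_def)
      finally show ?thesis .
    qed
    then show ?thesis
      using split[OF Xm[of n]] split[OF hm[of n]] X(3) L'0 Ebound by simp
  qed
  show "expectation (\<lambda>\<omega>. X (L \<omega>) \<omega>) = expectation (\<lambda>\<omega>. expectation (X (L \<omega>)))"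
    using LIMSEQ_unique[OF lim1[unfolded disc] lim2] .
qed

section \<open>The Laplace exponent\<close>

locale levy =
  fixes \<nu> :: "real measure"
  assumes levy: "levy_measure \<nu>"
begin

abbreviation \<Phi> :: "real \<Rightarrow> real" where "\<Phi> \<equiv> laplace_exponent \<nu>"

lemma sets_\<nu>: "sets \<nu> = sets borel"
  and \<nu>_nonpos: "emeasure \<nu> {..0} = 0"
  and \<nu>_finite: "(\<integral>\<^sup>+ t. ennreal (min 1 t) \<partial>\<nu>) < \<infinity>"
  and \<nu>_infinite: "emeasure \<nu> {0<..} = \<infinity>"
  using levy by (auto simp: levy_measure_def)

lemma AE_pos: "AE t in \<nu>. 0 < t"
  by (rule AE_I[where N = "{..0}"]) (auto simp: \<nu>_nonpos sets_\<nu>)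

lemma measurable_\<nu>: "f \<in> borel_measurable borel \<Longrightarrow> f \<in> borel_measurable \<nu>"
  using sets_\<nu> by (simp cong: measurable_cong_sets)

lemma integrable_exponent:
  assumes "0 \<le> z"
  shows "integrable \<nu> (\<lambda>t. 1 - exp (- z * t))"
proof (rule Bochner_Integration.integrable_bound)
  have "integrable \<nu> (\<lambda>t. min 1 t)"
  proof (rule integrableI_nonneg)
    show "AE t in \<nu>. 0 \<le> min 1 t" using AE_pos by eventually_elim simp
  qed (auto intro: measurable_\<nu> simp: \<nu>_finite[simplified])
  then show "integrable \<nu> (\<lambda>t. (1 + z) * min 1 t)" by simp
  show "(\<lambda>t. 1 - exp (- z * t)) \<in> borel_measurable \<nu>" by (rule measurable_\<nu>) measurable
  show "AE t in \<nu>. norm (1 - exp (- z * t)) \<le> norm ((1 + z) * min 1 t)"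
    using AE_pos
  proof eventually_elim
    case (elim t)
    have "0 \<le> 1 - exp (- z * t)" using assms elim by simp
    moreover have "1 - exp (- z * t) \<le> (1 + z) * min 1 t"
    proof (cases "t \<le> 1")
      case True
      have "1 - exp (- z * t) \<le> z * t" using exp_ge_add_one_self[of "- z * t"] by simp
      then show ?thesis using True elim by (simp add: min_def algebra_simps)
    next
      case False
      have "1 - exp (- z * t) \<le> 1" by simp
      also have "1 \<le> (1 + z) * min 1 t" using False assms by simp
      finally show ?thesis .
    qed
    ultimately show ?case by simp
  qed
qed

lemma exponent_nonneg: "0 \<le> z \<Longrightarrow> 0 \<le> \<Phi> z"
  unfolding laplace_exponent_def
  by (rule integral_nonneg_AE) (use AE_pos in eventually_elim, simp)

text \<open>By Fatou's lemma a bound \<open>B\<close> would also bound the total mass of the Levy measure.\<close>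
lemma exponent_unbounded: "\<exists>n::nat. B \<le> \<Phi> (real n)"
proof (rule ccontr)
  assume "\<not> ?thesis"
  then have B: "\<Phi> (real n) \<le> B" for n :: nat by (metis linear)
  have eq: "(\<integral>\<^sup>+ t. ennreal (1 - exp (- real n * t)) \<partial>\<nu>) = ennreal (\<Phi> (real n))" for n :: nat
    unfolding laplace_exponent_def
    by (rule nn_integral_eq_integral[OF integrable_exponent]) (simp, use AE_pos in eventually_elim, simp)
  have "emeasure \<nu> {0<..} = (\<integral>\<^sup>+ t. indicator {0<..} t \<partial>\<nu>)" by (simp add: sets_\<nu>)
  also have "\<dots> \<le> (\<integral>\<^sup>+ t. liminf (\<lambda>n. ennreal (1 - exp (- real n * t))) \<partial>\<nu>)"
  proof (rule nn_integral_mono)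
    fix t
    show "indicator {0<..} t \<le> liminf (\<lambda>n. ennreal (1 - exp (- real n * t)))"
    proof (cases "0 < t")
      case True
      have "(\<lambda>n. exp (- t) ^ n) \<longlonglongrightarrow> 0" using True by (intro LIMSEQ_realpow_zero) auto
      then have "(\<lambda>n. exp (- real n * t)) \<longlonglongrightarrow> 0" by (simp add: exp_of_nat_mult[symmetric])
      then have "(\<lambda>n. 1 - exp (- real n * t)) \<longlonglongrightarrow> 1 - 0" by (intro tendsto_intros)
      then have "(\<lambda>n. ennreal (1 - exp (- real n * t))) \<longlonglongrightarrow> ennreal 1" by (intro tendsto_ennrealI) simp
      then have "liminf (\<lambda>n. ennreal (1 - exp (- real n * t))) = ennreal 1" by (intro lim_imp_Liminf) auto
      then show ?thesis using True by simp
    qed simp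
  qed
  also have "\<dots> \<le> liminf (\<lambda>n. \<integral>\<^sup>+ t. ennreal (1 - exp (- real n * t)) \<partial>\<nu>)"
    by (rule nn_integral_liminf) (auto intro: measurable_\<nu>)
  also have "\<dots> \<le> liminf (\<lambda>n::nat. ennreal B)"
    unfolding eq by (intro Liminf_mono always_eventually allI ennreal_leI B)
  also have "\<dots> = ennreal B" by (simp add: Liminf_const)
  finally show False by (simp add: \<nu>_infinite top_unique)
qed

end

section \<open>Paths of the inverse subordinator\<close>

text \<open>The properties of almost every path of a subordinator with infinite Levy measure on which the continuity
  of the inverse rests. Strict monotonicity on the rationals is enough, and involves only countably
  many events.\<close>
definition climbing_path :: "(real \<Rightarrow> real) \<Rightarrow> bool" where
  "climbing_path s \<longleftrightarrow> mono_on {0..} s \<and> (\<forall>n::nat. \<exists>k::nat. real n < s (real k))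
     \<and> (\<forall>p\<in>\<rat>. \<forall>q\<in>\<rat>. 0 \<le> p \<and> p < q \<longrightarrow> s p < s q)"

lemma inverse_subordinator_nonneg: "0 \<le> inverse_subordinator S t \<omega>"
  unfolding inverse_subordinator_def by (auto intro!: cInf_greatest)

text \<open>The second alternative describes the paths bounded by \<open>t\<close>, on which the inverse is set to \<open>0\<close>. Only rational
  times enter, which makes the event measurable.\<close>
lemma inverse_subordinator_less_iff:
  assumes mono: "mono_on {0..} (\<lambda>r. S r \<omega>)" and r: "0 < r"
  shows "inverse_subordinator S t \<omega> < r
    \<longleftrightarrow> (\<exists>q\<in>\<rat>. 0 < q \<and> q < r \<and> t < S q \<omega>) \<or> (\<forall>q\<in>\<rat>. 0 < q \<longrightarrow> S q \<omega> \<le> t)"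
proof (cases "\<exists>s>0. t < S s \<omega>")
  case True
  have bdd: "bdd_below {s. 0 < s \<and> t < S s \<omega>}" by (rule bdd_belowI[of _ 0]) auto
  have "inverse_subordinator S t \<omega> = Inf {s. 0 < s \<and> t < S s \<omega>}"
    using True by (simp add: inverse_subordinator_def)
  moreover have "Inf {s. 0 < s \<and> t < S s \<omega>} < r \<longleftrightarrow> (\<exists>s\<in>{s. 0 < s \<and> t < S s \<omega>}. s < r)"
    by (rule cInf_less_iff) (use True bdd in auto)
  ultimately have "inverse_subordinator S t \<omega> < r \<longleftrightarrow> (\<exists>s. 0 < s \<and> s < r \<and> t < S s \<omega>)"
    by auto
  also have "\<dots> \<longleftrightarrow> (\<exists>q\<in>\<rat>. 0 < q \<and> q < r \<and> t < S q \<omega>)"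
  proof safe
    fix s assume s: "0 < s" "s < r" "t < S s \<omega>"
    obtain q where q: "q \<in> \<rat>" "s < q" "q < r" using Rats_dense_in_real[OF s(2)] by blast
    have "S s \<omega> \<le> S q \<omega>" using mono_onD[OF mono, of s q] s q by auto
    then show "\<exists>q\<in>\<rat>. 0 < q \<and> q < r \<and> t < S q \<omega>" using s q by (intro bexI[of _ q]) auto
  qed auto
  also have "\<dots> \<longleftrightarrow> (\<exists>q\<in>\<rat>. 0 < q \<and> q < r \<and> t < S q \<omega>) \<or> (\<forall>q\<in>\<rat>. 0 < q \<longrightarrow> S q \<omega> \<le> t)"
  proof -
    obtain s where s: "0 < s" "t < S s \<omega>" using True by blast
    obtain q where q: "q \<in> \<rat>" "s < q" using Rats_dense_in_real[of s "s + 1"] by auto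
    have "S s \<omega> \<le> S q \<omega>" using mono_onD[OF mono, of s q] s q by auto
    then have "\<not> (\<forall>q\<in>\<rat>. 0 < q \<longrightarrow> S q \<omega> \<le> t)" using s q by (auto simp: not_le intro!: bexI[of _ q])
    then show ?thesis by blast
  qed
  finally show ?thesis .
next
  case False
  then have "inverse_subordinator S t \<omega> = 0" by (auto simp: inverse_subordinator_def)
  moreover have "\<forall>q\<in>\<rat>. 0 < q \<longrightarrow> S q \<omega> \<le> t" using False not_le_imp_less by blast
  ultimately show ?thesis using r by simp
qed

lemma climbing_path_exceeds:
  assumes "climbing_path (\<lambda>r. S r \<omega>)"
  obtains s where "0 < s" "t < S s \<omega>"
proof -
  obtain n :: nat where n: "t < real n" using reals_Archimedean2 by blast
  obtain k :: nat where k: "real n < S (real k) \<omega>" using assms unfolding climbing_path_def by blast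
  have "S (real k) \<omega> \<le> S (real k + 1) \<omega>"
    using assms mono_onD[of "{0..}" "\<lambda>r. S r \<omega>" "real k" "real k + 1"] by (auto simp: climbing_path_def)
  then show thesis using that[of "real k + 1"] n k by auto
qed

lemma inverse_subordinator_less_iff':
  assumes cl: "climbing_path (\<lambda>r. S r \<omega>)"
  shows "inverse_subordinator S t \<omega> < r \<longleftrightarrow> (\<exists>s. 0 < s \<and> s < r \<and> t < S s \<omega>)"
proof -
  have bdd: "bdd_below {s. 0 < s \<and> t < S s \<omega>}" by (rule bdd_belowI[of _ 0]) auto
  obtain s where s: "0 < s" "t < S s \<omega>" by (rule climbing_path_exceeds[where S = S and \<omega> = \<omega> and t = t, OF cl])
  then have "inverse_subordinator S t \<omega> = Inf {s. 0 < s \<and> t < S s \<omega>}"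
    by (auto simp: inverse_subordinator_def)
  moreover have "{s. 0 < s \<and> t < S s \<omega>} \<noteq> {}" using s by auto
  ultimately show ?thesis using bdd by (auto simp: cInf_less_iff)
qed

text \<open>A jump of the inverse at \<open>t\<close> would be an interval of times on which the path stays at level \<open>t\<close>.
  The limit at \<open>t\<close> from above needs no more than the definition of the infimum.\<close>
lemma inverse_subordinator_continuous:
  assumes cl: "climbing_path (\<lambda>r. S r \<omega>)"
  shows "((\<lambda>r. inverse_subordinator S r \<omega>) \<longlongrightarrow> inverse_subordinator S t \<omega>) (at t)"
proof (rule order_tendstoI)
  note mono = mono_onD[of "{0..}" "\<lambda>r. S r \<omega>"]
  have mono: "S p \<omega> \<le> S q \<omega>" if "0 \<le> p" "p \<le> q" for p q
    using cl that by (auto simp: climbing_path_def intro: mono)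
  let ?L = "\<lambda>r. inverse_subordinator S r \<omega>"
  fix a assume a: "a < ?L t"
  show "\<forall>\<^sub>F r in at t. a < ?L r"
  proof (cases "a < 0")
    case True
    then show ?thesis using inverse_subordinator_nonneg[of S _ \<omega>] by (auto intro!: always_eventually less_le_trans[OF True])
  next
    case False
    obtain p where p: "p \<in> \<rat>" "a < p" "p < ?L t" using Rats_dense_in_real[OF a] by blast
    obtain q where q: "q \<in> \<rat>" "p < q" "q < ?L t" using Rats_dense_in_real[OF p(3)] by blast
    have "0 < p" using False p by simp
    have "\<not> t < S q \<omega>"
    proof
      assume "t < S q \<omega>"
      then have "?L t < (q + ?L t) / 2" unfolding inverse_subordinator_less_iff'[where S = S and \<omega> = \<omega>, OF cl]
        using q \<open>0 < p\<close> by (intro exI[of _ q]) auto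
      then show False using q by simp
    qed
    moreover have "S p \<omega> < S q \<omega>" using cl p q \<open>0 < p\<close> by (auto simp: climbing_path_def)
    ultimately have "S p \<omega> < t" by simp
    have "a < ?L r" if "S p \<omega> < r" for r
    proof -
      have "\<not> ?L r < p"
        unfolding inverse_subordinator_less_iff'[where S = S and \<omega> = \<omega>, OF cl]
        using mono that by (metis less_eq_real_def not_less order_less_le_trans)
      then show ?thesis using p by simp
    qed
    then show ?thesis
      using \<open>S p \<omega> < t\<close> by (intro eventually_mono[OF order_tendstoD(1)[OF tendsto_ident_at]]) auto
  qed
next
  let ?L = "\<lambda>r. inverse_subordinator S r \<omega>"
  fix a assume "?L t < a"
  then obtain s where s: "0 < s" "s < a" "t < S s \<omega>"
    unfolding inverse_subordinator_less_iff'[where S = S and \<omega> = \<omega>, OF cl] by blast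
  have "?L r < a" if "r < S s \<omega>" for r
    unfolding inverse_subordinator_less_iff'[where S = S and \<omega> = \<omega>, OF cl] using s that by blast
  then show "\<forall>\<^sub>F r in at t. ?L r < a"
    using s(3) by (intro eventually_mono[OF order_tendstoD(2)[OF tendsto_ident_at]]) auto
qed

section \<open>The law of the inverse subordinator\<close>

locale levy_subordinator = levy \<nu> + prob_space Q
  for \<nu> :: "real measure" and Q :: "'w measure" +
  fixes S :: "real \<Rightarrow> 'w \<Rightarrow> real"
  assumes subordinator: "subordinator \<nu> Q S"
begin

lemma S_measurable: "0 \<le> t \<Longrightarrow> S t \<in> borel_measurable Q"
  and S_start: "\<omega> \<in> space Q \<Longrightarrow> S 0 \<omega> = 0"
  and S_stationary: "\<lbrakk>0 \<le> s; 0 \<le> t\<rbrakk> \<Longrightarrow> distr Q borel (\<lambda>\<omega>. S (s + t) \<omega> - S s \<omega>) = distr Q borel (S t)"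
  and S_mono: "\<omega> \<in> space Q \<Longrightarrow> mono_on {0..} (\<lambda>t. S t \<omega>)"
  and S_laplace: "\<lbrakk>0 \<le> t; 0 \<le> z\<rbrakk> \<Longrightarrow> expectation (\<lambda>\<omega>. exp (- z * S t \<omega>)) = exp (- t * \<Phi> z)"
  using subordinator unfolding subordinator_def levy_process_def by blast+

lemma S_nonneg: "\<omega> \<in> space Q \<Longrightarrow> 0 \<le> t \<Longrightarrow> 0 \<le> S t \<omega>"
  using mono_onD[OF S_mono, of \<omega> 0 t] S_start[of \<omega>] by auto

lemma integrable_exp_S: "0 \<le> t \<Longrightarrow> 0 \<le> z \<Longrightarrow> integrable Q (\<lambda>\<omega>. exp (- z * S t \<omega>))"
  using S_measurable[of t] S_nonneg[of _ t]
  by (intro integrable_const_bound[where B = 1] AE_I2) (auto simp: zero_le_mult_iff)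

lemma integrable_indicator: "A \<in> events \<Longrightarrow> integrable Q (indicat_real A)"
  by (rule integrable_const_bound[where B = 1]) (auto simp: indicator_def)

lemma S_set_measurable:
  "0 \<le> r \<Longrightarrow> {\<omega> \<in> space Q. t < S r \<omega>} \<in> events" "0 \<le> r \<Longrightarrow> {\<omega> \<in> space Q. S r \<omega> \<le> t} \<in> events"
  using S_measurable[of r] by measurable

text \<open>Chernoff's bound. Letting \<open>z\<close> grow it shows that the subordinator leaves \<open>0\<close> at once, and letting \<open>r\<close>
  grow that it is unbounded.\<close>
lemma prob_S_le:
  assumes "0 \<le> r" "0 \<le> z"
  shows "prob {\<omega> \<in> space Q. S r \<omega> \<le> t} \<le> exp (z * t - r * \<Phi> z)"
proof -
  have "prob {\<omega> \<in> space Q. S r \<omega> \<le> t} = expectation (indicator {\<omega> \<in> space Q. S r \<omega> \<le> t})"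
    using S_set_measurable(2)[OF assms(1)] by (simp add: Int_def conj_commute)
  also have "\<dots> \<le> expectation (\<lambda>\<omega>. exp (z * t) * exp (- z * S r \<omega>))"
  proof (rule integral_mono)
    show "indicator {\<omega> \<in> space Q. S r \<omega> \<le> t} \<omega> \<le> exp (z * t) * exp (- z * S r \<omega>)" for \<omega>
      using assms(2) by (auto simp: indicator_def mult_left_mono simp flip: exp_add)
  qed (use integrable_indicator[OF S_set_measurable(2)[OF assms(1)]] integrable_exp_S[OF assms] in auto)
  also have "\<dots> = exp (z * t - r * \<Phi> z)" 
    by (simp only: integral_mult_right_zero S_laplace[OF assms]) (simp flip: exp_add)
  finally show ?thesis .
qed

lemma prob_S_nonpos:
  assumes "0 < h"
  shows "prob {\<omega> \<in> space Q. S h \<omega> \<le> 0} = 0"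
proof -
  have "prob {\<omega> \<in> space Q. S h \<omega> \<le> 0} \<le> exp (- b)" for b
  proof -
    obtain n :: nat where n: "b / h \<le> \<Phi> (real n)" using exponent_unbounded by blast
    have "b \<le> h * \<Phi> (real n)" using n assms by (simp add: field_simps)
    then show ?thesis using prob_S_le[of h "real n" 0] assms by simp (meson exp_le_cancel_iff le_minus_iff minus_le_iff neg_le_iff_le order_trans)
  qed
  then have "prob {\<omega> \<in> space Q. S h \<omega> \<le> 0} \<le> exp (- real n)" for n .
  moreover have "(\<lambda>n. exp (- real n)) \<longlonglongrightarrow> 0" by real_asymp
  ultimately have "prob {\<omega> \<in> space Q. S h \<omega> \<le> 0} \<le> 0" by (intro LIMSEQ_le_const) auto
  then show ?thesis by (simp add: measure_le_0_iff)
qed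

text \<open>An increment over \<open>[p, q]\<close> has the law of \<open>S (q - p)\<close>, which almost surely does not vanish.\<close>
lemma AE_climbing_path: "AE \<omega> in Q. climbing_path (\<lambda>r. S r \<omega>)"
proof -
  have strict: "AE \<omega> in Q. S p \<omega> < S q \<omega>" if "0 \<le> p" "p < q" for p q
  proof -
    have m: "(\<lambda>\<omega>. S q \<omega> - S p \<omega>) \<in> borel_measurable Q" using that S_measurable by auto
    have "prob {\<omega> \<in> space Q. S q \<omega> - S p \<omega> \<le> 0} = measure (distr Q borel (\<lambda>\<omega>. S q \<omega> - S p \<omega>)) {..0}"
      using m by (simp add: measure_distr vimage_def Int_def conj_commute)
    also have "distr Q borel (\<lambda>\<omega>. S q \<omega> - S p \<omega>) = distr Q borel (S (q - p))"
      using S_stationary[of p "q - p"] that by simp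
    also have "measure \<dots> {..0} = prob {\<omega> \<in> space Q. S (q - p) \<omega> \<le> 0}"
      using S_measurable[of "q - p"] that by (simp add: measure_distr vimage_def Int_def conj_commute)
    also have "\<dots> = 0" using prob_S_nonpos that by simp
    finally have "prob {\<omega> \<in> space Q. S q \<omega> - S p \<omega> \<le> 0} = 0" .
    moreover have "{\<omega> \<in> space Q. S q \<omega> - S p \<omega> \<le> 0} \<in> events" using m by measurable
    ultimately have "AE \<omega> in Q. \<omega> \<notin> {\<omega> \<in> space Q. S q \<omega> - S p \<omega> \<le> 0}" by (simp only: prob_eq_0)
    then show ?thesis using AE_space by eventually_elim auto
  qed
  have "AE \<omega> in Q. \<forall>p\<in>\<rat>. \<forall>q\<in>\<rat>. 0 \<le> p \<and> p < q \<longrightarrow> S p \<omega> < S q \<omega>"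
    by (intro AE_ball_countable' countable_rat) (use strict in auto)
  moreover have "AE \<omega> in Q. \<forall>n::nat. \<exists>k::nat. real n < S (real k) \<omega>"
  proof (subst AE_all_countable, intro allI)
    fix n :: nat
    obtain z :: nat where z: "1 \<le> \<Phi> (real z)" using exponent_unbounded by blast
    let ?A = "{\<omega> \<in> space Q. \<forall>k::nat. S (real k) \<omega> \<le> real n}"
    have A: "?A \<in> events" using S_measurable by measurable
    have "prob ?A \<le> exp (real z * real n - real k)" for k :: nat
    proof -
      have "prob ?A \<le> prob {\<omega> \<in> space Q. S (real k) \<omega> \<le> real n}"
        using S_set_measurable(2) by (intro finite_measure_mono) auto
      also have "\<dots> \<le> exp (real z * real n - real k * \<Phi> (real z))" by (rule prob_S_le) auto
      also have "\<dots> \<le> exp (real z * real n - real k)" using mult_left_mono[OF z, of "real k"] by simp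
      finally show ?thesis .
    qed
    moreover have "(\<lambda>k. exp (real z * real n - real k)) \<longlonglongrightarrow> 0" by real_asymp
    ultimately have "prob ?A \<le> 0" by (intro LIMSEQ_le_const) auto
    then have "AE \<omega> in Q. \<omega> \<notin> ?A" using A by (simp add: measure_le_0_iff prob_eq_0)
    then show "AE \<omega> in Q. \<exists>k::nat. real n < S (real k) \<omega>"
      using AE_space by eventually_elim (auto simp: not_le)
  qed
  ultimately show ?thesis
    using AE_space by eventually_elim (auto simp: climbing_path_def S_mono)
qed

abbreviation "L \<equiv> inverse_subordinator S"

lemma L_less_event: "{\<omega> \<in> space Q. L t \<omega> < r} \<in> process_events Q {0..} S"
proof (cases "0 < r")
  case False
  then have "\<not> L t \<omega> < r" for \<omega> using inverse_subordinator_nonneg[of S t \<omega>] by linarith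
  then have "{\<omega> \<in> space Q. L t \<omega> < r} = {}" by auto
  then show ?thesis by (simp only: process_events_closed)
next
  case True
  interpret E: sigma_algebra "space Q" "process_events Q {0..} S" by (rule process_events_sigma_algebra)
  have gt: "{\<omega> \<in> space Q. t < S q \<omega>} \<in> process_events Q {0..} S" if "0 < q" for q
    using process_events_basic[of q "{0..}" "{t<..}" S Q] that by (simp add: vimage_def Int_def conj_commute)
  have le: "{\<omega> \<in> space Q. S q \<omega> \<le> t} \<in> process_events Q {0..} S" if "0 < q" for q
    using process_events_basic[of q "{0..}" "{..t}" S Q] that by (simp add: vimage_def Int_def conj_commute)
  have "{\<omega> \<in> space Q. L t \<omega> < r} = (\<Union>q\<in>\<rat> \<inter> {0<..<r}. {\<omega> \<in> space Q. t < S q \<omega>})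
      \<union> (\<Inter>q\<in>\<rat> \<inter> {0<..}. {\<omega> \<in> space Q. S q \<omega> \<le> t})"
    (is "_ = ?R")
  proof (rule set_eqI)
    fix \<omega>
    have "(1::real) \<in> \<rat> \<inter> {0<..}" by simp
    then have "\<omega> \<in> ?R \<Longrightarrow> \<omega> \<in> space Q" by blast
    then show "\<omega> \<in> {\<omega> \<in> space Q. L t \<omega> < r} \<longleftrightarrow> \<omega> \<in> ?R"
      using inverse_subordinator_less_iff[where S = S and \<omega> = \<omega> and t = t, OF S_mono True]
      by (cases "\<omega> \<in> space Q") auto
  qed
  also have "\<dots> \<in> process_events Q {0..} S"
  proof (rule E.Un)
    show "(\<Union>q\<in>\<rat> \<inter> {0<..<r}. {\<omega> \<in> space Q. t < S q \<omega>}) \<in> process_events Q {0..} S"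
      by (rule E.countable_UN'') (use gt countable_rat in auto)
    show "(\<Inter>q\<in>\<rat> \<inter> {0<..}. {\<omega> \<in> space Q. S q \<omega> \<le> t}) \<in> process_events Q {0..} S"
    proof (rule E.countable_INT')
      have "(1::real) \<in> \<rat> \<inter> {0<..}" by simp
      then show "\<rat> \<inter> {0<..} \<noteq> ({} :: real set)" by blast
    qed (use le countable_rat in auto)
  qed
  finally show ?thesis .
qed

lemma process_events_S: "process_events Q {0..} S \<subseteq> events"
  unfolding process_events_def
  by (rule sets.sigma_sets_subset) (auto intro: measurable_sets[OF S_measurable])

lemma L_less_measurable: "{\<omega> \<in> space Q. L t \<omega> < r} \<in> events"
  using L_less_event process_events_S by blast

lemma L_measurable [measurable]: "L t \<in> borel_measurable Q"
  by (rule borel_measurable_iff_less[THEN iffD2]) (use L_less_measurable in auto)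

lemma AE_L_less_iff: "AE \<omega> in Q. \<forall>r. L t \<omega> < r \<longleftrightarrow> (\<exists>s. 0 < s \<and> s < r \<and> t < S s \<omega>)"
  using AE_climbing_path by eventually_elim (rule allI, rule inverse_subordinator_less_iff')

text \<open>If the inverse at \<open>t\<close> is below \<open>r\<close> then \<open>S r > t\<close>, and the probability of this is bounded by Markov's
  inequality for \<open>1 - exp (- S r / t)\<close>, whose mean is \<open>1 - exp (- r \<Phi>(1 / t))\<close>.\<close>
lemma prob_L_less_le:
  assumes "0 < t" "0 \<le> r"
  shows "prob {\<omega> \<in> space Q. L t \<omega> < r} \<le> r * \<Phi> (1 / t) / (1 - exp (-1))"
proof -
  have "prob {\<omega> \<in> space Q. L t \<omega> < r} \<le> prob {\<omega> \<in> space Q. t < S r \<omega>}"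
  proof (rule finite_measure_mono_AE)
    show "AE \<omega> in Q. \<omega> \<in> {\<omega> \<in> space Q. L t \<omega> < r} \<longrightarrow> \<omega> \<in> {\<omega> \<in> space Q. t < S r \<omega>}"
      using AE_L_less_iff[of t] AE_space
    proof eventually_elim
      case (elim \<omega>)
      have "t < S r \<omega>" if lt: "L t \<omega> < r"
      proof -
        obtain s where s: "0 < s" "s < r" "t < S s \<omega>" using lt elim(1)[rule_format, of r] by blast
        then show ?thesis using mono_onD[OF S_mono[OF elim(2)], of s r] by auto
      qed
      then show ?case using elim(2) by auto
    qed
  qed (rule S_set_measurable(1)[OF assms(2)])
  also have "\<dots> = expectation (indicator {\<omega> \<in> space Q. t < S r \<omega>})"
    using S_set_measurable(1)[OF assms(2)] by (simp add: Int_def conj_commute)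
  also have "\<dots> \<le> expectation (\<lambda>\<omega>. (1 - exp (- (1 / t) * S r \<omega>)) / (1 - exp (-1)))"
  proof (rule integral_mono)
    fix \<omega> assume w: "\<omega> \<in> space Q"
    have "0 \<le> S r \<omega>" using S_nonneg[OF w assms(2)] .
    moreover have "exp (- (1 / t) * S r \<omega>) \<le> exp (-1)" if "t < S r \<omega>"
      using that assms(1) by (simp add: field_simps)
    ultimately show "indicator {\<omega> \<in> space Q. t < S r \<omega>} \<omega> \<le> (1 - exp (- (1 / t) * S r \<omega>)) / (1 - exp (-1))"
      using assms(1) by (auto simp: indicator_def field_simps)
  qed (use integrable_indicator[OF S_set_measurable(1)[OF assms(2)]] integrable_exp_S[of r "1 / t"] assms in auto)
  also have "\<dots> = (1 - exp (- r * \<Phi> (1 / t))) / (1 - exp (-1))"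
    using integrable_exp_S[of r "1 / t"] S_laplace[of r "1 / t"] assms by (simp add: prob_space)
  also have "\<dots> \<le> r * \<Phi> (1 / t) / (1 - exp (-1))"
    using exp_ge_add_one_self[of "- r * \<Phi> (1 / t)"] by (intro divide_right_mono) auto
  finally show ?thesis .
qed

lemma integrable_exp_L:
  assumes "Re z \<le> 0"
  shows "integrable Q (\<lambda>\<omega>. exp (z * of_real (L t \<omega>)))"
  using assms inverse_subordinator_nonneg[of S t]
  by (intro integrable_const_bound[where B = 1] AE_I2) (auto simp: mult_nonpos_nonneg)

text \<open>The mean of \<open>exp (- a L)\<close> is \<open>O(1 / a)\<close>, since \<open>L\<close> falls below \<open>(k + 1) / a\<close> with probability \<open>O((k + 1) / a)\<close>
  and \<open>exp (- a L) \<le> exp (- k)\<close> once \<open>L \<ge> k / a\<close>. The bound at \<open>t\<close> serves all later times,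
  because the inverse increases with time.\<close>
lemma exp_moment_bound:
  assumes "0 < t" "t \<le> r" "0 < a" "Re z = - a"
  shows "cmod (exp_moment_inverse Q S r z) \<le> (\<Sum>k. (real k + 1) * exp (- real k)) * (\<Phi> (1 / t) / (1 - exp (-1))) / a"
proof -
  define c where "c = \<Phi> (1 / t) / (1 - exp (-1))"
  have c: "0 \<le> c" using exponent_nonneg[of "1 / t"] assms(1) by (simp add: c_def)
  have sm: "summable (\<lambda>k. (real k + 1) * exp (- real k))"
  proof -
    have g: "summable (\<lambda>k. 2 * exp (- 1 / 2 :: real) ^ k)"
      by (intro summable_mult summable_geometric) simp
    show ?thesis
    proof (rule summable_comparison_test'[OF g, of 0])
      fix k :: nat
      \<comment> \<open>Half of the exponential decay absorbs the linear factor.\<close>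
      have "real k + 1 \<le> 2 * exp (real k / 2)" using exp_ge_add_one_self[of "real k / 2"] by linarith
      then have "(real k + 1) * exp (- real k) \<le> 2 * exp (real k / 2) * exp (- real k)"
        by (intro mult_right_mono) auto
      also have "\<dots> = 2 * exp (- 1 / 2) ^ k"
        by (simp add: exp_of_nat_mult[symmetric] mult.assoc flip: exp_add)
      finally show "norm ((real k + 1) * exp (- real k)) \<le> 2 * exp (- 1 / 2) ^ k" by simp
    qed
  qed
  have le: "L t \<omega> \<le> L r \<omega>" if cl: "climbing_path (\<lambda>r. S r \<omega>)" for \<omega>
  proof (rule ccontr)
    assume "\<not> L t \<omega> \<le> L r \<omega>"
    then have "L r \<omega> < L t \<omega>" by simp
    then obtain s where "0 < s" "s < L t \<omega>" "r < S s \<omega>"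
      unfolding inverse_subordinator_less_iff'[where S = S and \<omega> = \<omega>, OF cl] by blast
    then have "L t \<omega> < L t \<omega>"
      using assms(2) by (subst inverse_subordinator_less_iff'[where S = S and \<omega> = \<omega>, OF cl]) auto
    then show False by simp
  qed
  have ineq: "exp (- a * y) \<le> (\<Sum>k. exp (- real k) * indicator {..<(real k + 1) / a} y)"
    and sumi: "summable (\<lambda>k. exp (- real k) * indicator {..<(real k + 1) / a} y :: real)" if "0 \<le> y" for y :: real
  proof -
    show s: "summable (\<lambda>k. exp (- real k) * indicator {..<(real k + 1) / a} y :: real)"
      by (rule summable_comparison_test'[OF sm, of 0]) (auto simp: indicator_def)
    define k where "k = nat \<lfloor>a * y\<rfloor>"
    have k: "real k \<le> a * y" "a * y < real k + 1" using that assms(3) by (simp_all add: k_def)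
    have "exp (- a * y) \<le> exp (- real k)" using k by simp
    also have "\<dots> = exp (- real k) * indicator {..<(real k + 1) / a} y"
      using k assms(3) by (auto simp: indicator_def field_simps)
    also have "\<dots> \<le> (\<Sum>k. exp (- real k) * indicator {..<(real k + 1) / a} y)"
    proof -
      define F where "F j = exp (- real j) * indicator {..<(real j + 1) / a} y" for j
      have "summable F" using s by (simp only: F_def[abs_def])
      then have "sum F {k} \<le> suminf F" by (rule sum_le_suminf) (auto simp: F_def)
      then have "F k \<le> suminf F" by simp
      then show ?thesis by (simp only: F_def[abs_def])
    qed
    finally show "exp (- a * y) \<le> (\<Sum>k. exp (- real k) * indicator {..<(real k + 1) / a} y)" .
  qed
  have "cmod (exp_moment_inverse Q S r z) \<le> expectation (\<lambda>\<omega>. cmod (exp (z * of_real (L r \<omega>))))"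
    unfolding exp_moment_inverse_def by (rule integral_norm_bound)
  also have "\<dots> = expectation (\<lambda>\<omega>. exp (- a * L r \<omega>))" using assms(4) by simp
  also have "ennreal \<dots> = (\<integral>\<^sup>+ \<omega>. ennreal (exp (- a * L r \<omega>)) \<partial>Q)"
    by (rule nn_integral_eq_integral[symmetric])
       (use inverse_subordinator_nonneg[of S r] assms(3) in \<open>auto intro!: integrable_const_bound[where B = 1] AE_I2 simp: zero_le_mult_iff\<close>)
  finally have 1: "ennreal (cmod (exp_moment_inverse Q S r z)) \<le> (\<integral>\<^sup>+ \<omega>. ennreal (exp (- a * L r \<omega>)) \<partial>Q)"
    by (simp add: ennreal_leI)
  also have "\<dots> \<le> (\<integral>\<^sup>+ \<omega>. (\<Sum>k. ennreal (exp (- real k)) * indicator {\<omega> \<in> space Q. L t \<omega> < (real k + 1) / a} \<omega>) \<partial>Q)"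
  proof (rule nn_integral_mono_AE)
    show "AE \<omega> in Q. ennreal (exp (- a * L r \<omega>)) \<le> (\<Sum>k. ennreal (exp (- real k)) * indicator {\<omega> \<in> space Q. L t \<omega> < (real k + 1) / a} \<omega>)"
      using AE_climbing_path AE_space
    proof eventually_elim
      case (elim \<omega>)
      have "exp (- a * L r \<omega>) \<le> exp (- a * L t \<omega>)" using le[OF elim(1)] assms(3) by simp
      also have "\<dots> \<le> (\<Sum>k. exp (- real k) * indicator {..<(real k + 1) / a} (L t \<omega>))"
        by (rule ineq[OF inverse_subordinator_nonneg])
      finally have "ennreal (exp (- a * L r \<omega>)) \<le> ennreal (\<Sum>k. exp (- real k) * indicator {..<(real k + 1) / a} (L t \<omega>))"
        by (rule ennreal_leI)
      also have "\<dots> = (\<Sum>k. ennreal (exp (- real k) * indicator {..<(real k + 1) / a} (L t \<omega>)))"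
        by (rule suminf_ennreal2[symmetric]) (use sumi[OF inverse_subordinator_nonneg] in auto)
      also have "\<dots> = (\<Sum>k. ennreal (exp (- real k)) * indicator {\<omega> \<in> space Q. L t \<omega> < (real k + 1) / a} \<omega>)"
        using elim(2) by (intro suminf_cong) (auto simp: indicator_def)
      finally show ?case .
    qed
  qed
  also have "\<dots> = (\<Sum>k. ennreal (exp (- real k)) * ennreal (prob {\<omega> \<in> space Q. L t \<omega> < (real k + 1) / a}))"
    using L_less_measurable by (subst nn_integral_suminf) (auto simp: nn_integral_cmult emeasure_eq_measure)
  also have "\<dots> \<le> (\<Sum>k. ennreal (((real k + 1) * exp (- real k)) * (c / a)))"
  proof (intro suminf_le allI summableI)
    fix k
    have "prob {\<omega> \<in> space Q. L t \<omega> < (real k + 1) / a} \<le> (real k + 1) / a * c"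
      using prob_L_less_le[OF assms(1), of "(real k + 1) / a"] assms(3) by (simp add: c_def)
    then have "exp (- real k) * prob {\<omega> \<in> space Q. L t \<omega> < (real k + 1) / a} \<le> exp (- real k) * ((real k + 1) / a * c)"
      by (intro mult_left_mono) auto
    then have "exp (- real k) * prob {\<omega> \<in> space Q. L t \<omega> < (real k + 1) / a} \<le> ((real k + 1) * exp (- real k)) * (c / a)"
      by (simp add: mult_ac)
    then show "ennreal (exp (- real k)) * ennreal (prob {\<omega> \<in> space Q. L t \<omega> < (real k + 1) / a})
        \<le> ennreal (((real k + 1) * exp (- real k)) * (c / a))"
      by (simp add: ennreal_leI flip: ennreal_mult)
  qed
  also have "\<dots> = ennreal (\<Sum>k. ((real k + 1) * exp (- real k)) * (c / a))"
    using c assms(3) sm by (intro suminf_ennreal2 summable_mult2) auto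
  also have "(\<Sum>k. ((real k + 1) * exp (- real k)) * (c / a)) = (\<Sum>k. (real k + 1) * exp (- real k)) * c / a"
    using suminf_mult2[OF sm, of "c / a"] by simp
  finally have "ennreal (cmod (exp_moment_inverse Q S r z)) \<le> ennreal ((\<Sum>k. (real k + 1) * exp (- real k)) * c / a)" .
  moreover have "0 \<le> (\<Sum>k. (real k + 1) * exp (- real k)) * c / a"
    using c assms(3) sm by (intro divide_nonneg_nonneg mult_nonneg_nonneg suminf_nonneg) auto
  ultimately show ?thesis by (simp add: c_def)
qed

lemma exp_moment_le_1:
  assumes "Re z \<le> 0"
  shows "cmod (exp_moment_inverse Q S t z) \<le> 1"
proof -
  have "cmod (exp_moment_inverse Q S t z) \<le> expectation (\<lambda>\<omega>. cmod (exp (z * of_real (L t \<omega>))))"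
    unfolding exp_moment_inverse_def by (rule integral_norm_bound)
  also have "\<dots> \<le> expectation (\<lambda>\<omega>. 1)"
    using inverse_subordinator_nonneg[of S t] assms
    by (intro integral_mono integrable_norm integrable_exp_L) (auto simp: mult_nonpos_nonneg)
  finally show ?thesis by (simp add: prob_space)
qed

lemma exp_moment_continuous:
  assumes "Re z \<le> 0"
  shows "((\<lambda>r. exp_moment_inverse Q S r z) \<longlongrightarrow> exp_moment_inverse Q S t z) (at t within I)"
  unfolding tendsto_at_iff_sequentially
proof (intro allI impI)
  fix X :: "nat \<Rightarrow> real" assume X: "\<forall>i. X i \<in> I - {t}" "X \<longlonglongrightarrow> t"
  have "(\<lambda>n. exp_moment_inverse Q S (X n) z) \<longlonglongrightarrow> exp_moment_inverse Q S t z"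
    unfolding exp_moment_inverse_def
  proof (rule integral_dominated_convergence[where w = "\<lambda>_. 1"])
    show "AE \<omega> in Q. (\<lambda>n. exp (z * of_real (L (X n) \<omega>))) \<longlonglongrightarrow> exp (z * of_real (L t \<omega>))"
      using AE_climbing_path
    proof eventually_elim
      case (elim \<omega>)
      have "filterlim X (at t) sequentially" using X by (auto simp: filterlim_at)
      then have "(\<lambda>n. L (X n) \<omega>) \<longlonglongrightarrow> L t \<omega>"
        by (rule filterlim_compose[OF inverse_subordinator_continuous[where S = S and \<omega> = \<omega>, OF elim]])
      then show ?case by (intro tendsto_intros)
    qed
    show "AE \<omega> in Q. norm (exp (z * of_real (L (X n) \<omega>))) \<le> 1" for n
      using assms inverse_subordinator_nonneg[of S "X n"] by (auto intro!: AE_I2 simp: mult_nonpos_nonneg)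
  qed auto
  then show "((\<lambda>r. exp_moment_inverse Q S r z) \<circ> X) \<longlonglongrightarrow> exp_moment_inverse Q S t z" by (simp add: comp_def)
qed

text \<open>The events \<open>S s > t\<close> increase with \<open>s\<close>, and their union over \<open>s < r\<close> is \<open>L t < r\<close> up to a null set. The
  law of the inverse is thereby expressed through the laws of single values of the subordinator.\<close>
lemma prob_L_less_limit:
  assumes "0 < r"
  shows "(\<lambda>n. prob {\<omega> \<in> space Q. t < S (r * (1 - 1 / real (n + 2))) \<omega>}) \<longlonglongrightarrow> prob {\<omega> \<in> space Q. L t \<omega> < r}"
proof -
  define \<rho> where "\<rho> n = r * (1 - 1 / real (n + 2))" for n :: nat
  have \<rho>: "0 < \<rho> n" "\<rho> n < r" for n
  proof -
    have "0 < 1 / real (n + 2)" "1 / real (n + 2) < 1" by simp_all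
    then have "0 < r * (1 - 1 / real (n + 2))" "0 < r * (1 / real (n + 2))"
      using assms by (intro mult_pos_pos; linarith)+
    then show "0 < \<rho> n" "\<rho> n < r" unfolding \<rho>_def right_diff_distrib by simp_all
  qed
  have inc: "\<rho> m \<le> \<rho> n" if "m \<le> n" for m n
    unfolding \<rho>_def using assms that by (intro mult_left_mono diff_left_mono divide_left_mono) auto
  have lim: "\<rho> \<longlonglongrightarrow> r"
    unfolding \<rho>_def by real_asymp
  let ?A = "\<lambda>n. {\<omega> \<in> space Q. t < S (\<rho> n) \<omega>}"
  have "incseq ?A"
  proof (rule incseq_SucI, safe)
    fix n \<omega> assume "\<omega> \<in> space Q" "t < S (\<rho> n) \<omega>"
    then show "t < S (\<rho> (Suc n)) \<omega>"
      using mono_onD[OF S_mono, of \<omega> "\<rho> n" "\<rho> (Suc n)"] inc[of n "Suc n"] \<rho>(1)[of n] \<rho>(1)[of "Suc n"] by auto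
  qed
  moreover have A: "range ?A \<subseteq> events" using S_set_measurable(1) \<rho>(1) by (auto intro: less_imp_le)
  ultimately have "(\<lambda>n. prob (?A n)) \<longlonglongrightarrow> prob (\<Union>n. ?A n)" by (intro finite_Lim_measure_incseq)
  also have "prob (\<Union>n. ?A n) = prob {\<omega> \<in> space Q. L t \<omega> < r}"
  proof (rule finite_measure_eq_AE)
    show "AE \<omega> in Q. \<omega> \<in> (\<Union>n. ?A n) \<longleftrightarrow> \<omega> \<in> {\<omega> \<in> space Q. L t \<omega> < r}"
      using AE_L_less_iff[of t] AE_space
    proof eventually_elim
      case (elim \<omega>)
      have "(\<exists>n. t < S (\<rho> n) \<omega>) \<longleftrightarrow> (\<exists>s. 0 < s \<and> s < r \<and> t < S s \<omega>)"
      proof safe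
        fix s assume s: "0 < s" "s < r" "t < S s \<omega>"
        obtain n where n: "s < \<rho> n" using order_tendstoD(1)[OF lim s(2)] by (auto simp: eventually_sequentially)
        have "S s \<omega> \<le> S (\<rho> n) \<omega>" using mono_onD[OF S_mono[OF elim(2)], of s "\<rho> n"] s n by auto
        then show "\<exists>n. t < S (\<rho> n) \<omega>" using s(3) by (intro exI[of _ n]) simp
      qed (use \<rho> in blast)
      then show ?case using elim by auto
    qed
    show "(\<Union>n. ?A n) \<in> events" using A by auto
    show "{\<omega> \<in> space Q. L t \<omega> < r} \<in> events" by (rule L_less_measurable)
  qed
  finally show ?thesis by (simp add: \<rho>_def)
qed

text \<open>The bounded variable \<open>exp (- S r)\<close> has the moments \<open>\<E> exp (- n S r)\<close>, given by the Laplace exponent; its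
  characteristic function is their exponential generating series.\<close>
lemma char_exp_S:
  assumes "0 \<le> r"
  shows "(\<lambda>n. (\<i> * of_real y) ^ n / fact n * of_real (exp (- r * \<Phi> (real n))))
    sums char (distr Q borel (\<lambda>\<omega>. exp (- S r \<omega>))) y"
proof -
  define U where "U \<omega> = exp (- S r \<omega>)" for \<omega>
  have Um: "U \<in> borel_measurable Q" unfolding U_def[abs_def] using S_measurable[OF assms] by simp
  have U: "0 \<le> U \<omega>" "U \<omega> \<le> 1" if "\<omega> \<in> space Q" for \<omega> using S_nonneg[OF that assms] by (auto simp: U_def)
  have Un: "U \<omega> ^ n = exp (- real n * S r \<omega>)" for n \<omega> by (simp add: U_def exp_of_nat_mult[symmetric])
  let ?f = "\<lambda>n \<omega>. (\<i> * of_real y) ^ n / fact n * of_real (U \<omega> ^ n)"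
  have ui: "integrable Q (\<lambda>\<omega>. U \<omega> ^ n)" for n unfolding Un by (rule integrable_exp_S) (use assms in auto)
  have int: "integrable Q (?f n)" for n by (intro integrable_mult_right integrable_of_real ui)
  have nf: "norm (?f n \<omega>) = \<bar>y\<bar> ^ n / fact n * U \<omega> ^ n" if "\<omega> \<in> space Q" for n \<omega>
    using U[OF that] by (simp add: norm_mult norm_power norm_divide)
  have nb: "norm (?f n \<omega>) \<le> \<bar>y\<bar> ^ n / fact n" if "\<omega> \<in> space Q" for n \<omega>
    unfolding nf[OF that] by (rule mult_left_le) (use U[OF that] in \<open>auto intro: power_le_one\<close>)
  have sy: "summable (\<lambda>n. \<bar>y\<bar> ^ n / fact n)" using summable_exp[of "\<bar>y\<bar>"] by (simp add: divide_inverse mult.commute)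
  have sums: "(\<lambda>n. expectation (?f n)) sums expectation (\<lambda>\<omega>. \<Sum>n. ?f n \<omega>)"
  proof (rule sums_integral[OF int])
    show "AE \<omega> in Q. summable (\<lambda>n. norm (?f n \<omega>))"
    proof (intro AE_I2)
      fix \<omega> assume w: "\<omega> \<in> space Q"
      show "summable (\<lambda>n. norm (?f n \<omega>))"
        by (rule summable_comparison_test'[OF sy, of 0]) (use nb[OF w] in simp)
    qed
    show "summable (\<lambda>n. expectation (\<lambda>\<omega>. norm (?f n \<omega>)))"
    proof (rule summable_comparison_test'[OF sy, of 0])
      fix n
      have "expectation (\<lambda>\<omega>. norm (?f n \<omega>)) \<le> expectation (\<lambda>\<omega>. \<bar>y\<bar> ^ n / fact n)"
        by (intro integral_mono integrable_norm int nb) auto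
      then show "norm (expectation (\<lambda>\<omega>. norm (?f n \<omega>))) \<le> \<bar>y\<bar> ^ n / fact n"
        by (simp add: prob_space abs_of_nonneg[OF Bochner_Integration.integral_nonneg])
    qed
  qed
  have ef: "expectation (?f n) = (\<i> * of_real y) ^ n / fact n * of_real (exp (- r * \<Phi> (real n)))" for n
  proof -
    have "expectation (?f n) = (\<i> * of_real y) ^ n / fact n * of_real (expectation (\<lambda>\<omega>. U \<omega> ^ n))"
      by (simp only: integral_mult_right_zero integral_complex_of_real)
    then show ?thesis unfolding Un using S_laplace[OF assms, of "real n"] by simp
  qed
  have sf: "(\<Sum>n. ?f n \<omega>) = exp (\<i> * of_real (y * U \<omega>))" for \<omega>
  proof -
    have "(\<lambda>n. (\<i> * of_real (y * U \<omega>)) ^ n /\<^sub>R fact n) sums exp (\<i> * of_real (y * U \<omega>))"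
      by (rule exp_converges)
    moreover have "(\<i> * of_real (y * U \<omega>)) ^ n /\<^sub>R fact n = ?f n \<omega>" for n
      by (simp add: power_mult_distrib scaleR_conv_of_real divide_inverse mult_ac)
    ultimately show ?thesis by (simp add: sums_iff)
  qed
  have ch: "char (distr Q borel U) y = expectation (\<lambda>\<omega>. exp (\<i> * of_real (y * U \<omega>)))"
    unfolding char_def by (subst integral_distr) (use Um in auto)
  show ?thesis using sums unfolding ef sf U_def[abs_def, symmetric] ch .
qed

end

text \<open>Uniqueness of characteristic functions, applied to \<open>exp (- S r)\<close>.\<close>
lemma subordinator_law_unique:
  assumes "levy_subordinator \<nu> Q S" "levy_subordinator \<nu> Q' S'" "0 \<le> r"
  shows "measure Q {\<omega> \<in> space Q. t < S r \<omega>} = measure Q' {\<omega> \<in> space Q'. t < S' r \<omega>}"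
proof -
  interpret A: levy_subordinator \<nu> Q S by fact
  interpret B: levy_subordinator \<nu> Q' S' by fact
  have "char (distr Q borel (\<lambda>\<omega>. exp (- S r \<omega>))) = char (distr Q' borel (\<lambda>\<omega>. exp (- S' r \<omega>)))"
    using sums_unique2[OF A.char_exp_S[OF assms(3)] B.char_exp_S[OF assms(3)]] by (rule ext)
  then have eq: "distr Q borel (\<lambda>\<omega>. exp (- S r \<omega>)) = distr Q' borel (\<lambda>\<omega>. exp (- S' r \<omega>))"
    using A.S_measurable[OF assms(3)] B.S_measurable[OF assms(3)]
    by (intro Levy_uniqueness A.real_distribution_distr B.real_distribution_distr) auto
  have "measure Q {\<omega> \<in> space Q. t < S r \<omega>} = measure (distr Q borel (\<lambda>\<omega>. exp (- S r \<omega>))) {..<exp (- t)}"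
    using A.S_measurable[OF assms(3)] by (simp add: measure_distr vimage_def Int_def conj_commute)
  also have "\<dots> = measure Q' {\<omega> \<in> space Q'. t < S' r \<omega>}"
    unfolding eq using B.S_measurable[OF assms(3)] by (simp add: measure_distr vimage_def Int_def conj_commute)
  finally show ?thesis .
qed

lemma exp_moment_unique:
  assumes "levy_subordinator \<nu> Q S" "levy_subordinator \<nu> Q' S'"
  shows "exp_moment_inverse Q S t z = exp_moment_inverse Q' S' t z"
proof -
  interpret A: levy_subordinator \<nu> Q S by fact
  interpret B: levy_subordinator \<nu> Q' S' by fact
  have less: "A.prob {\<omega> \<in> space Q. A.L t \<omega> < r} = B.prob {\<omega> \<in> space Q'. B.L t \<omega> < r}" for r
  proof (cases "0 < r")
    case True
    have "0 \<le> r * (1 - 1 / real (n + 2))" for n using True by (simp add: field_simps)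
    then show ?thesis
      using A.prob_L_less_limit[OF True, of t] B.prob_L_less_limit[OF True, of t]
      by (simp only: subordinator_law_unique[OF assms]) (rule LIMSEQ_unique)
  next
    case False
    then have "\<not> A.L t \<omega> < r" "\<not> B.L t \<omega>' < r" for \<omega> \<omega>'
      using inverse_subordinator_nonneg[of S t \<omega>] inverse_subordinator_nonneg[of S' t \<omega>'] by linarith+
    then have "{\<omega> \<in> space Q. A.L t \<omega> < r} = {}" "{\<omega> \<in> space Q'. B.L t \<omega> < r} = {}" by auto
    then show ?thesis by (simp only: measure_empty)
  qed
  have eq: "distr Q borel (\<lambda>\<omega>. - A.L t \<omega>) = distr Q' borel (\<lambda>\<omega>. - B.L t \<omega>)"
  proof (rule measure_eqI_lessThan)
    fix y
    have s: "(\<lambda>\<omega>. - A.L t \<omega>) -` {y<..} \<inter> space Q = {\<omega> \<in> space Q. A.L t \<omega> < - y}"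
      "(\<lambda>\<omega>. - B.L t \<omega>) -` {y<..} \<inter> space Q' = {\<omega> \<in> space Q'. B.L t \<omega> < - y}" by auto
    show "emeasure (distr Q borel (\<lambda>\<omega>. - A.L t \<omega>)) {y<..} < \<infinity>"
      by (simp add: emeasure_distr s A.emeasure_eq_measure)
    show "emeasure (distr Q borel (\<lambda>\<omega>. - A.L t \<omega>)) {y<..} = emeasure (distr Q' borel (\<lambda>\<omega>. - B.L t \<omega>)) {y<..}"
      by (simp add: emeasure_distr s A.emeasure_eq_measure B.emeasure_eq_measure less)
  qed auto
  have "exp_moment_inverse Q S t z = (LINT y|distr Q borel (\<lambda>\<omega>. - A.L t \<omega>). exp (- z * of_real y))"
    unfolding exp_moment_inverse_def by (subst integral_distr) auto
  also have "\<dots> = exp_moment_inverse Q' S' t z"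
    unfolding exp_moment_inverse_def eq by (subst integral_distr) auto
  finally show ?thesis .
qed

section \<open>The time-changed diffusion\<close>

locale time_changed_diffusion =
  fixes \<mu> :: real and \<nu> :: "real measure" and M :: "'w measure" and P :: "real^3 \<Rightarrow> 'w measure"
    and W :: "real \<Rightarrow> 'w \<Rightarrow> real^3" and S :: "real \<Rightarrow> 'w \<Rightarrow> real"
  assumes levy: "levy_measure \<nu>"
    and sub_M: "subordinator \<nu> M S"
    and diffusion: "spherical_BM_with_drift \<mu> M P W"
    and sub_P: "\<And>x. x \<in> S2 \<Longrightarrow> subordinator \<nu> (P x) S"
    and indep: "\<And>x. x \<in> S2 \<Longrightarrow> independent_processes (P x) W S"
begin

sublocale feller M P W
  using diffusion by unfold_locales (simp add: spherical_BM_with_drift_def)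

lemma levy_subordinatorI: "subordinator \<nu> Q S \<Longrightarrow> levy_subordinator \<nu> Q S"
  using levy by (auto simp: levy_subordinator_def levy_subordinator_axioms_def levy_def
      subordinator_def levy_process_def)

sublocale base: levy_subordinator \<nu> M S
  by (rule levy_subordinatorI[OF sub_M])

definition rate :: "nat \<Rightarrow> int \<Rightarrow> complex" where
  "rate l m = \<i> * of_real \<mu> * of_int m - of_nat (l * (l + 1))"

definition relaxation :: "real \<Rightarrow> nat \<Rightarrow> int \<Rightarrow> complex" where
  "relaxation t l m = exp_moment_inverse M S t (rate l m)"

definition law :: "real \<Rightarrow> real^3 \<Rightarrow> (real^3) measure" where
  "law t x = distr (P x) surface_measure (time_changed W S t)"

lemma Re_rate: "Re (rate l m) = - real (l * (l + 1))"
  by (simp add: rate_def)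

lemma Re_rate_nonpos: "Re (rate l m) \<le> 0"
  unfolding Re_rate by (simp only: neg_le_0_iff_le of_nat_0_le_iff)

lemma expectation_time_changed:
  assumes x: "x \<in> S2" and g: "continuous_on S2 g"
  shows "(\<lambda>\<omega>. g (time_changed W S t \<omega>)) \<in> borel_measurable (P x)"
    and "(LINT \<omega>|P x. g (time_changed W S t \<omega>)) = (LINT \<omega>|P x. T (inverse_subordinator S t \<omega>) g x)"
proof -
  interpret levy_subordinator \<nu> "P x" S by (rule levy_subordinatorI[OF sub_P[OF x]])
  have ind: "indep_set (process_events (P x) {0..} W) (process_events (P x) {0..} S)"
    using indep[OF x] by (simp add: independent_processes_def)
  obtain B where B: "\<And>y. y \<in> S2 \<Longrightarrow> cmod (g y) \<le> B"
    using continuous_bounded_S2[OF g] by blast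
  have WS2: "W s \<omega> \<in> S2" if "0 \<le> s" "\<omega> \<in> space (P x)" for s \<omega>
    using W_in_S2 that space_P[OF x] by simp
  have ev: "(\<lambda>\<omega>. g (W s \<omega>)) -` A \<inter> space (P x) \<in> process_events (P x) {0..} W"
    if "0 \<le> s" "A \<in> sets borel" for s A
  proof -
    have "g -` A \<inter> space (restrict_space borel S2) \<in> sets (restrict_space borel S2)"
      by (rule measurable_sets[OF borel_measurable_continuous_on_restrict[OF g] that(2)])
    then obtain A' where A': "A' \<in> sets borel" "g -` A \<inter> S2 = A' \<inter> S2"
      by (auto simp: space_restrict_space sets_restrict_space)
    have "(\<lambda>\<omega>. g (W s \<omega>)) -` A \<inter> space (P x) = W s -` A' \<inter> space (P x)"
      using A'(2) WS2[OF that(1)] by blast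
    then show ?thesis using process_events_basic[of s "{0..}" A' W "P x"] that A'(1) by simp
  qed
  have cont: "continuous_on {0..} (\<lambda>s. g (W s \<omega>))" if "\<omega> \<in> space (P x)" for \<omega>
    using W_continuous that WS2 space_P[OF x] by (intro continuous_on_compose2[OF g]) auto
  note rt = independent_random_time[OF ind process_events_sigma_algebra, of "\<lambda>s \<omega>. g (W s \<omega>)" B "L t"]
  show "(\<lambda>\<omega>. g (time_changed W S t \<omega>)) \<in> borel_measurable (P x)"
    unfolding time_changed_def
    by (rule rt(1)) (use g_W_measurable[OF x _ g] ev B WS2 cont L_less_event inverse_subordinator_nonneg in auto)
  have "expectation (\<lambda>\<omega>. g (W (L t \<omega>) \<omega>)) = expectation (\<lambda>\<omega>. expectation (\<lambda>\<omega>'. g (W (L t \<omega>) \<omega>')))"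
    by (rule rt(2)) (use g_W_measurable[OF x _ g] ev B WS2 cont L_less_event inverse_subordinator_nonneg in auto)
  then show "(LINT \<omega>|P x. g (time_changed W S t \<omega>)) = (LINT \<omega>|P x. T (L t \<omega>) g x)"
    by (simp add: time_changed_def transition_op_def)
qed

text \<open>Coordinate by coordinate, as the result on random times concerns scalar processes.\<close>
lemma time_changed_measurable:
  assumes x: "x \<in> S2"
  shows "time_changed W S t \<in> P x \<rightarrow>\<^sub>M surface_measure"
proof -
  have "time_changed W S t \<in> borel_measurable (P x)"
  proof (subst borel_measurable_euclidean_space, rule ballI)
    fix i :: "real^3"
    have "(\<lambda>\<omega>. complex_of_real (time_changed W S t \<omega> \<bullet> i)) \<in> borel_measurable (P x)"
      by (rule expectation_time_changed(1)[OF x, where g = "\<lambda>y. complex_of_real (y \<bullet> i)"]) (intro continuous_intros)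
    from measurable_compose[OF this borel_measurable_Re]
    show "(\<lambda>\<omega>. time_changed W S t \<omega> \<bullet> i) \<in> borel_measurable (P x)" by simp
  qed
  moreover have "time_changed W S t \<omega> \<in> S2" if "\<omega> \<in> space (P x)" for \<omega>
    using W_in_S2[OF inverse_subordinator_nonneg] that space_P[OF x] by (simp add: time_changed_def)
  ultimately have "time_changed W S t \<in> P x \<rightarrow>\<^sub>M restrict_space borel S2"
    by (intro measurable_restrict_space2) auto
  then show ?thesis by (simp cong: measurable_cong_sets)
qed

lemma law_integral:
  fixes g :: "real^3 \<Rightarrow> complex"
  assumes "x \<in> S2" "g \<in> borel_measurable surface_measure"
  shows "(LINT y|law t x. g y) = (LINT \<omega>|P x. g (time_changed W S t \<omega>))"
  unfolding law_def by (rule integral_distr[OF time_changed_measurable[OF assms(1)] assms(2)])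

text \<open>The multipliers refer to the law of the inverse under \<open>M\<close>, whereas the expectations are taken under
  \<open>P x\<close>; the two laws agree because the Laplace exponent is the same.\<close>
lemma law_kernel: "spherical_kernel (law t) (relaxation t)"
proof (rule spherical_kernel.intro)
  fix x :: "real^3" assume x: "x \<in> S2"
  interpret levy_subordinator \<nu> "P x" S by (rule levy_subordinatorI[OF sub_P[OF x]])
  show "prob_space (law t x)"
    unfolding law_def by (rule prob_space_distr[OF time_changed_measurable[OF x]])
  show "sets (law t x) = sets surface_measure" unfolding law_def by (rule sets_distr)
  fix l m assume m: "m \<in> {- int l..int l}"
  note c = continuous_on_sph_harm[OF m]
  have "(LINT y|law t x. sph_harm l m y) = (LINT \<omega>|P x. T (L t \<omega>) (sph_harm l m) x)"
    unfolding law_integral[OF x continuous_imp_measurable_surface[OF c]] by (rule expectation_time_changed(2)[OF x c])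
  also have "\<dots> = (LINT \<omega>|P x. exp (rate l m * of_real (L t \<omega>)) * sph_harm l m x)"
    unfolding transition_sph_harm[OF diffusion m x inverse_subordinator_nonneg] rate_def ..
  also have "\<dots> = exp_moment_inverse (P x) S t (rate l m) * sph_harm l m x"
    by (simp add: exp_moment_inverse_def)
  also have "exp_moment_inverse (P x) S t (rate l m) = relaxation t l m"
    unfolding relaxation_def
    by (rule exp_moment_unique) (rule levy_subordinator_axioms base.levy_subordinator_axioms)+
  finally show "(LINT y|law t x. sph_harm l m y) = relaxation t l m * sph_harm l m x" .
next
  show "relaxation t 0 0 = 1"
    by (simp add: relaxation_def rate_def exp_moment_inverse_def base.prob_space)
qed

lemma relaxation_le_1: "cmod (relaxation t l m) \<le> 1"
  unfolding relaxation_def by (rule base.exp_moment_le_1) (rule Re_rate_nonpos)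

lemma relaxation_continuous: "((\<lambda>r. relaxation r l m) \<longlongrightarrow> relaxation t l m) (at t within I)"
  unfolding relaxation_def by (rule base.exp_moment_continuous) (rule Re_rate_nonpos)

lemma relaxation_decay:
  assumes "0 < t"
  obtains C where "0 \<le> C" "\<And>r l m. t \<le> r \<Longrightarrow> (real l)\<^sup>2 * cmod (relaxation r l m) \<le> C"
proof
  define C where "C = (\<Sum>k. (real k + 1) * exp (- real k)) * (laplace_exponent \<nu> (1 / t) / (1 - exp (-1)))"
  show "0 \<le> max C 0" by simp
  fix r l m assume r: "t \<le> r"
  show "(real l)\<^sup>2 * cmod (relaxation r l m) \<le> max C 0"
  proof (cases "l = 0")
    case False
    then have pos: "0 < real (l * (l + 1))" by (simp only: of_nat_0_less_iff) simp
    have "cmod (relaxation r l m) \<le> C / real (l * (l + 1))"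
      unfolding relaxation_def C_def by (rule base.exp_moment_bound[OF assms r pos Re_rate])
    then have "real (l * (l + 1)) * cmod (relaxation r l m) \<le> C"
      using pos by (simp add: pos_le_divide_eq mult.commute)
    moreover have "(real l)\<^sup>2 * cmod (relaxation r l m) \<le> real (l * (l + 1)) * cmod (relaxation r l m)"
      by (intro mult_right_mono) (simp_all add: power2_eq_square algebra_simps)
    ultimately show ?thesis by linarith
  qed simp
qed

end

section \<open>Continuity in time\<close>

text \<open>Tannery's theorem, for the weights \<open>w = 1\<close> and \<open>w l = l\<^sup>4\<close> that describe convergence in \<open>L\<^sup>2\<close> and in
  \<open>H\<^sup>2\<close>; the dominating series is a multiple of the power spectrum of \<open>f\<close>.\<close>
lemma multiplier_sum_tendsto_0:
  fixes e :: "real \<Rightarrow> nat \<Rightarrow> int \<Rightarrow> complex" and w :: "nat \<Rightarrow> real"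
  assumes f: "L2 f"
    and lim: "\<And>l m. ((\<lambda>r. e r l m) \<longlongrightarrow> e t l m) F"
    and w: "\<And>l. 0 \<le> w l"
    and bound: "eventually (\<lambda>r. \<forall>l m. w l * (cmod (e r l m - e t l m))\<^sup>2 \<le> C) F"
    and F: "F \<noteq> bot"
  shows "((\<lambda>r. \<Sum>l. w l * (\<Sum>m\<in>{- int l..int l}. (cmod (fourier_laplace f l m * (e r l m - e t l m)))\<^sup>2)) \<longlongrightarrow> 0) F"
proof -
  let ?a = "\<lambda>l r. w l * (\<Sum>m\<in>{- int l..int l}. (cmod (fourier_laplace f l m * (e r l m - e t l m)))\<^sup>2)"
  have le: "\<bar>?a l r\<bar> \<le> C * power_spectrum f l" if "\<forall>l m. w l * (cmod (e r l m - e t l m))\<^sup>2 \<le> C" for l r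
  proof -
    have "?a l r = (\<Sum>m\<in>{- int l..int l}. (w l * (cmod (e r l m - e t l m))\<^sup>2) * (cmod (fourier_laplace f l m))\<^sup>2)"
      by (simp add: sum_distrib_left norm_mult power_mult_distrib mult_ac)
    also have "\<dots> \<le> (\<Sum>m\<in>{- int l..int l}. C * (cmod (fourier_laplace f l m))\<^sup>2)"
      using that by (intro sum_mono mult_right_mono) auto
    also have "\<dots> = C * power_spectrum f l" by (simp add: power_spectrum_def sum_distrib_left)
    finally show ?thesis using w[of l] by (simp add: abs_of_nonneg sum_nonneg)
  qed
  have "((\<lambda>r. \<Sum>l. ?a l r) \<longlongrightarrow> (\<Sum>l. 0)) F"
  proof (rule tannerys_theorem[where M = "\<lambda>l. C * power_spectrum f l", THEN conjunct2, THEN conjunct2])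
    show "((\<lambda>r. ?a l r) \<longlongrightarrow> 0) F" for l
    proof -
      have "((\<lambda>r. ?a l r) \<longlongrightarrow> w l * (\<Sum>m\<in>{- int l..int l}. (cmod (fourier_laplace f l m * (e t l m - e t l m)))\<^sup>2)) F"
        by (intro tendsto_intros lim)
      then show ?thesis by simp
    qed
    show "\<forall>\<^sub>F (l, r) in sequentially \<times>\<^sub>F F. norm (?a l r) \<le> C * power_spectrum f l"
      by (rule eventually_mono[OF eventually_prodI[OF eventually_True bound]]) (use le in \<open>auto simp: case_prod_unfold\<close>)
    show "summable (\<lambda>l. C * power_spectrum f l)"
      using Parseval[OF f] by (intro summable_mult) (rule sums_summable)
  qed (rule F)
  then show ?thesis by simp
qed

theorem theorem3p6:
  fixes \<mu> :: real
    and \<nu> :: "real measure"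
    and M :: "'w measure"
    and P :: "real^3 \<Rightarrow> 'w measure"
    and W :: "real \<Rightarrow> 'w \<Rightarrow> real^3"
    and S :: "real \<Rightarrow> 'w \<Rightarrow> real"
    and f :: "real^3 \<Rightarrow> complex"
    and u :: "real \<Rightarrow> real^3 \<Rightarrow> complex"
  assumes "levy_measure \<nu>"
    and "subordinator \<nu> M S"
    and "spherical_BM_with_drift \<mu> M P W"
    and "\<And>x. x \<in> S2 \<Longrightarrow> subordinator \<nu> (P x) S"
    and "\<And>x. x \<in> S2 \<Longrightarrow> independent_processes (P x) W S"
    and "L2 f"
    and "\<And>t x. t \<ge> 0 \<Longrightarrow> x \<in> S2 \<Longrightarrow> u t x = (LINT \<omega>|P x. f (time_changed W S t \<omega>))"
  shows "(\<forall>t\<ge>0.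
        (AE x in surface_measure. integrable (P x) (\<lambda>\<omega>. f (time_changed W S t \<omega>)))
        \<and> (\<lambda>N. L2_norm (\<lambda>x. u t x -
              (\<Sum>l\<le>N. \<Sum>m\<in>{- int l..int l}.
                fourier_laplace f l m
                * exp_moment_inverse M S t (\<i> * of_real \<mu> * of_int m - of_nat (l * (l + 1)))
                * sph_harm l m x))) \<longlonglongrightarrow> 0)
    \<and> continuous_curve L2 L2_norm {0..} u
    \<and> continuous_curve (Hs 2) (Hs_norm 2) {0<..} u"
proof -
  interpret time_changed_diffusion \<mu> \<nu> M P W S
    using assms(1-5) by unfold_locales
  note f = \<open>L2 f\<close>
  note fm = L2_measurable[OF f]
  define v where "v t = spherical_kernel.avg (law t) f" for t
  note ker = law_kernel
  have u: "u t x = v t x" if "t \<ge> 0" "x \<in> S2" for t x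
    unfolding v_def spherical_kernel.avg_def[OF ker] law_integral[OF that(2) fm] by (rule assms(7)[OF that])
  have vL2: "L2 (v t)" for t unfolding v_def by (rule spherical_kernel.avg_L2[OF ker f])
  have uL2: "L2 (u t)" if "t \<ge> 0" for t using vL2[of t] L2_cong(1)[of "u t" "v t"] u[OF that] by simp
  have fu: "fourier_laplace (u t) l m = fourier_laplace f l m * relaxation t l m"
    if "t \<ge> 0" "m \<in> {- int l..int l}" for t l m
    using L2_cong(3)[of "u t" "v t"] u[OF that(1)] spherical_kernel.fourier_laplace_avg[OF ker f that(2)]
    by (simp add: v_def)
  have fdiff: "fourier_laplace (\<lambda>x. u r x - u t x) l m = fourier_laplace f l m * (relaxation r l m - relaxation t l m)"
    if "r \<ge> 0" "t \<ge> 0" "m \<in> {- int l..int l}" for r t l m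
    unfolding fourier_laplace_diff[OF uL2[OF that(1)] uL2[OF that(2)] that(3)] fu[OF that(1,3)] fu[OF that(2,3)]
    by (simp add: algebra_simps)
  have psdiff: "power_spectrum (\<lambda>x. u r x - u t x) l
      = (\<Sum>m\<in>{- int l..int l}. (cmod (fourier_laplace f l m * (relaxation r l m - relaxation t l m)))\<^sup>2)"
    if "r \<ge> 0" "t \<ge> 0" for r t l
    unfolding power_spectrum_def by (intro sum.cong refl) (simp only: fdiff[OF that])
  have integrable: "AE x in surface_measure. integrable (P x) (\<lambda>\<omega>. f (time_changed W S t \<omega>))" for t
    using spherical_kernel.AE_square_integrable[OF ker[of t] f] AE_space
  proof eventually_elim
    case (elim x)
    then have "x \<in> S2" "integrable (law t x) f" by auto
    then show ?case unfolding law_def by (intro integrable_distr[OF time_changed_measurable])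
  qed
  have expansion: "(\<lambda>N. L2_norm (\<lambda>x. u t x - harm_sum N (\<lambda>l m. fourier_laplace f l m * relaxation t l m) x)) \<longlonglongrightarrow> 0"
    if t: "t \<ge> 0" for t
  proof -
    have "L2_norm (\<lambda>x. v t x - g x) = L2_norm (\<lambda>x. u t x - g x)" for g
      by (rule L2_cong(2)) (simp add: u[OF t])
    then show ?thesis using spherical_kernel.avg_expansion[OF ker[of t] f] by (simp only: v_def)
  qed
  have L2_cont: "((\<lambda>r. L2_norm (\<lambda>x. u r x - u t x)) \<longlongrightarrow> 0) (at t within I)" if t: "t \<ge> 0" and I: "I \<subseteq> {0..}" for t I
  proof (cases "at t within I = bot")
    case False
    have le: "1 * (cmod (relaxation r l m - relaxation t l m))\<^sup>2 \<le> 4" for r l m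
    proof -
      have "cmod (relaxation r l m - relaxation t l m) \<le> 2"
        using norm_triangle_ineq4[of "relaxation r l m" "relaxation t l m"] relaxation_le_1[of r l m] relaxation_le_1[of t l m]
        by linarith
      from power_mono[OF this, of 2] show ?thesis by simp
    qed
    have lim: "((\<lambda>r. \<Sum>l. 1 * (\<Sum>m\<in>{- int l..int l}. (cmod (fourier_laplace f l m * (relaxation r l m - relaxation t l m)))\<^sup>2)) \<longlongrightarrow> 0) (at t within I)"
      by (rule multiplier_sum_tendsto_0[where C = 4, OF f relaxation_continuous]) (use le False in auto)
    have "\<forall>\<^sub>F r in at t within I. (\<Sum>l. 1 * (\<Sum>m\<in>{- int l..int l}. (cmod (fourier_laplace f l m * (relaxation r l m - relaxation t l m)))\<^sup>2))
        = (L2_norm (\<lambda>x. u r x - u t x))\<^sup>2"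
    proof (rule eventually_mono[of "\<lambda>r. r \<in> I"])
      show "\<forall>\<^sub>F r in at t within I. r \<in> I" by (auto simp: eventually_at_filter)
      fix r assume "r \<in> I"
      then have r: "r \<ge> 0" using I by auto
      show "(\<Sum>l. 1 * (\<Sum>m\<in>{- int l..int l}. (cmod (fourier_laplace f l m * (relaxation r l m - relaxation t l m)))\<^sup>2))
        = (L2_norm (\<lambda>x. u r x - u t x))\<^sup>2"
        unfolding mult_1 psdiff[OF r t, symmetric]
        by (rule sums_unique[OF Parseval[OF L2_diff[OF uL2[OF r] uL2[OF t]]], symmetric])
    qed
    from Lim_transform_eventually[OF lim this]
    have "((\<lambda>r. (L2_norm (\<lambda>x. u r x - u t x))\<^sup>2) \<longlongrightarrow> 0) (at t within I)" .
    from tendsto_real_sqrt[OF this] show ?thesis by simp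
  qed simp
  have Hs: "Hs 2 (u t)" if t: "t > 0" for t
    unfolding Hs_def
  proof
    show "L2 (u t)" using uL2 t by simp
    obtain C where C: "0 \<le> C" "\<And>r l m. t \<le> r \<Longrightarrow> (real l)\<^sup>2 * cmod (relaxation r l m) \<le> C"
      by (rule relaxation_decay[OF t]) blast
    show "summable (\<lambda>l. real l powr (2 * 2) * power_spectrum (u t) l)"
    proof (rule summable_comparison_test'[where N = 0])
      show "summable (\<lambda>l. C\<^sup>2 * power_spectrum f l)" using Parseval[OF f] by (intro summable_mult) (rule sums_summable)
      fix l
      have "real l powr (2 * 2) * power_spectrum (u t) l
        = (\<Sum>m\<in>{- int l..int l}. ((real l)\<^sup>2 * cmod (relaxation t l m))\<^sup>2 * (cmod (fourier_laplace f l m))\<^sup>2)"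
        using t unfolding power_spectrum_def sum_distrib_left
        by (intro sum.cong refl) (simp add: fu norm_mult power_mult_distrib mult_ac powr_numeral flip: power_mult)
      also have "\<dots> \<le> (\<Sum>m\<in>{- int l..int l}. C\<^sup>2 * (cmod (fourier_laplace f l m))\<^sup>2)"
        using C by (intro sum_mono mult_right_mono power_mono) auto
      also have "\<dots> = C\<^sup>2 * power_spectrum f l" by (simp add: power_spectrum_def sum_distrib_left)
      finally show "norm (real l powr (2 * 2) * power_spectrum (u t) l) \<le> C\<^sup>2 * power_spectrum f l" by simp
    qed
  qed
  have Hs_cont: "((\<lambda>r. Hs_norm 2 (\<lambda>x. u r x - u t x)) \<longlongrightarrow> 0) (at t within {0<..})" if t: "t > 0" for t
  proof -
    have F: "at t within {0<..} \<noteq> bot"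
      using t by (simp add: at_within_open[of t "{0<..}"])
    \<comment> \<open>The decay is uniform only away from time \<open>0\<close>, so \<open>r\<close> is kept above \<open>t / 2\<close>.\<close>
    obtain C where C: "0 \<le> C" "\<And>r l m. t / 2 \<le> r \<Longrightarrow> (real l)\<^sup>2 * cmod (relaxation r l m) \<le> C"
      by (rule relaxation_decay[of "t / 2"]) (use t in auto)
    have ev: "\<forall>\<^sub>F r in at t within {0<..}. t / 2 < r"
      using order_tendstoD(1)[OF tendsto_ident_at, of "t / 2" t] t by simp
    have w: "real l powr (2 * 2) = ((real l)\<^sup>2)\<^sup>2" for l
      by (simp add: powr_numeral flip: power_mult)
    have le: "real l powr (2 * 2) * (cmod (relaxation r l m - relaxation t l m))\<^sup>2 \<le> (2 * C)\<^sup>2" if "t / 2 < r" for r l m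
    proof -
      have "(real l)\<^sup>2 * cmod (relaxation r l m - relaxation t l m)
          \<le> (real l)\<^sup>2 * (cmod (relaxation r l m) + cmod (relaxation t l m))"
        by (intro mult_left_mono norm_triangle_ineq4) simp
      also have "\<dots> \<le> 2 * C" using C(2)[of r l m] C(2)[of t l m] that t by (simp add: algebra_simps)
      finally have "((real l)\<^sup>2 * cmod (relaxation r l m - relaxation t l m))\<^sup>2 \<le> (2 * C)\<^sup>2"
        by (intro power_mono) auto
      then show ?thesis by (simp only: w power_mult_distrib)
    qed
    have lim: "((\<lambda>r. \<Sum>l. real l powr (2 * 2) * (\<Sum>m\<in>{- int l..int l}. (cmod (fourier_laplace f l m * (relaxation r l m - relaxation t l m)))\<^sup>2)) \<longlongrightarrow> 0) (at t within {0<..})"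
      by (rule multiplier_sum_tendsto_0[where C = "(2 * C)\<^sup>2", OF f relaxation_continuous _ eventually_mono[OF ev] F])
         (use le in auto)
    have "\<forall>\<^sub>F r in at t within {0<..}. (\<Sum>l. real l powr (2 * 2) * (\<Sum>m\<in>{- int l..int l}. (cmod (fourier_laplace f l m * (relaxation r l m - relaxation t l m)))\<^sup>2))
        = (\<Sum>l. real l powr (2 * 2) * power_spectrum (\<lambda>x. u r x - u t x) l)"
      using ev by eventually_elim (use t in \<open>simp only: psdiff\<close>)
    from tendsto_real_sqrt[OF Lim_transform_eventually[OF lim this]]
    have "((\<lambda>r. Hs_seminorm 2 (\<lambda>x. u r x - u t x)) \<longlongrightarrow> 0) (at t within {0<..})"
      by (simp add: Hs_seminorm_def)
    moreover have "((\<lambda>r. L2_norm (\<lambda>x. u r x - u t x)) \<longlongrightarrow> 0) (at t within {0<..})"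
      using t by (intro L2_cont) auto
    ultimately show ?thesis
      unfolding Hs_norm_def using tendsto_add[of _ 0 _ _ 0] by fastforce
  qed
  show ?thesis
    unfolding continuous_curve_def
    using integrable expansion[unfolded harm_sum_def relaxation_def rate_def] L2_cont uL2 Hs Hs_cont by simp
qed

end
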